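(* Let $F\in\mathbb{Z}_2[X]$ be a $*$-symmetric polynomial of even degree $2n$. There exists an even unimodular $\mathbb{Z}_2$-lattice of discriminant $1$ having a semisimple isometry with characteristic polynomial $F$ if and only if (a) $v_2(F(1))\equiv v_2(F(-1))\equiv0\pmod2$, and (b) if $F(1)F(-1)\ne0$ then $(-1)^nF(1)F(-1)=1$ in $\mathbb{Q}_2^\times/\mathbb{Q}_2^{\times2}$.
   Context: A monic polynomial $F$ with $F(0)\ne0$ is $*$-symmetric if $F(X)=F(0)^{-1}X^{\deg F}F(X^{-1})$. Convention: $v_2(0)\equiv0\pmod2$. A $\mathbb{Z}_2$-lattice is a free $\mathbb{Z}_2$-module $\Lambda$ of finite rank with a nondegenerate symmetric bilinear form $b$ with values in $\mathbb{Q}_2$; it is unimodular if $\Lambda^\vee=\{y\in\Lambda\otimes\mathbb{Q}_2: b(x,y)\in\mathbb{Z}_2\ \forall x\in\Lambda\}$ equals $\Lambda$, even if $b(x,x)\in2\mathbb{Z}_2$ for all $x$. The discriminant of a form of rank $d$ is $(-1)^{d(d-1)/2}\det b\in\mathbb{Q}_2^\times/\mathbb{Q}_2^{\times2}$. Semisimple means diagonalizable over an algebraic closure. *)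

theory Defs
  imports
    "HOL-Algebra.Algebraic_Closure_Type"
    "HOL-Computational_Algebra.Polynomial_Factorial"
    "Jordan_Normal_Form.Char_Poly"
begin

section \<open>The ring of 2-adic integers and its fraction field\<close>

text \<open>The inverse limit of the rings of integers modulo powers of 2. The equation below also
  forces \<open>0 \<le> x k < 2 ^ k\<close>, so \<open>x k\<close> is the canonical representative of the residue class
  modulo \<open>2 ^ k\<close>.\<close>

typedef z2 = "{x :: nat \<Rightarrow> int. \<forall>k. x k = x (Suc k) mod 2 ^ k}"
  morphisms res Abs_z2
  by (rule exI[of _ "\<lambda>_. 0"]) simp

setup_lifting type_definition_z2

lemma mod_pow_Suc: "(a mod 2 ^ Suc k) mod 2 ^ k = (a :: int) mod 2 ^ k"
  by (rule mod_mod_cancel) (simp add: le_imp_power_dvd)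

lemma res_Suc: "res x (Suc k) mod 2 ^ k = res x k"
  by (rule CollectD[OF res[of x], rule_format, symmetric])

lemma res_mod: "res x k mod 2 ^ k = res x k"
  by (metis res_Suc mod_mod_trivial)

lemma res_add_index: "res x (k + j) mod 2 ^ k = res x k"
proof (induction j)
  case 0
  show ?case by (simp add: res_mod)
next
  case (Suc j)
  have "res x (k + j) mod 2 ^ k = (res x (Suc (k + j)) mod 2 ^ (k + j)) mod 2 ^ k"
    by (simp add: res_Suc)
  also have "\<dots> = res x (Suc (k + j)) mod 2 ^ k"
    by (rule mod_mod_cancel) (simp add: le_imp_power_dvd)
  finally show ?case using Suc by simp
qed

lemma z2_eqI: "(\<And>k. res x k = res y k) \<Longrightarrow> x = y"
  by (rule iffD1[OF res_inject]) (rule ext)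

lemma compatible_op:
  fixes f :: "int \<Rightarrow> int \<Rightarrow> int"
  assumes "\<And>a b m. f (a mod m) (b mod m) mod m = f a b mod m"
    and "\<And>k. x k = x (Suc k) mod 2 ^ k" "\<And>k. y k = y (Suc k) mod 2 ^ k"
  shows "f (x k) (y k) mod 2 ^ k = f (x (Suc k)) (y (Suc k)) mod 2 ^ Suc k mod 2 ^ k"
proof -
  have "f (x k) (y k) = f (x (Suc k) mod 2 ^ k) (y (Suc k) mod 2 ^ k)"
    by (rule arg_cong2[where f = f, OF assms(2) assms(3)])
  then show "f (x k) (y k) mod 2 ^ k = f (x (Suc k)) (y (Suc k)) mod 2 ^ Suc k mod 2 ^ k"
    by (simp only: assms(1) mod_pow_Suc)
qed

instantiation z2 :: comm_ring_1
begin

lift_definition zero_z2 :: z2 is "\<lambda>_. 0" by simp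

lift_definition one_z2 :: z2 is "\<lambda>k. 1 mod 2 ^ k"
  by (simp only: mod_pow_Suc simp_thms)

lift_definition plus_z2 :: "z2 \<Rightarrow> z2 \<Rightarrow> z2" is "\<lambda>x y k. (x k + y k) mod 2 ^ k"
  by (rule compatible_op[of "(+)", OF mod_add_eq])

lift_definition minus_z2 :: "z2 \<Rightarrow> z2 \<Rightarrow> z2" is "\<lambda>x y k. (x k - y k) mod 2 ^ k"
  by (rule compatible_op[of "(-)", OF mod_diff_eq])

lift_definition uminus_z2 :: "z2 \<Rightarrow> z2" is "\<lambda>x k. (- x k) mod 2 ^ k"
  by (rule compatible_op[of "\<lambda>a _. - a", OF mod_minus_eq])

lift_definition times_z2 :: "z2 \<Rightarrow> z2 \<Rightarrow> z2" is "\<lambda>x y k. (x k * y k) mod 2 ^ k"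
  by (rule compatible_op[of "(*)", OF mod_mult_eq])

lemmas res_simps = zero_z2.rep_eq one_z2.rep_eq plus_z2.rep_eq minus_z2.rep_eq
  uminus_z2.rep_eq times_z2.rep_eq

instance
proof
  fix a b c :: z2
  show "a * b * c = a * (b * c)"
    by (rule z2_eqI) (simp only: res_simps mod_mult_left_eq mod_mult_right_eq mult.assoc)
  show "a * b = b * a"
    by (rule z2_eqI) (simp only: res_simps mult.commute)
  show "1 * a = a"
    by (rule z2_eqI) (simp only: res_simps mod_mult_left_eq mult_1 res_mod)
  show "a + b + c = a + (b + c)"
    by (rule z2_eqI) (simp only: res_simps mod_add_left_eq mod_add_right_eq add.assoc)
  show "a + b = b + a"
    by (rule z2_eqI) (simp only: res_simps add.commute)
  show "0 + a = a"
    by (rule z2_eqI) (simp only: res_simps add_0 res_mod)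
  show "- a + a = 0"
    by (rule z2_eqI) (simp only: res_simps mod_add_left_eq left_minus mod_0)
  show "a - b = a + - b"
    by (rule z2_eqI) (simp only: res_simps mod_add_right_eq diff_conv_add_uminus)
  show "(a + b) * c = a * c + b * c"
    by (rule z2_eqI) (simp only: res_simps mod_mult_left_eq mod_add_eq distrib_right)
  have "res 0 1 \<noteq> res 1 1"
    by (simp add: res_simps)
  then show "(0 :: z2) \<noteq> 1"
    by metis
qed

end

lemma not_pow2_dvd_mult:
  fixes a b :: int
  assumes "\<not> 2 ^ i dvd a" "\<not> 2 ^ j dvd b"
  shows "\<not> 2 ^ (i + j) dvd a * b"
proof
  assume d: "2 ^ (i + j) dvd a * b"
  have "a \<noteq> 0" "b \<noteq> 0" using assms by auto
  have "multiplicity 2 (a * b) = multiplicity 2 a + multiplicity 2 b"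
    using \<open>a \<noteq> 0\<close> \<open>b \<noteq> 0\<close> by (intro prime_elem_multiplicity_mult_distrib) auto
  moreover have "multiplicity 2 a < i" "multiplicity 2 b < j"
    using assms multiplicity_dvd'[of _ 2] by (meson not_less)+
  moreover have "i + j \<le> multiplicity 2 (a * b)"
    using d \<open>a \<noteq> 0\<close> \<open>b \<noteq> 0\<close> by (intro multiplicity_geI) auto
  ultimately show False by simp
qed

instance z2 :: idom
proof
  fix x y :: z2
  assume "x \<noteq> 0" "y \<noteq> 0"
  then obtain i j where ij: "res x i \<noteq> 0" "res y j \<noteq> 0"
    using z2_eqI[of x 0] z2_eqI[of y 0] by (auto simp: zero_z2.rep_eq)
  have "\<not> 2 ^ i dvd res x (i + j)" "\<not> 2 ^ j dvd res y (i + j)"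
    using ij res_add_index[of x i j] res_add_index[of y j i]
    by (auto simp: dvd_eq_mod_eq_0 add.commute)
  then have "\<not> 2 ^ (i + j) dvd res x (i + j) * res y (i + j)"
    by (rule not_pow2_dvd_mult)
  then have "res (x * y) (i + j) \<noteq> 0"
    by (simp add: times_z2.rep_eq dvd_eq_mod_eq_0)
  then show "x * y \<noteq> 0"
    by (metis zero_z2.rep_eq)
qed

type_synonym q2 = "z2 fract"

text \<open>The 2-adic valuation on 2-adic integers; the value at 0 follows the convention that
  \<open>v2 0\<close> is even.\<close>

definition v2 :: "z2 \<Rightarrow> nat" where
  "v2 x = (if x = 0 then 0 else (GREATEST k. 2 ^ k dvd x))"

definition same_square_class :: "q2 \<Rightarrow> q2 \<Rightarrow> bool" where
  "same_square_class a c \<longleftrightarrow> a \<noteq> 0 \<and> c \<noteq> 0 \<and> (\<exists>s. s \<noteq> 0 \<and> a = c * s\<^sup>2)"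


section \<open>Symmetric polynomials\<close>

text \<open>\<open>reflect_poly F\<close> is \<open>X\<close> to the power \<open>degree F\<close> times \<open>F (1 / X)\<close>.\<close>

definition star_symmetric :: "'a :: field poly \<Rightarrow> bool" where
  "star_symmetric F \<longleftrightarrow>
     lead_coeff F = 1 \<and> poly F 0 \<noteq> 0 \<and> F = smult (inverse (poly F 0)) (reflect_poly F)"


section \<open>Lattices over the 2-adic integers\<close>

text \<open>A free module of rank \<open>d\<close> is taken to be the coordinate module of column vectors of
  length \<open>d\<close>; only the values of \<open>b\<close> on that carrier matter.\<close>

locale z2_lattice =
  fixes d :: nat and b :: "z2 vec \<Rightarrow> z2 vec \<Rightarrow> q2"
  assumes add_left: "\<lbrakk>x \<in> carrier_vec d; y \<in> carrier_vec d; z \<in> carrier_vec d\<rbrakk>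
      \<Longrightarrow> b (x + y) z = b x z + b y z"
    and smult_left: "\<lbrakk>x \<in> carrier_vec d; y \<in> carrier_vec d\<rbrakk>
      \<Longrightarrow> b (c \<cdot>\<^sub>v x) y = to_fract c * b x y"
    and sym: "\<lbrakk>x \<in> carrier_vec d; y \<in> carrier_vec d\<rbrakk> \<Longrightarrow> b x y = b y x"
    and nondegenerate: "\<lbrakk>x \<in> carrier_vec d; \<And>y. y \<in> carrier_vec d \<Longrightarrow> b x y = 0\<rbrakk>
      \<Longrightarrow> x = 0\<^sub>v d"

definition gram :: "nat \<Rightarrow> (z2 vec \<Rightarrow> z2 vec \<Rightarrow> q2) \<Rightarrow> q2 mat" where
  "gram d b = mat d d (\<lambda>(i, j). b (unit_vec d i) (unit_vec d j))"

text \<open>The extension of \<open>b\<close> to the vector space obtained by tensoring with \<^typ>\<open>q2\<close>.\<close>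

definition form_ext :: "nat \<Rightarrow> (z2 vec \<Rightarrow> z2 vec \<Rightarrow> q2) \<Rightarrow> q2 vec \<Rightarrow> q2 vec \<Rightarrow> q2" where
  "form_ext d b x y = x \<bullet> (gram d b *\<^sub>v y)"

definition lattice_in_ext :: "nat \<Rightarrow> q2 vec set" where
  "lattice_in_ext d = map_vec to_fract ` (carrier_vec d :: z2 vec set)"

definition dual_lattice :: "nat \<Rightarrow> (z2 vec \<Rightarrow> z2 vec \<Rightarrow> q2) \<Rightarrow> q2 vec set" where
  "dual_lattice d b =
     {y \<in> carrier_vec d. \<forall>x \<in> lattice_in_ext d. form_ext d b x y \<in> range to_fract}"

definition unimodular :: "nat \<Rightarrow> (z2 vec \<Rightarrow> z2 vec \<Rightarrow> q2) \<Rightarrow> bool" where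
  "unimodular d b \<longleftrightarrow> dual_lattice d b = lattice_in_ext d"

definition even_lattice :: "nat \<Rightarrow> (z2 vec \<Rightarrow> z2 vec \<Rightarrow> q2) \<Rightarrow> bool" where
  "even_lattice d b \<longleftrightarrow> (\<forall>x \<in> carrier_vec d. \<exists>z. b x x = to_fract (2 * z))"

text \<open>A representative of the discriminant, which is a class modulo nonzero squares.\<close>

definition disc :: "nat \<Rightarrow> (z2 vec \<Rightarrow> z2 vec \<Rightarrow> q2) \<Rightarrow> q2" where
  "disc d b = (- 1) ^ (d * (d - 1) div 2) * det (gram d b)"

text \<open>The endomorphisms of the coordinate module are the square matrices \<open>T\<close>.\<close>

definition isometry :: "nat \<Rightarrow> (z2 vec \<Rightarrow> z2 vec \<Rightarrow> q2) \<Rightarrow> z2 mat \<Rightarrow> bool" where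
  "isometry d b T \<longleftrightarrow> T \<in> carrier_mat d d \<and>
     bij_betw (\<lambda>x. T *\<^sub>v x) (carrier_vec d) (carrier_vec d) \<and>
     (\<forall>x \<in> carrier_vec d. \<forall>y \<in> carrier_vec d. b (T *\<^sub>v x) (T *\<^sub>v y) = b x y)"

definition semisimple :: "z2 mat \<Rightarrow> bool" where
  "semisimple T \<longleftrightarrow>
     (\<exists>D :: q2 alg_closure mat. diagonal_mat D \<and>
        similar_mat (map_mat (\<lambda>x. to_ac (to_fract x)) T) D)"

end

theory Submission
  imports Defs
begin

text \<open>
  Necessity: let \<open>G\<close> be the Gram matrix and \<open>F(1) \<noteq> 0\<close>. The Cayley-type matrix
  \<open>W = (G (1 - T))\<^sup>-\<^sup>1\<close> satisfies \<open>W + W\<^sup>t = G\<^sup>-\<^sup>1\<close>, which is integral with even diagonal. Hence \<open>W\<close> is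
  the sum of an integral and an alternating matrix, its elementary divisors with poles come in
  pairs, and the valuation of \<open>det W\<close>, which is that of \<open>F(1)\<close> up to sign, is even. The same applies
  to \<open>-T\<close> and \<open>F(-1)\<close>. The determinant of the alternating matrix \<open>G T - T\<^sup>t G\<close>, a square, equals
  \<open>det G F(1) F(-1)\<close>, which gives (b).

  Sufficiency: an irreducible factor \<open>H\<close> whose square divides \<open>F\<close> allows splitting off a hyperbolic
  factor \<open>H H\<^sup>*\<close>, and induction reduces to nearly separable \<open>F\<close>. If \<open>F(0) = -1\<close>, then \<open>F\<close> is the
  characteristic polynomial of multiplication by \<open>X\<close> on \<open>\<int>\<^sub>2[X] / F\<close>, which preserves the form
  \<open>X\<^sup>i, X\<^sup>j \<mapsto> c\<^sub>i\<^sub>-\<^sub>j\<close>; here \<open>c\<close> is the even solution of the recurrence with characteristic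
  polynomial \<open>F\<close> such that \<open>c\<^sub>k = 0\<close> for \<open>\<bar>k\<bar> < n\<close> and \<open>c\<^sub>n = 1\<close>, and the form is even and unimodular of
  discriminant 1. For \<open>F(0) = 1\<close> one starts with the form of \<open>(X\<^sup>2 - 1) P\<close>, where \<open>P\<close> is \<open>F\<close> without
  its roots 1 and -1. The eigenvectors \<open>(X \<plusminus> 1) P\<close> have norms \<open>2 P(1)\<close> and
  \<open>-2 (-1)\<^sup>m P(-1)\<close>, with \<open>2m\<close> the degree of \<open>P\<close>; by (a) and (b) these differ from prescribed unit
  multiples of 2 by squares, so that eigenvectors can be exchanged or cancelled in a neighbouring
  lattice.
\<close>

section \<open>Arithmetic of the 2-adic integers\<close>

text \<open>The construction is split by the sign of F(0) because of the symmetric sequence c.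
  Between -n and n the recurrence involves only the two outermost values, both 1, and reads F(0) + 1
  = 0, so the sign -1 is forced there. In even degree this sign also forces the roots 1 and -1,
  which makes (a) and (b) vacuous. Multiplication by X^2 - 1 turns the sign 1 into -1, at the price
  of two extra eigenvectors that have to be removed again; only their norms matter, and here (a) and
  (b) enter. Semisimplicity rules out companion matrices as the general answer: they are
  diagonalizable only for separable polynomials, so repeated factors have to be spread over
  orthogonal summands. Splitting off H H* preserves (a) and (b) as long as each root 1 or -1 of H is
  also a root of the cofactor: if H(1) = 0, then F(1) = 0 says nothing about the cofactor at 1. This
  is why (X - 1)^2 P with P(1) nonzero requires a construction of its own.\<close>

lemma res_2_pow: "res (2 ^ k) j = 2 ^ k mod 2 ^ j"
proof (induction k)
  case (Suc k)
  have "res (2 :: z2) j = 2 mod 2 ^ j"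
    by (simp only: one_add_one[symmetric] res_simps mod_add_eq)
  then show ?case using Suc by (simp add: times_z2.rep_eq mod_mult_eq)
qed (simp add: one_z2.rep_eq)

text \<open>The residues of the quotient are those of x moved by k places:
  \<open>res x (k + j)\<close> divided by \<open>2 ^ k\<close> is still determined modulo
  \<open>2 ^ j\<close>.\<close>

lemma pow2_dvd_iff: "2 ^ k dvd (x :: z2) \<longleftrightarrow> res x k = 0"
proof
  assume "2 ^ k dvd x"
  then obtain y where "x = 2 ^ k * y" by (elim dvdE)
  then show "res x k = 0" by (simp add: times_z2.rep_eq res_2_pow)
next
  assume 0: "res x k = 0"
  have d: "2 ^ k dvd res x (k + j)" for j
    using res_add_index[of x k j] 0 by (simp add: dvd_eq_mod_eq_0)
  define y where "y = Abs_z2 (\<lambda>j. res x (k + j) div 2 ^ k)"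
  have "res x (k + j) div 2 ^ k = (res x (k + Suc j) div 2 ^ k) mod 2 ^ j" for j
  proof -
    have "res x (k + j) = res x (k + Suc j) mod (2 ^ k * 2 ^ j)"
      using res_Suc[of x "k + j"] by (simp add: power_add)
    then show ?thesis by (simp add: zmod_zmult2_eq)
  qed
  then have "(\<lambda>j. res x (k + j) div 2 ^ k) \<in> {x. \<forall>k. x k = x (Suc k) mod 2 ^ k}" by blast
  then have y: "res y j = res x (k + j) div 2 ^ k" for j
    unfolding y_def by (simp only: Abs_z2_inverse)
  have "x = 2 ^ k * y"
  proof (rule z2_eqI)
    fix j
    have "res (2 ^ k * y) j = (2 ^ k * (res x (k + j) div 2 ^ k)) mod 2 ^ j"
      by (simp add: times_z2.rep_eq res_2_pow y mod_mult_left_eq)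
    also have "\<dots> = res x (k + j) mod 2 ^ j" using d by simp
    also have "\<dots> = res x j" using res_add_index[of x j k] by (simp add: add.commute)
    finally show "res x j = res (2 ^ k * y) j" ..
  qed
  then show "2 ^ k dvd x" by simp
qed

lemma res_1_cases: "res x (Suc 0) = 0 \<or> res x (Suc 0) = 1"
proof -
  have "res x (Suc 0) mod 2 = res x (Suc 0)" using res_mod[of x "Suc 0"] by simp
  then show ?thesis by (metis not_mod_2_eq_1_eq_0)
qed

text \<open>An odd number is invertible modulo every power of 2. These inverses are unique, hence
  compatible, and define a 2-adic integer.\<close>

lemma z2_unit_iff: "(u :: z2) dvd 1 \<longleftrightarrow> \<not> 2 dvd u"
proof
  assume "u dvd 1"
  then obtain w where "1 = u * w" by (elim dvdE)
  then have "res (u * w) (Suc 0) = 1" by (metis one_z2.rep_eq mod_less one_mod_two_eq_one power_one_right One_nat_def)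
  then have "res u (Suc 0) \<noteq> 0" by (auto simp: times_z2.rep_eq)
  then show "\<not> 2 dvd u" using pow2_dvd_iff[of 1 u] by simp
next
  assume "\<not> 2 dvd u"
  then have u1: "res u (Suc 0) = 1" using pow2_dvd_iff[of 1 u] res_1_cases[of u] by auto
  have odd: "odd (res u (Suc k))" for k
    using res_add_index[of u 1 k] u1 by (auto simp: odd_iff_mod_2_eq_one)
  have "\<exists>y. (res u k * y) mod 2 ^ k = 1 mod 2 ^ k" for k
  proof (cases k)
    case (Suc m)
    have "coprime (res u k) (2 ^ k)" using odd[of m] Suc by simp
    then obtain a b where "a * res u k + b * 2 ^ k = 1"
      using bezout_int[of "res u k" "2 ^ k"] by auto
    then have "(res u k * a) mod 2 ^ k = 1 mod 2 ^ k"
      by (metis mod_mult_self1 mult.commute)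
    then show ?thesis by blast
  qed simp
  then obtain f where f: "\<And>k. (res u k * f k) mod 2 ^ k = 1 mod 2 ^ k" by metis
  define w where "w = Abs_z2 (\<lambda>k. f k mod 2 ^ k)"
  have "f k mod 2 ^ k = (f (Suc k) mod 2 ^ Suc k) mod 2 ^ k" for k
  proof -
    have "(res u (Suc k) * f (Suc k)) mod 2 ^ k = 1 mod 2 ^ k"
      using f[of "Suc k"] mod_pow_Suc by metis
    then have e: "(res u k * f (Suc k)) mod 2 ^ k = 1 mod 2 ^ k"
      using res_Suc[of u k] by (metis mod_mult_left_eq)
    have "f k mod 2 ^ k = (f k * (res u k * f (Suc k))) mod 2 ^ k"
      by (metis e mod_mult_right_eq mult.right_neutral)
    also have "\<dots> = ((res u k * f k) * f (Suc k)) mod 2 ^ k" by (simp add: ac_simps)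
    also have "\<dots> = f (Suc k) mod 2 ^ k"
      by (metis f mod_mult_left_eq mult_1)
    finally show ?thesis by (simp only: mod_pow_Suc)
  qed
  then have "(\<lambda>k. f k mod 2 ^ k) \<in> {x. \<forall>k. x k = x (Suc k) mod 2 ^ k}" by blast
  then have w: "res w k = f k mod 2 ^ k" for k
    unfolding w_def by (simp only: Abs_z2_inverse)
  have "u * w = 1"
    by (rule z2_eqI) (simp only: times_z2.rep_eq w mod_mult_right_eq f one_z2.rep_eq)
  then show "u dvd 1" by (metis dvd_triv_left)
qed

lemma two_dvd_diff: "\<not> 2 dvd x \<Longrightarrow> \<not> 2 dvd y \<Longrightarrow> 2 dvd (x - y :: z2)"
  using pow2_dvd_iff[of 1] res_1_cases[of x] res_1_cases[of y] by (auto simp: minus_z2.rep_eq)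

lemma two_dvd_mult: "2 dvd x * y \<longleftrightarrow> 2 dvd x \<or> 2 dvd (y :: z2)"
  using z2_unit_iff[of x] z2_unit_iff[of y] z2_unit_iff[of "x * y"] is_unit_mult_iff[of x y] by blast

lemma prime_elem_2_z2: "prime_elem (2 :: z2)"
proof (rule prime_elemI)
  show "(2 :: z2) \<noteq> 0"
  proof
    assume "(2 :: z2) = 0"
    then have "res (2 :: z2) 2 = 0" by (simp add: zero_z2.rep_eq)
    moreover have "res (2 :: z2) 2 = 2"
      by (simp only: one_add_one[symmetric] res_simps) simp
    ultimately show False by simp
  qed
  show "\<not> (2 :: z2) dvd 1" using z2_unit_iff[of 1] by simp
qed (simp add: two_dvd_mult)

lemma two_neq_0 [simp]: "(2 :: z2) \<noteq> 0"
  using prime_elem_2_z2 by (rule prime_elem_not_zeroI)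

lemma z2_factor:
  assumes "x \<noteq> (0 :: z2)"
  obtains k u where "u dvd 1" "x = 2 ^ k * u"
proof -
  obtain j where "res x j \<noteq> 0" using assms z2_eqI[of x 0] by (auto simp: zero_z2.rep_eq)
  then have nj: "\<not> 2 ^ j dvd x" by (simp add: pow2_dvd_iff)
  define k where "k = (GREATEST k. 2 ^ k dvd x)"
  have b: "i \<le> j" if "2 ^ i dvd x" for i
    using nj that power_le_dvd[of 2 i x j] by (meson nat_le_linear)
  have k: "2 ^ k dvd x" unfolding k_def
    by (rule GreatestI_nat[of _ 0 j]) (use b in auto)
  then obtain u where u: "x = 2 ^ k * u" by (elim dvdE)
  have "\<not> 2 dvd u"
  proof
    assume "2 dvd u"
    then have "2 ^ Suc k dvd x" using u by (auto simp: mult.assoc)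
    then have "Suc k \<le> k" unfolding k_def by (intro Greatest_le_nat[of _ _ j]) (use b in auto)
    then show False by simp
  qed
  then show thesis using that u z2_unit_iff by blast
qed

lemma v2_pow2_times_unit:
  assumes "(u :: z2) dvd 1"
  shows "v2 (2 ^ k * u) = k"
proof -
  have n: "\<not> 2 dvd u" using assms z2_unit_iff by blast
  have "i \<le> k" if "2 ^ i dvd 2 ^ k * u" for i
  proof (rule ccontr)
    assume "\<not> i \<le> k"
    then have "2 ^ Suc k dvd 2 ^ k * u" using that by (meson not_less_eq_eq power_le_dvd)
    then have "2 dvd u" by (simp add: mult.commute)
    then show False using n by simp
  qed
  then have "(GREATEST i. 2 ^ i dvd 2 ^ k * u) = k" by (intro Greatest_equality) auto
  moreover have "u \<noteq> 0" using n by auto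
  ultimately show ?thesis by (simp add: v2_def)
qed

text \<open>The form in which condition (a) enters the constructions: the power of 4 is absorbed by
  rescaling vectors, and the unit remains.\<close>

lemma even_v2_iff:
  "even (v2 x) \<longleftrightarrow> x = 0 \<or> (\<exists>e u. u dvd 1 \<and> x = 4 ^ e * u)"
proof (cases "x = 0")
  case False
  then obtain k u where ku: "u dvd 1" "x = 2 ^ k * u" by (rule z2_factor)
  have 4: "(4 :: z2) ^ e = 2 ^ (2 * e)" for e by (simp add: power_mult)
  show ?thesis
  proof
    assume "even (v2 x)"
    then obtain e where "k = 2 * e" using ku v2_pow2_times_unit by (auto elim: evenE)
    then show "x = 0 \<or> (\<exists>e u. u dvd 1 \<and> x = 4 ^ e * u)" using ku 4 by metis
  next
    assume "x = 0 \<or> (\<exists>e u. u dvd 1 \<and> x = 4 ^ e * u)"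
    then obtain e w where "w dvd 1" "x = 2 ^ (2 * e) * w" using False 4 by auto
    then show "even (v2 x)" by (simp add: v2_pow2_times_unit)
  qed
qed (simp add: v2_def)

instance z2 :: ring_char_0
proof
  \<comment> \<open>Since n is less than \<open>2 ^ n\<close>, its residue modulo
    \<open>2 ^ n\<close> is n itself.\<close>
  have "of_nat n \<noteq> (0 :: z2)" if "n > 0" for n
  proof
    assume "of_nat n = (0 :: z2)"
    then have "res (of_nat n) n = 0" by (simp add: zero_z2.rep_eq)
    moreover have "res (of_nat m) k = int m mod 2 ^ k" for m k
      by (induction m) (simp_all add: res_simps mod_add_eq mod_add_left_eq mod_add_right_eq add.commute)
    moreover have "int n < 2 ^ n" by (metis of_nat_less_two_power)
    ultimately show False using that by simp
  qed
  then have "of_nat m = (of_nat n :: z2) \<Longrightarrow> m \<le> n" for m n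
    by (metis add_cancel_left_right le_add_diff_inverse nat_le_linear not_gr_zero of_nat_add diff_is_0_eq)
  then show "inj (of_nat :: nat \<Rightarrow> z2)" by (intro injI) (metis dual_order.antisym)
qed

instance fract :: ("{idom,ring_char_0}") field_char_0
proof
  have "of_nat n = to_fract (of_nat n :: 'a)" for n by (induction n) auto
  then show "inj (of_nat :: nat \<Rightarrow> 'a fract)" by (auto intro!: injI)
qed

section \<open>The valuation ring in the field of 2-adic numbers\<close>

definition O2 :: "q2 set" where "O2 = range to_fract"

lemma to_fract_in_O2 [simp, intro]: "to_fract x \<in> O2" by (simp add: O2_def)

lemma O2_E: "x \<in> O2 \<Longrightarrow> (\<And>y. x = to_fract y \<Longrightarrow> P) \<Longrightarrow> P" by (auto simp: O2_def)

lemma to_fract_power [simp]: "to_fract (x ^ n) = to_fract x ^ n"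
  by (induction n) auto

lemma to_fract_of_nat [simp]: "to_fract (of_nat n) = of_nat n"
  by (induction n) auto

lemma to_fract_numeral [simp]: "to_fract (numeral n) = numeral n"
  using to_fract_of_nat[of "numeral n"] by simp

lemma O2_0 [simp, intro]: "0 \<in> O2" using to_fract_in_O2[of 0] by (simp del: to_fract_in_O2)
lemma O2_1 [simp, intro]: "1 \<in> O2" using to_fract_in_O2[of 1] by (simp del: to_fract_in_O2)
lemma O2_numeral [simp, intro]: "numeral n \<in> O2" using to_fract_in_O2[of "numeral n"] by (simp del: to_fract_in_O2)
lemma O2_add [intro]: "x \<in> O2 \<Longrightarrow> y \<in> O2 \<Longrightarrow> x + y \<in> O2"
  unfolding O2_def by (metis (no_types) rangeE rangeI to_fract_add)
lemma O2_diff [intro]: "x \<in> O2 \<Longrightarrow> y \<in> O2 \<Longrightarrow> x - y \<in> O2"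
  unfolding O2_def by (metis (no_types) rangeE rangeI to_fract_diff)
lemma O2_mult [intro]: "x \<in> O2 \<Longrightarrow> y \<in> O2 \<Longrightarrow> x * y \<in> O2"
  unfolding O2_def by (metis (no_types) rangeE rangeI to_fract_mult)
lemma O2_uminus [intro]: "x \<in> O2 \<Longrightarrow> - x \<in> O2"
  unfolding O2_def by (metis (no_types) rangeE rangeI to_fract_uminus)
lemma O2_uminus_iff [simp]: "- x \<in> O2 \<longleftrightarrow> x \<in> O2"
  using O2_uminus[of x] O2_uminus[of "- x"] by auto
lemma O2_power [intro]: "x \<in> O2 \<Longrightarrow> x ^ n \<in> O2" by (induction n) auto
lemma O2_sum [intro]: "(\<And>i. i \<in> A \<Longrightarrow> f i \<in> O2) \<Longrightarrow> sum f A \<in> O2"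
  by (induction A rule: infinite_finite_induct) auto
lemma to_fract_unit_inverse: "u dvd 1 \<Longrightarrow> inverse (to_fract u) \<in> O2"
  by (metis dvdE inverse_unique to_fract_1 to_fract_in_O2 to_fract_mult)

lemma q2_factor:
  assumes "x \<noteq> (0 :: q2)"
  obtains u k l where "u dvd 1" "x = to_fract u * 2 ^ k / 2 ^ l"
proof -
  obtain a b where ab: "b \<noteq> 0" "x = Fract a b" by (cases x)
  then have x: "x = to_fract a / to_fract b" by (simp add: Fract_conv_to_fract)
  then have "a \<noteq> 0" using assms by auto
  obtain k u where ku: "u dvd 1" "a = 2 ^ k * u" using \<open>a \<noteq> 0\<close> by (rule z2_factor)
  obtain l w where lw: "w dvd 1" "b = 2 ^ l * w" using \<open>b \<noteq> 0\<close> by (rule z2_factor)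
  obtain w' where w': "1 = w * w'" using lw by (elim dvdE)
  have w0: "to_fract w * to_fract w' = 1" by (metis w' to_fract_1 to_fract_mult)
  then have nz: "to_fract w \<noteq> 0" by auto
  have "u * w' dvd 1" using ku w' by (metis dvd_triv_right is_unit_mult_iff)
  moreover have "x = to_fract (u * w') * 2 ^ k / 2 ^ l"
    unfolding x ku lw using w0 nz by (simp add: field_simps)
  ultimately show thesis using that by blast
qed

text \<open>The valuation ring property in a sharp form: the inverse of an element with a pole lies
  in the maximal ideal. The factor 2 is what later turns pivot determinants into squares times
  units.\<close>

lemma O2_valuation: "x \<in> O2 \<or> (\<exists>y\<in>O2. inverse x = 2 * y)"
proof (cases "x = 0")
  case False
  then obtain u k l where u: "u dvd 1" "x = to_fract u * 2 ^ k / 2 ^ l" by (rule q2_factor)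
  have nz: "to_fract u \<noteq> 0" using u False by auto
  show ?thesis
  proof (cases "l \<le> k")
    case True
    then have "x = to_fract u * 2 ^ (k - l)" using u by (simp add: power_diff)
    then show ?thesis by auto
  next
    case False
    then obtain d where d: "l = Suc (k + d)" using less_imp_Suc_add not_le by blast
    have "inverse x = 2 * (2 ^ d * inverse (to_fract u))"
      unfolding u(2) d using nz by (simp add: field_simps power_add)
    then show ?thesis using to_fract_unit_inverse u by blast
  qed
qed simp

text \<open>If x had a pole, its inverse would be integral, and so would x as the product of x^2
  with this inverse.\<close>

lemma O2_square_root:
  assumes "x\<^sup>2 \<in> O2" shows "x \<in> O2"
proof (rule ccontr)
  assume n: "x \<notin> O2"
  then obtain y where y: "y \<in> O2" "inverse x = 2 * y" using O2_valuation by blast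
  have "x \<noteq> 0" using n by auto
  have "x = x\<^sup>2 * inverse x" using \<open>x \<noteq> 0\<close> by (simp add: power2_eq_square)
  then show False using n y assms by (metis O2_mult O2_numeral)
qed

section \<open>Schur complements of two-dimensional principal blocks\<close>

lemma mult_mat_index: "A \<in> carrier_mat n m \<Longrightarrow> B \<in> carrier_mat m k \<Longrightarrow> i < n \<Longrightarrow> j < k \<Longrightarrow>
  (A * B) $$ (i, j) = (\<Sum>l = 0..<m. A $$ (i, l) * B $$ (l, j))"
  by (auto simp: scalar_prod_def intro!: sum.cong)

text \<open>Block elimination: a lower unitriangular factor \<open>?L\<close> times an upper block
  triangular factor \<open>?R\<close>.\<close>

lemma det_four_block_schur:
  fixes A :: "'a :: idom mat"
  assumes c: "A \<in> carrier_mat n n" "B \<in> carrier_mat n m" "C \<in> carrier_mat m n" "D \<in> carrier_mat m m"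
    and A': "A' \<in> carrier_mat n n" "A' * A = 1\<^sub>m n"
  shows "det (four_block_mat A B C D) = det A * det (D - C * A' * B)"
proof -
  let ?L = "four_block_mat (1\<^sub>m n) (0\<^sub>m n m) (C * A') (1\<^sub>m m)"
  let ?R = "four_block_mat A B (0\<^sub>m m n) (D - C * A' * B)"
  have CA: "C * A' \<in> carrier_mat m n" using c A' by auto
  have S: "D - C * A' * B \<in> carrier_mat m m" using c A' by auto
  have e1: "1\<^sub>m n * A + 0\<^sub>m n m * 0\<^sub>m m n = A" using c by auto
  have e2: "1\<^sub>m n * B + 0\<^sub>m n m * (D - C * A' * B) = B" using c S by auto
  have e3: "C * A' * A + 1\<^sub>m m * 0\<^sub>m m n = C" using c A'
    by (simp add: assoc_mult_mat[of C m n A' n A n])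
  have e4: "C * A' * B + 1\<^sub>m m * (D - C * A' * B) = D"
    using c A' S by (intro eq_matI) auto
  have "?L * ?R = four_block_mat A B C D"
    by (subst mult_four_block_mat[OF one_carrier_mat zero_carrier_mat CA one_carrier_mat c(1,2) zero_carrier_mat S])
       (simp only: e1 e2 e3 e4)
  then have "det (four_block_mat A B C D) = det ?L * det ?R"
    using c CA S by (metis det_mult four_block_carrier_mat one_carrier_mat)
  also have "det ?L = 1"
    by (subst det_four_block_mat_upper_right_zero[OF _ refl CA]) auto
  also have "det ?R = det A * det (D - C * A' * B)"
    by (rule det_four_block_mat_lower_left_zero[OF c(1,2) refl S])
  finally show ?thesis by simp
qed

lemma det_dim_2:
  fixes A :: "'a :: idom mat"
  assumes A: "A \<in> carrier_mat 2 2"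
  shows "det A = A $$ (0, 0) * A $$ (Suc 0, Suc 0) - A $$ (0, Suc 0) * A $$ (Suc 0, 0)"
proof -
  let ?b = "\<lambda>i j. mat 1 1 (\<lambda>_. A $$ (i, j)) :: 'a mat"
  have b: "?b i j \<in> carrier_mat 1 1" for i j by simp
  have "A = four_block_mat (?b 0 0) (?b 0 (Suc 0)) (?b (Suc 0) 0) (?b (Suc 0) (Suc 0))"
    using A by (intro eq_matI) (auto simp: less_Suc_eq numeral_2_eq_2)
  moreover have comm: "?b i j * ?b k l = ?b k l * ?b i j" for i j k l
    by (auto simp: scalar_prod_def mult.commute intro!: eq_matI)
  ultimately have "det A = det (?b 0 0 * ?b (Suc 0) (Suc 0) - ?b 0 (Suc 0) * ?b (Suc 0) 0)"
    using det_four_block_mat[OF b b b b] comm by metis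
  also have "\<dots> = (?b 0 0 * ?b (Suc 0) (Suc 0) - ?b 0 (Suc 0) * ?b (Suc 0) 0) $$ (0, 0)"
    by (rule det_single) auto
  finally show ?thesis by (simp add: scalar_prod_def)
qed

text \<open>The sign of the permutation occurs twice, once for rows and once for columns.\<close>

lemma det_permute_rows_cols:
  fixes A :: "'a :: idom mat"
  assumes A: "A \<in> carrier_mat d d" and p: "p permutes {0..<d}"
  shows "det (mat d d (\<lambda>(i, j). A $$ (p i, p j))) = det A"
proof -
  have lt: "i < d \<Longrightarrow> p i < d" for i using permutes_in_image[OF p, of i] by auto
  let ?R = "mat d d (\<lambda>(i, j). A $$ (p i, j))"
  have R: "transpose_mat ?R \<in> carrier_mat d d" by auto
  have "mat d d (\<lambda>(i, j). A $$ (p i, p j))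
      = transpose_mat (mat d d (\<lambda>(i, j). transpose_mat ?R $$ (p i, j)))"
    using A lt by (intro eq_matI) auto
  then have "det (mat d d (\<lambda>(i, j). A $$ (p i, p j)))
      = det (mat d d (\<lambda>(i, j). transpose_mat ?R $$ (p i, j)))"
    by (metis det_transpose mat_carrier)
  also have "\<dots> = signof p * det (transpose_mat ?R)" by (rule det_permute_rows[OF R p])
  also have "det (transpose_mat ?R) = det ?R" by (rule det_transpose) auto
  also have "det ?R = signof p * det A" by (rule det_permute_rows[OF A p])
  finally show ?thesis by (cases p rule: sign_cases) auto
qed

text \<open>Here a, b, c, d form the pivot block, x and y lie in a row beside it, v and w in a
  column below it. With D the determinant of the block the error term on the right vanishes.\<close>

lemma two_dim_pivot_identity:
  fixes a b c d x y v w t D :: "'a :: field"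
  assumes "D \<noteq> 0"
  shows "t - x * v - y * w - ((x * d - y * c) / D) * - (a * v + b * w)
      - ((y * a - x * b) / D) * - (c * v + d * w) = t + (x * v + y * w) * ((a * d - b * c) / D - 1)"
  using assms by (simp add: field_simps)

lemma two_dim_inverse_identity:
  fixes a b c d D :: "'a :: field"
  assumes "D = a * d - b * c" "D \<noteq> 0"
  shows "d * a / D - b * c / D = 1" "a * d / D - c * b / D = 1"
  using assms by (simp_all add: field_simps)

text \<open>Elimination with the principal block at i and j as pivot. The entries of the Schur
  complement are spelled out because its users have to recognize them as alternating or as nearly
  integral. The last clause, that a Schur complement is inverse to the complementary block of the
  inverse, carries the integrality of an inverse through an induction.\<close>

lemma pivot_step:
  fixes A :: "'a :: field mat"
  assumes A: "A \<in> carrier_mat d d" and ij: "i < d" "j < d" "i \<noteq> j"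
    and D: "D = A $$ (i, i) * A $$ (j, j) - A $$ (i, j) * A $$ (j, i)" "D \<noteq> 0"
  obtains e f Y where "d = e + 2" "bij_betw f {0..<e} ({0..<d} - {i, j})"
    "Y \<in> carrier_mat e e"
    "\<forall>k<e. \<forall>l<e. Y $$ (k, l) = A $$ (f k, f l) -
        (A $$ (f k, i) * (A $$ (j, j) * A $$ (i, f l) - A $$ (i, j) * A $$ (j, f l)) +
         A $$ (f k, j) * (A $$ (i, i) * A $$ (j, f l) - A $$ (j, i) * A $$ (i, f l))) / D"
    "det A = D * det Y"
    "\<forall>V\<in>carrier_mat d d. A * V = 1\<^sub>m d \<longrightarrow>
        Y * mat e e (\<lambda>(k, l). V $$ (f k, f l)) = 1\<^sub>m e"
proof -
  define e where "e = d - 2"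
  have de: "d = e + 2" using ij unfolding e_def by linarith
  have "card {0..<e} = card ({0..<d} - {i, j})" using ij by (simp add: de card_Diff_subset)
  then obtain f where f: "bij_betw f {0..<e} ({0..<d} - {i, j})"
    using finite_same_card_bij[of "{0..<e}" "{0..<d} - {i, j}"] by auto
  have fd: "f k < d" "f k \<noteq> i" "f k \<noteq> j" if "k < e" for k
    using bij_betwE[OF f] that by auto
  have finj: "f k = f l \<longleftrightarrow> k = l" if "k < e" "l < e" for k l
    using bij_betw_imp_inj_on[OF f] that by (auto simp: inj_on_def)
  define Y where "Y = mat e e (\<lambda>(k, l). A $$ (f k, f l) -
        (A $$ (f k, i) * (A $$ (j, j) * A $$ (i, f l) - A $$ (i, j) * A $$ (j, f l)) +
         A $$ (f k, j) * (A $$ (i, i) * A $$ (j, f l) - A $$ (j, i) * A $$ (i, f l))) / D)"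
  have Y: "Y \<in> carrier_mat e e" by (simp add: Y_def)
  \<comment> \<open>Brings the two pivot indices to the front. Beyond d it is the identity, as
    \<open>permutes\<close> demands.\<close>
  define p where "p k = (if k = 0 then i else if k = 1 then j else if k < d then f (k - 2) else k)" for k
  have p01: "p 0 = i" "p (Suc 0) = j" by (auto simp: p_def)
  have pf: "p (k + 2) = f k" if "k < e" for k using that by (simp add: p_def de)
  have split: "x = 0 \<or> x = Suc 0 \<or> (\<exists>k<e. x = k + 2)" if "x < d" for x
    using that de by presburger
  have "inj_on p {0..<d}"
  proof (rule inj_onI)
    fix x y assume "x \<in> {0..<d}" "y \<in> {0..<d}" and e: "p x = p y"
    then have "x < d" "y < d" by auto
    then consider "x = 0" | "x = Suc 0" | k where "k < e" "x = k + 2" using split by blast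
    then show "x = y"
    proof cases
      case 1
      then show ?thesis using split[OF \<open>y < d\<close>] e p01 pf fd(2) ij(3) by metis
    next
      case 2
      then show ?thesis using split[OF \<open>y < d\<close>] e p01 pf fd(3) ij(3) by metis
    next
      case (3 k)
      then show ?thesis using split[OF \<open>y < d\<close>] e p01 pf fd finj by metis
    qed
  qed
  moreover have "p ` {0..<d} \<subseteq> {0..<d}"
  proof
    fix z assume "z \<in> p ` {0..<d}"
    then obtain x where "x < d" "z = p x" by auto
    then show "z \<in> {0..<d}" using split[of x] p01 pf fd(1) ij(1,2) by auto
  qed
  ultimately have "bij_betw p {0..<d} {0..<d}"
    by (simp add: bij_betw_def endo_inj_surj)
  then have p: "p permutes {0..<d}" by (rule bij_imp_permutes) (auto simp: p_def de)
  let ?P = "mat d d (\<lambda>(i, j). A $$ (p i, p j))"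
  let ?A1 = "mat 2 2 (\<lambda>(k, l). A $$ (p k, p l))"
  let ?A2 = "mat 2 e (\<lambda>(k, l). A $$ (p k, f l))"
  let ?A3 = "mat e 2 (\<lambda>(k, l). A $$ (f k, p l))"
  let ?A4 = "mat e e (\<lambda>(k, l). A $$ (f k, f l))"
  \<comment> \<open>The adjugate of the pivot block divided by its determinant.\<close>
  let ?I = "mat 2 2 (\<lambda>(k, l). (if k = 0 then if l = 0 then A $$ (j, j) else - A $$ (i, j)
      else if l = 0 then - A $$ (j, i) else A $$ (i, i)) / D)"
  have two: "k < 2 \<longleftrightarrow> k = 0 \<or> k = Suc 0" for k :: nat by auto
  have blocks: "?P = four_block_mat ?A1 ?A2 ?A3 ?A4"
    by (rule eq_matI) (auto simp: de p_def)
  have s2: "(\<Sum>x = 0..<2. g x) = g 0 + g (Suc 0)" for g :: "nat \<Rightarrow> 'a" by (simp add: numeral_2_eq_2)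
  have inv: "?I * ?A1 = 1\<^sub>m 2"
  proof (rule eq_matI)
    fix k l assume "k < dim_row (1\<^sub>m 2)" "l < dim_col (1\<^sub>m 2)"
    then have "k = 0 \<or> k = Suc 0" "l = 0 \<or> l = Suc 0" by auto
    moreover note two_dim_inverse_identity[OF D]
    ultimately show "(?I * ?A1) $$ (k, l) = 1\<^sub>m 2 $$ (k, l)"
      by (elim disjE) (simp_all add: scalar_prod_def s2 p01)
  qed auto
  have Ys: "?A4 - ?A3 * ?I * ?A2 = Y"
  proof (rule eq_matI)
    fix k l assume "k < dim_row Y" "l < dim_col Y"
    then have kl: "k < e" "l < e" using Y by auto
    have "(?A4 - ?A3 * ?I * ?A2) $$ (k, l) = A $$ (f k, f l)
        - ((A $$ (f k, i) * (A $$ (j, j) / D) + A $$ (f k, j) * (- A $$ (j, i) / D)) * A $$ (i, f l)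
         + (A $$ (f k, i) * (- A $$ (i, j) / D) + A $$ (f k, j) * (A $$ (i, i) / D)) * A $$ (j, f l))"
      using kl by (simp add: scalar_prod_def s2 p01)
    also have "\<dots> = Y $$ (k, l)" using kl D(2) by (simp add: Y_def field_simps)
    finally show "(?A4 - ?A3 * ?I * ?A2) $$ (k, l) = Y $$ (k, l)" .
  qed (auto simp: Y_def)
  have d1: "det ?A1 = D"
    by (subst det_dim_2) (auto simp: p01 D)
  have "det A = det ?P" by (rule det_permute_rows_cols[OF A p, symmetric])
  also have "\<dots> = det ?A1 * det (?A4 - ?A3 * ?I * ?A2)"
    unfolding blocks by (rule det_four_block_schur) (use inv in auto)
  finally have detA: "det A = D * det Y" by (simp add: Ys d1)
  have inverse_block: "Y * mat e e (\<lambda>(k, l). V $$ (f k, f l)) = 1\<^sub>m e"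
    if V: "V \<in> carrier_mat d d" "A * V = 1\<^sub>m d" for V
  proof -
    have row: "A $$ (r, i) * V $$ (i, s) + A $$ (r, j) * V $$ (j, s)
        + (\<Sum>l = 0..<e. A $$ (r, f l) * V $$ (f l, s)) = (if r = s then 1 else 0)"
      if "r < d" "s < d" for r s
    proof -
      have "(if r = s then 1 else 0) = (A * V) $$ (r, s)" using V that by simp
      also have "\<dots> = (\<Sum>c\<in>{0..<d}. A $$ (r, c) * V $$ (c, s))"
        by (rule mult_mat_index[OF A V(1)]) (use that in auto)
      also have "\<dots> = A $$ (r, i) * V $$ (i, s) + (\<Sum>c\<in>{0..<d} - {i}. A $$ (r, c) * V $$ (c, s))"
        using ij by (intro sum.remove) auto
      also have "(\<Sum>c\<in>{0..<d} - {i}. A $$ (r, c) * V $$ (c, s))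
          = A $$ (r, j) * V $$ (j, s) + (\<Sum>c\<in>{0..<d} - {i} - {j}. A $$ (r, c) * V $$ (c, s))"
        using ij by (intro sum.remove) auto
      also have "{0..<d} - {i} - {j} = {0..<d} - {i, j}" by auto
      also have "(\<Sum>c\<in>{0..<d} - {i, j}. A $$ (r, c) * V $$ (c, s))
          = (\<Sum>l\<in>{0..<e}. A $$ (r, f l) * V $$ (f l, s))"
        by (rule sum.reindex_bij_betw[OF f, symmetric])
      finally show ?thesis by (simp add: add.assoc)
    qed
    show "Y * mat e e (\<lambda>(k, l). V $$ (f k, f l)) = 1\<^sub>m e"
    proof (rule eq_matI)
      fix k m assume "k < dim_row (1\<^sub>m e)" "m < dim_col (1\<^sub>m e)"
      then have km: "k < e" "m < e" by auto
      let ?V = "\<lambda>l. V $$ (f l, f m)"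
      let ?S = "\<lambda>r. \<Sum>l = 0..<e. A $$ (r, f l) * ?V l"
      let ?a = "A $$ (i, i)" and ?b = "A $$ (i, j)" and ?c = "A $$ (j, i)" and ?d = "A $$ (j, j)"
      let ?x = "A $$ (f k, i)" and ?y = "A $$ (f k, j)"
      have move: "x + y + z = t \<Longrightarrow> z = t - x - y"
        and move0: "x + y + z = 0 \<Longrightarrow> z = - (x + y)" for x y z t :: 'a
        by (simp_all add: algebra_simps eq_neg_iff_add_eq_0)
      \<comment> \<open>The equation A V = 1 expresses the sums over the other columns by the two
        pivot rows of V. For the rows i and j its right side is 0, since \<open>f m\<close> avoids
        both.\<close>
      have Sk: "?S (f k) = (if k = m then 1 else 0) - ?x * V $$ (i, f m) - ?y * V $$ (j, f m)"
        by (rule move, subst row) (use fd km finj[of k m] in auto)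
      have Si: "?S i = - (?a * V $$ (i, f m) + ?b * V $$ (j, f m))"
        by (rule move0, subst row) (use ij fd[of m] km in auto)
      have Sj: "?S j = - (?c * V $$ (i, f m) + ?d * V $$ (j, f m))"
        by (rule move0, subst row) (use ij fd[of m] km in auto)
      have "(Y * mat e e (\<lambda>(k, l). V $$ (f k, f l))) $$ (k, m) = (\<Sum>l = 0..<e. Y $$ (k, l) * ?V l)"
        using km by (subst mult_mat_index[OF Y]) auto
      also have "\<dots> = (\<Sum>l = 0..<e. A $$ (f k, f l) * ?V l
          - ((?x * ?d - ?y * ?c) / D) * (A $$ (i, f l) * ?V l)
          - ((?y * ?a - ?x * ?b) / D) * (A $$ (j, f l) * ?V l))"
      proof (rule sum.cong)
        fix l assume l: "l \<in> {0..<e}"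
        have "Y $$ (k, l) = A $$ (f k, f l) - ((?x * ?d - ?y * ?c) / D) * A $$ (i, f l)
            - ((?y * ?a - ?x * ?b) / D) * A $$ (j, f l)"
          using km l D(2) by (simp add: Y_def field_simps)
        show "Y $$ (k, l) * ?V l = A $$ (f k, f l) * ?V l
          - ((?x * ?d - ?y * ?c) / D) * (A $$ (i, f l) * ?V l)
          - ((?y * ?a - ?x * ?b) / D) * (A $$ (j, f l) * ?V l)"
          unfolding \<open>Y $$ (k, l) = _\<close> by (simp only: left_diff_distrib mult.assoc)
      qed simp
      also have "\<dots> = ?S (f k) - ((?x * ?d - ?y * ?c) / D) * ?S i - ((?y * ?a - ?x * ?b) / D) * ?S j"
        by (simp only: sum_subtractf sum_distrib_left)
      also have "\<dots> = (if k = m then 1 else 0) - ?x * V $$ (i, f m) - ?y * V $$ (j, f m)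
          - ((?x * ?d - ?y * ?c) / D) * - (?a * V $$ (i, f m) + ?b * V $$ (j, f m))
          - ((?y * ?a - ?x * ?b) / D) * - (?c * V $$ (i, f m) + ?d * V $$ (j, f m))"
        unfolding Sk Si Sj ..
      also have "\<dots> = (if k = m then 1 else 0) + (?x * V $$ (i, f m) + ?y * V $$ (j, f m)) * ((?a * ?d - ?b * ?c) / D - 1)"
        by (rule two_dim_pivot_identity[OF D(2)])
      also have "\<dots> = (if k = m then 1 else 0)" using D by simp
      finally show "(Y * mat e e (\<lambda>(k, l). V $$ (f k, f l))) $$ (k, m) = 1\<^sub>m e $$ (k, m)"
        using km by simp
    qed (auto simp: Y_def)
  qed
  show thesis
    by (rule that[OF de f Y _ detA]) (simp add: Y_def, use inverse_block in blast)
qed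

text \<open>The root is the Pfaffian up to sign. A nonzero entry at (i, j) gives a pivot block whose
  determinant is the square of this entry, and the Schur complement is again alternating.\<close>

lemma det_alternating_square:
  fixes A :: "'a :: field mat"
  assumes "A \<in> carrier_mat d d" "\<And>k. k < d \<Longrightarrow> A $$ (k, k) = 0"
    and "\<And>k l. k < d \<Longrightarrow> l < d \<Longrightarrow> A $$ (k, l) = - A $$ (l, k)"
  shows "\<exists>s. det A = s\<^sup>2"
  using assms
proof (induction d arbitrary: A rule: less_induct)
  case (less d)
  show ?case
  proof (cases "\<exists>i<d. \<exists>j<d. A $$ (i, j) \<noteq> 0")
    case False
    then have A0: "A = 0\<^sub>m d d" using less.prems(1) by (intro eq_matI) auto
    show ?thesis
    proof (cases "d = 0")
      case True
      then show ?thesis using less.prems(1) by (intro exI[of _ 1]) simp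
    next
      case False
      then show ?thesis unfolding A0 by (intro exI[of _ 0]) simp
    qed
  next
    case True
    then obtain i j where ij: "i < d" "j < d" "A $$ (i, j) \<noteq> 0" by blast
    then have ne: "i \<noteq> j" using less.prems(2) by auto
    have D: "(A $$ (i, j))\<^sup>2 = A $$ (i, i) * A $$ (j, j) - A $$ (i, j) * A $$ (j, i)"
      using less.prems(2)[OF ij(1)] less.prems(3)[OF ij(2,1)] by (simp add: power2_eq_square)
    have D0: "(A $$ (i, j))\<^sup>2 \<noteq> 0" using ij(3) by simp
    obtain e f Y where Y: "d = e + 2" "bij_betw f {0..<e} ({0..<d} - {i, j})" "Y \<in> carrier_mat e e"
      "\<forall>k<e. \<forall>l<e. Y $$ (k, l) = A $$ (f k, f l) -
        (A $$ (f k, i) * (A $$ (j, j) * A $$ (i, f l) - A $$ (i, j) * A $$ (j, f l)) +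
         A $$ (f k, j) * (A $$ (i, i) * A $$ (j, f l) - A $$ (j, i) * A $$ (i, f l))) / (A $$ (i, j))\<^sup>2"
      "det A = (A $$ (i, j))\<^sup>2 * det Y"
      by (rule pivot_step[OF less.prems(1) ij(1,2) ne D D0]) (rule that; assumption)
    have fd: "f k < d" if "k < e" for k using bij_betwE[OF Y(2)] that by auto
    let ?N = "\<lambda>k l. A $$ (k, i) * (A $$ (j, j) * A $$ (i, l) - A $$ (i, j) * A $$ (j, l)) +
         A $$ (k, j) * (A $$ (i, i) * A $$ (j, l) - A $$ (j, i) * A $$ (i, l))"
    have N: "?N k l = - ?N l k" if "k < d" "l < d" for k l
    proof -
      have e: "A $$ (i, i) = 0" "A $$ (j, j) = 0" "A $$ (j, i) = - A $$ (i, j)"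
        "A $$ (k, i) = - A $$ (i, k)" "A $$ (k, j) = - A $$ (j, k)"
        "A $$ (l, i) = - A $$ (i, l)" "A $$ (l, j) = - A $$ (j, l)"
        by (rule less.prems(2,3); use ij that in simp)+
      show ?thesis unfolding e by (simp add: algebra_simps)
    qed
    have N0: "?N k k = 0" if "k < d" for k
    proof -
      have e: "A $$ (i, i) = 0" "A $$ (j, j) = 0" "A $$ (j, i) = - A $$ (i, j)"
        "A $$ (k, i) = - A $$ (i, k)" "A $$ (k, j) = - A $$ (j, k)"
        by (rule less.prems(2,3); use ij that in simp)+
      show ?thesis unfolding e by (simp add: algebra_simps)
    qed
    have gen: "- a - (- n) / c = - (a - n / c)" for a n c :: 'a by simp
    have sk: "Y $$ (k, l) = - Y $$ (l, k)" if "k < e" "l < e" for k l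
      unfolding Y(4)[rule_format, OF that] Y(4)[rule_format, OF that(2,1)] N[OF fd[OF that(1)] fd[OF that(2)]]
        less.prems(3)[OF fd[OF that(1)] fd[OF that(2)]] by (rule gen)
    have "Y $$ (k, k) = 0" if "k < e" for k
      unfolding Y(4)[rule_format, OF that that] N0[OF fd[OF that]] using less.prems(2)[OF fd[OF that]] by simp
    then obtain s where "det Y = s\<^sup>2" using less.IH[OF _ Y(3) _ sk] Y(1) by auto
    then show ?thesis using Y(5) by (metis power_mult_distrib)
  qed
qed

section \<open>The form integral plus alternating\<close>

interpretation to_fract_hom: inj_comm_ring_hom "to_fract :: 'a :: idom \<Rightarrow> 'a fract"
  by unfold_locales auto

lemma integral_mat_lift:
  assumes A: "A \<in> carrier_mat n m" and i: "\<And>i j. i < n \<Longrightarrow> j < m \<Longrightarrow> A $$ (i, j) \<in> O2"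
  obtains A0 where "A0 \<in> carrier_mat n m" "A = map_mat to_fract A0"
proof -
  have "\<forall>i j. \<exists>x. i < n \<longrightarrow> j < m \<longrightarrow> A $$ (i, j) = to_fract x" using i by (auto simp: O2_def image_iff)
  then obtain g where g: "\<And>i j. i < n \<Longrightarrow> j < m \<Longrightarrow> A $$ (i, j) = to_fract (g i j)" by metis
  have "A = map_mat to_fract (mat n m (\<lambda>(i, j). g i j))"
    using A g by (intro eq_matI) auto
  then show thesis using that by (metis mat_carrier)
qed

lemma det_integral:
  assumes "A \<in> carrier_mat n n" "\<And>i j. i < n \<Longrightarrow> j < n \<Longrightarrow> A $$ (i, j) \<in> O2"
  shows "det A \<in> O2"
  using integral_mat_lift[of A n n] assms by (metis to_fract_hom.hom_det to_fract_in_O2)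

text \<open>Pole orders are compared through integrality of quotients, so that no valuation on the
  field has to be introduced.\<close>

lemma O2_maximal_pole:
  assumes "finite S" "S \<noteq> {}" "0 \<notin> S"
  shows "\<exists>m\<in>S. \<forall>x\<in>S. x / m \<in> O2"
  using assms
proof (induction S rule: finite_ne_induct)
  case (singleton x)
  then show ?case by simp
next
  case (insert x S)
  then obtain m where m: "m \<in> S" "\<forall>y\<in>S. y / m \<in> O2" by auto
  have nz: "m \<noteq> 0" "x \<noteq> 0" using m insert.prems by auto
  show ?case
  proof (cases "x / m \<in> O2")
    case True
    then show ?thesis using m by auto
  next
    case False
    then obtain w where "w \<in> O2" "inverse (x / m) = 2 * w" using O2_valuation by blast
    then have mx: "m / x \<in> O2" by (auto simp: field_simps)
    have "y / x \<in> O2" if "y \<in> S" for y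
      using O2_mult[OF m(2)[rule_format, OF that] mx] nz by (simp add: field_simps)
    then show ?thesis using nz by auto
  qed
qed

text \<open>The correction term of the Schur complement for a pivot entry \<open>\<beta>\<close> of
  maximal pole order. After the entries near the pivot are written as multiples of
  \<open>\<beta>\<close>, up to integral summands, everything with a pole cancels except the skew
  term \<open>\<beta> * (a' * b - b' * a)\<close>.\<close>

lemma cleared_pole_identity:
  fixes a b a' b' o1 o2 p \<delta> \<alpha> \<beta> \<eta> :: "'a :: field"
  assumes "\<beta> \<noteq> 0" "\<eta> \<noteq> 0"
  shows "((o1 - \<beta> * a') * (\<delta> * (\<beta> * a) - \<beta> * (\<beta> * b)) + (o2 - \<beta> * b') * (\<alpha> * (\<beta> * b) - (p - \<beta>) * (\<beta> * a)))
      / (\<beta>\<^sup>2 * \<eta>)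
    = ((o1 * inverse \<beta> - a') * \<delta> * a - o1 * b + (o2 * inverse \<beta> - b') * (\<alpha> * b - p * a) + o2 * a
       + \<beta> * (a' * b - b' * a)) * inverse \<eta>"
  using assms by (simp add: field_simps power2_eq_square)

text \<open>The elementary divisors of an integral perturbation of an alternating matrix come in pairs.
  Pivoting at an entry with a pole of maximal order reduces the size by two; without poles the
  determinant is a unit because the inverse is integral.\<close>

lemma det_valuation_even:
  assumes "W \<in> carrier_mat d d"
    and "\<And>k. k < d \<Longrightarrow> W $$ (k, k) \<in> O2"
    and "\<And>k l. k < d \<Longrightarrow> l < d \<Longrightarrow> W $$ (k, l) + W $$ (l, k) \<in> O2"
    and "V \<in> carrier_mat d d" "\<And>k l. k < d \<Longrightarrow> l < d \<Longrightarrow> V $$ (k, l) \<in> O2" "W * V = 1\<^sub>m d"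
  shows "\<exists>e u. u dvd 1 \<and> det W * 4 ^ e = to_fract u"
  using assms
proof (induction d arbitrary: W V rule: less_induct)
  case (less d)
  note W = less.prems(1) and diag = less.prems(2) and symm = less.prems(3)
    and V = less.prems(4) and intV = less.prems(5) and WV = less.prems(6)
  show ?case
  proof (cases "\<forall>k<d. \<forall>l<d. W $$ (k, l) \<in> O2")
    case True
    then have "det W \<in> O2" using det_integral[OF W] by auto
    then obtain w where w: "det W = to_fract w" by (elim O2_E)
    have "det V \<in> O2" using det_integral[OF V] intV by auto
    then obtain v where v: "det V = to_fract v" by (elim O2_E)
    have "det W * det V = 1" using det_mult[OF W V] WV by simp
    then have "to_fract (w * v) = to_fract 1" using w v by simp
    then have "w dvd 1" unfolding to_fract_eq_iff by (metis dvd_triv_left)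
    then show ?thesis using w by (intro exI[of _ 0] exI[of _ w]) simp
  next
    case False
    then obtain k0 l0 where kl0: "k0 < d" "l0 < d" "W $$ (k0, l0) \<notin> O2" by blast
    define S where "S = (\<lambda>(k, l). W $$ (k, l)) ` ({0..<d} \<times> {0..<d}) - {0}"
    have "W $$ (k0, l0) \<in> S"
    proof -
      have "W $$ (k0, l0) \<in> (\<lambda>(k, l). W $$ (k, l)) ` ({0..<d} \<times> {0..<d})"
        using kl0 by (intro image_eqI[of _ _ "(k0, l0)"]) auto
      moreover have "W $$ (k0, l0) \<noteq> 0" using kl0(3) O2_0 by metis
      ultimately show ?thesis by (simp add: S_def)
    qed
    moreover have "finite S" "0 \<notin> S" by (auto simp: S_def)
    ultimately obtain \<beta> where \<beta>: "\<beta> \<in> S" "\<forall>x\<in>S. x / \<beta> \<in> O2" using O2_maximal_pole by blast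
    then obtain i j where ij: "i < d" "j < d" "\<beta> = W $$ (i, j)" by (auto simp: S_def)
    have b0: "\<beta> \<noteq> 0" using \<beta> by (auto simp: S_def)
    have quot: "W $$ (k, l) / \<beta> \<in> O2" if "k < d" "l < d" for k l
    proof (cases "W $$ (k, l) = 0")
      case False
      then have "W $$ (k, l) \<in> S" using that unfolding S_def by (auto intro!: image_eqI[of _ _ "(k, l)"])
      then show ?thesis using \<beta>(2) by blast
    qed simp
    have bO: "\<beta> \<notin> O2"
    proof
      assume "\<beta> \<in> O2"
      then have "W $$ (k0, l0) / \<beta> * \<beta> \<in> O2" using quot kl0 by blast
      then show False using kl0 b0 by simp
    qed
    \<comment> \<open>The diagonal has no poles, so a pivot of maximal pole order lies off the
      diagonal.\<close>
    then have ne: "i \<noteq> j" using diag ij by metis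
    obtain y where y: "y \<in> O2" "inverse \<beta> = 2 * y" using O2_valuation bO by blast
    define \<epsilon> where "\<epsilon> = inverse \<beta>"
    have \<epsilon>: "\<epsilon> \<in> O2" using y \<epsilon>_def by auto
    define \<alpha> \<delta> p where "\<alpha> = W $$ (i, i)" and "\<delta> = W $$ (j, j)" and "p = \<beta> + W $$ (j, i)"
    have apd: "\<alpha> \<in> O2" "\<delta> \<in> O2" "p \<in> O2"
      using diag symm ij by (auto simp: \<alpha>_def \<delta>_def p_def)
    \<comment> \<open>The pivot block has determinant alpha delta - beta (p - beta), that is beta^2
      times 1 + epsilon (alpha delta epsilon - p). As epsilon = 2 y, the second factor is 1 + 2 z, a
      unit.\<close>
    define z where "z = y * (\<alpha> * \<delta> * \<epsilon> - p)"
    have "z \<in> O2" unfolding z_def using y(1) apd \<epsilon> by blast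
    then obtain z0 where z0: "z = to_fract z0" by (elim O2_E)
    define \<eta>0 where "\<eta>0 = 1 + 2 * z0"
    have \<eta>u: "\<eta>0 dvd 1" unfolding z2_unit_iff \<eta>0_def
      by (metis dvd_add_left_iff dvd_triv_left prime_elem_2_z2 prime_elem_not_unit)
    define \<eta> where "\<eta> = to_fract \<eta>0"
    have \<eta>: "\<eta> \<noteq> 0" "inverse \<eta> \<in> O2"
      using \<eta>u to_fract_unit_inverse by (auto simp: \<eta>_def)
    have \<eta>eq: "\<eta> = 1 + \<epsilon> * (\<alpha> * \<delta> * \<epsilon> - p)"
      using y(2) by (simp add: \<eta>_def \<eta>0_def z0[symmetric] z_def \<epsilon>_def)
    have D: "\<beta>\<^sup>2 * \<eta> = W $$ (i, i) * W $$ (j, j) - W $$ (i, j) * W $$ (j, i)"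
    proof -
      have e: "W $$ (j, i) = p - \<beta>" by (simp add: p_def)
      show ?thesis unfolding \<eta>eq \<epsilon>_def \<alpha>_def[symmetric] \<delta>_def[symmetric] ij(3)[symmetric] e
        using b0 by (simp add: field_simps power2_eq_square)
    qed
    have D0: "\<beta>\<^sup>2 * \<eta> \<noteq> 0" using b0 \<eta> by simp
    obtain e f Y where Y: "d = e + 2" "bij_betw f {0..<e} ({0..<d} - {i, j})" "Y \<in> carrier_mat e e"
      "\<forall>k<e. \<forall>l<e. Y $$ (k, l) = W $$ (f k, f l) -
        (W $$ (f k, i) * (W $$ (j, j) * W $$ (i, f l) - W $$ (i, j) * W $$ (j, f l)) +
         W $$ (f k, j) * (W $$ (i, i) * W $$ (j, f l) - W $$ (j, i) * W $$ (i, f l))) / (\<beta>\<^sup>2 * \<eta>)"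
      "det W = (\<beta>\<^sup>2 * \<eta>) * det Y"
      "\<forall>V\<in>carrier_mat d d. W * V = 1\<^sub>m d \<longrightarrow>
        Y * mat e e (\<lambda>(k, l). V $$ (f k, f l)) = 1\<^sub>m e"
      by (rule pivot_step[OF W ij(1,2) ne D D0]) (rule that; assumption)
    have fd: "f k < d" if "k < e" for k using bij_betwE[OF Y(2)] that by auto
    define a b o1 o2 where "a k = W $$ (i, k) / \<beta>" and "b k = W $$ (j, k) / \<beta>"
      and "o1 k = W $$ (k, i) + W $$ (i, k)" and "o2 k = W $$ (k, j) + W $$ (j, k)" for k
    have abo: "a k \<in> O2" "b k \<in> O2" "o1 k \<in> O2" "o2 k \<in> O2" if "k < d" for k
      using quot symm that ij by (auto simp: a_def b_def o1_def o2_def)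
    \<comment> \<open>The integral part of the correction term.\<close>
    define J where "J k l = (o1 k * \<epsilon> - a k) * \<delta> * a l - o1 k * b l
        + (o2 k * \<epsilon> - b k) * (\<alpha> * b l - p * a l) + o2 k * a l" for k l
    have J: "J k l \<in> O2" if "k < d" "l < d" for k l
      unfolding J_def using abo[OF that(1)] abo[OF that(2)] apd \<epsilon> by (intro O2_add O2_diff O2_mult)
    have Ykl: "Y $$ (k, l) = W $$ (f k, f l)
        - (J (f k) (f l) + \<beta> * (a (f k) * b (f l) - b (f k) * a (f l))) * inverse \<eta>"
      if "k < e" "l < e" for k l
    proof -
      have e: "W $$ (f k, i) = o1 (f k) - \<beta> * a (f k)" "W $$ (f k, j) = o2 (f k) - \<beta> * b (f k)"
        "W $$ (i, f l) = \<beta> * a (f l)" "W $$ (j, f l) = \<beta> * b (f l)" "W $$ (j, i) = p - \<beta>"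
        using b0 by (simp_all add: a_def b_def o1_def o2_def p_def)
      show ?thesis
        unfolding Y(4)[rule_format, OF that] e ij(3)[symmetric] \<alpha>_def[symmetric] \<delta>_def[symmetric]
          cleared_pole_identity[OF b0 \<eta>(1)] J_def \<epsilon>_def ..
    qed
    \<comment> \<open>The skew term vanishes on the diagonal and cancels in symmetrized entries, so
      that Y inherits the hypotheses of the induction.\<close>
    have Ydiag: "Y $$ (k, k) \<in> O2" if "k < e" for k
    proof -
      have "Y $$ (k, k) = W $$ (f k, f k) - J (f k) (f k) * inverse \<eta>"
        by (subst Ykl[OF that that]) (simp add: mult.commute)
      then show ?thesis using diag[OF fd[OF that]] J[OF fd[OF that] fd[OF that]] \<eta>(2) by auto
    qed
    have Ysym: "Y $$ (k, l) + Y $$ (l, k) \<in> O2" if "k < e" "l < e" for k l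
    proof -
      have "Y $$ (k, l) + Y $$ (l, k) = (W $$ (f k, f l) + W $$ (f l, f k))
          - (J (f k) (f l) + J (f l) (f k)) * inverse \<eta>"
        unfolding Ykl[OF that] Ykl[OF that(2,1)] by (simp add: algebra_simps)
      then show ?thesis using symm[OF fd[OF that(1)] fd[OF that(2)]] J[OF fd[OF that(1)] fd[OF that(2)]]
          J[OF fd[OF that(2)] fd[OF that(1)]] \<eta>(2) by (metis O2_add O2_diff O2_mult)
    qed
    let ?V = "mat e e (\<lambda>(k, l). V $$ (f k, f l))"
    have YV: "Y * ?V = 1\<^sub>m e" using Y(6) V WV by blast
    obtain e' u' where u': "u' dvd 1" "det Y * 4 ^ e' = to_fract u'"
      using less.IH[OF _ Y(3) Ydiag Ysym _ _ YV] intV fd Y(1) by auto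
    \<comment> \<open>The pivot is a unit divided by \<open>2 ^ k\<close>. Its square enters the
      determinant, which changes the valuation by the even number 2k.\<close>
    obtain q where q: "\<epsilon> = to_fract q" using \<epsilon> by (elim O2_E)
    have "q \<noteq> 0" using q b0 \<epsilon>_def by auto
    then obtain k w where kw: "w dvd 1" "q = 2 ^ k * w" by (rule z2_factor)
    obtain w' where "1 = w * w'" using kw(1) by (elim dvdE)
    then have w': "to_fract w * to_fract w' = 1" "w' dvd 1"
      by (metis to_fract_1 to_fract_mult, metis dvd_triv_right)
    have "(\<beta> * 2 ^ k) * to_fract w = 1"
      using q kw(2) b0 unfolding \<epsilon>_def by (simp add: field_simps)
    moreover have "\<beta> * 2 ^ k = (\<beta> * 2 ^ k * to_fract w) * to_fract w'"
      by (simp only: mult.assoc w'(1) mult_1_right)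
    ultimately have bw: "\<beta> * 2 ^ k = to_fract w'" by simp
    have "(4 :: q2) ^ k = 2 ^ k * 2 ^ k" by (subst power_mult_distrib[symmetric]) simp
    then have "\<beta>\<^sup>2 * 4 ^ k = (\<beta> * 2 ^ k) * (\<beta> * 2 ^ k)"
      by (simp only: power2_eq_square ac_simps)
    then have b4: "\<beta>\<^sup>2 * 4 ^ k = to_fract (w' * w')" by (simp only: bw to_fract_mult)
    have "det W * 4 ^ (k + e') = (\<beta>\<^sup>2 * 4 ^ k) * \<eta> * (det Y * 4 ^ e')"
      unfolding Y(5) by (simp only: power_add ac_simps)
    also have "\<dots> = to_fract (w' * w') * \<eta> * to_fract u'" by (simp only: b4 u'(2))
    also have "\<dots> = to_fract (w' * w' * \<eta>0 * u')" by (simp add: \<eta>_def)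
    finally have "det W * 4 ^ (k + e') = to_fract (w' * w' * \<eta>0 * u')" .
    moreover have "w' * w' * \<eta>0 * u' dvd 1" using w'(2) \<eta>u u'(1) by (simp only: is_unit_mult_iff)
    ultimately show ?thesis by blast
  qed
qed

section \<open>Necessity\<close>

text \<open>Instantiated at a fixed dimension, these rules let the simplifier normalize products of
  square matrices and discharge the carrier conditions.\<close>

lemma square_mat_simps:
  fixes A B C :: "'a :: ring_1 mat"
  assumes "A \<in> carrier_mat n n" "B \<in> carrier_mat n n"
  shows "A * B \<in> carrier_mat n n" "A + B \<in> carrier_mat n n" "A - B \<in> carrier_mat n n"
    "C \<in> carrier_mat n n \<Longrightarrow> (A * B) * C = A * (B * C)"
    "C \<in> carrier_mat n n \<Longrightarrow> (A + B) * C = A * C + B * C"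
    "C \<in> carrier_mat n n \<Longrightarrow> C * (A + B) = C * A + C * B"
    "C \<in> carrier_mat n n \<Longrightarrow> (A - B) * C = A * C - B * C"
    "C \<in> carrier_mat n n \<Longrightarrow> C * (A - B) = C * A - C * B"
    "transpose_mat (A + B) = transpose_mat A + transpose_mat B"
    "transpose_mat (A - B) = transpose_mat A - transpose_mat B"
    "A + B - B = A"
  using assms by (auto simp: minus_carrier_mat add_mult_distrib_mat[of _ n n _ _ n] mult_add_distrib_mat[of _ n n _ n]
      minus_mult_distrib_mat[of _ n n _ _ n] mult_minus_distrib_mat[of _ n n _ n]
      transpose_add[of _ n n] transpose_minus[of _ n n] intro!: eq_matI[of "A + B - B"])

lemma one_mult_square:
  fixes A :: "'a :: ring_1 mat"
  assumes "A \<in> carrier_mat n n"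
  shows "1\<^sub>m n * A = A" "A * 1\<^sub>m n = A"
  using assms by auto

lemma transpose_mult_square:
  fixes A B :: "'a :: comm_ring_1 mat"
  shows "A \<in> carrier_mat n n \<Longrightarrow> B \<in> carrier_mat n n \<Longrightarrow>
    transpose_mat (A * B) = transpose_mat B * transpose_mat A"
  by (rule transpose_mult)

text \<open>The adjugate divided by the determinant. Stated for units, this serves both the field
  and the 2-adic integers.\<close>

lemma inverse_mat_exists:
  fixes A :: "'a :: idom mat"
  assumes A: "A \<in> carrier_mat n n" and c: "det A dvd 1"
  obtains B where "B \<in> carrier_mat n n" "A * B = 1\<^sub>m n" "B * A = 1\<^sub>m n"
proof -
  obtain c where c: "1 = det A * c" using c by (elim dvdE)
  have adj: "adj_mat A \<in> carrier_mat n n" "A * adj_mat A = det A \<cdot>\<^sub>m 1\<^sub>m n" "adj_mat A * A = det A \<cdot>\<^sub>m 1\<^sub>m n"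
    using adj_mat[OF A] by auto
  have "A * (c \<cdot>\<^sub>m adj_mat A) = 1\<^sub>m n"
    unfolding mult_smult_distrib[OF A adj(1)] adj(2) using c by (intro eq_matI) (auto simp: mult.commute)
  moreover have "(c \<cdot>\<^sub>m adj_mat A) * A = 1\<^sub>m n"
    unfolding mult_smult_assoc_mat[OF adj(1) A] adj(3) using c by (intro eq_matI) (auto simp: mult.commute)
  ultimately show thesis using that adj(1) by (metis smult_carrier_mat)
qed

lemma poly_char_poly:
  fixes A :: "'a :: comm_ring_1 mat"
  assumes "A \<in> carrier_mat n n"
  shows "poly (char_poly A) x = det (x \<cdot>\<^sub>m 1\<^sub>m n - A)"
  unfolding char_poly_def
  by (rule poly_det_cong[of _ n]) (use assms in \<open>auto simp: char_poly_matrix_def\<close>)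

text \<open>\<open>W\<close> is a Cayley transform of T. Its inverse \<open>U\<close> is integral
  and its symmetrization is the inverse Gram matrix \<open>H\<close>, which are the two things
  \<open>det_valuation_even\<close> asks for.\<close>

lemma isometry_valuation_even:
  fixes G H T :: "q2 mat"
  assumes c: "G \<in> carrier_mat d d" "H \<in> carrier_mat d d" "T \<in> carrier_mat d d"
    and GH: "G * H = 1\<^sub>m d" and sym: "transpose_mat G = G" and iso: "transpose_mat T * G * T = G"
    and int: "\<And>i j. i < d \<Longrightarrow> j < d \<Longrightarrow> G $$ (i, j) \<in> O2"
      "\<And>i j. i < d \<Longrightarrow> j < d \<Longrightarrow> H $$ (i, j) \<in> O2"
      "\<And>i j. i < d \<Longrightarrow> j < d \<Longrightarrow> T $$ (i, j) \<in> O2"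
    and even: "\<And>i. i < d \<Longrightarrow> \<exists>z\<in>O2. H $$ (i, i) = 2 * z"
    and nz: "det (1\<^sub>m d - T) \<noteq> 0"
  shows "\<exists>e u. u dvd 1 \<and> det (1\<^sub>m d - T) = to_fract (4 ^ e * u)"
proof -
  note [simp] = c carrier_matD[OF c(1)] carrier_matD[OF c(2)] carrier_matD[OF c(3)]
  have HG: "H * G = 1\<^sub>m d" using GH c mat_mult_left_right_inverse by blast
  note sq = square_mat_simps[where n = d] transpose_mult_square[where n = d] one_mult_square[where n = d]
  let ?I = "1\<^sub>m d :: q2 mat"
  let ?S = "?I - T"
  have S: "?S \<in> carrier_mat d d" by (simp add: sq)
  define U where "U = G * ?S"
  have U: "U \<in> carrier_mat d d" by (simp add: U_def sq)
  have detGH: "det G * det H = 1" using det_mult[OF c(1,2)] GH by simp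
  have detU: "det U = det G * det ?S" unfolding U_def by (rule det_mult[OF c(1) S])
  then have "det U \<noteq> 0" using nz detGH by auto
  then have "det U dvd 1" by (simp add: dvd_field_iff)
  then obtain W where W: "W \<in> carrier_mat d d" "U * W = ?I" "W * U = ?I"
    by (rule inverse_mat_exists[OF U])
  have TGT: "transpose_mat T * (G * T) = G" using iso by (simp add: sq)
  have HGS: "H * (G * A) = A" if "A \<in> carrier_mat d d" for A
  proof -
    have "H * (G * A) = (H * G) * A" using that by (simp add: sq)
    then show ?thesis using HG that by (simp add: sq)
  qed
  \<comment> \<open>Because T preserves G, both sides equal 2 G - G T minus the transpose of G T.
    Multiplication by W on both sides then gives H as the sum of W and its transpose.\<close>
  have "transpose_mat U * (H * U) = transpose_mat U * ?S"
    unfolding U_def by (simp add: HGS S)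
  also have "\<dots> = U + transpose_mat U"
    unfolding U_def by (simp add: sq sym TGT) (intro eq_matI; simp add: sq)
  finally have e2: "transpose_mat U * (H * U) = U + transpose_mat U" .
  have WU: "transpose_mat W * transpose_mat U = ?I"
    using transpose_mult_square[OF U W(1)] W by simp
  have "H = transpose_mat W * transpose_mat U * H * (U * W)"
    unfolding WU W(2) by simp
  also have "\<dots> = transpose_mat W * (transpose_mat U * (H * U)) * W"
    using U W(1) by (simp add: sq)
  also have "\<dots> = transpose_mat W * (U * W) + (transpose_mat W * transpose_mat U) * W"
    unfolding e2 using U W(1) by (simp add: sq)
  also have "\<dots> = transpose_mat W + W" unfolding W WU using W(1) by (simp add: sq)
  finally have HW: "H = transpose_mat W + W" .
  have sumW: "W $$ (k, l) + W $$ (l, k) = H $$ (k, l)" if "k < d" "l < d" for k l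
    using that W(1) unfolding HW by simp
  \<comment> \<open>Evenness enters here: the diagonal of H is twice the diagonal of W.\<close>
  have diagW: "W $$ (k, k) \<in> O2" if k: "k < d" for k
  proof -
    obtain z where z: "z \<in> O2" "H $$ (k, k) = 2 * z" using even k by blast
    then have "2 * W $$ (k, k) = 2 * z" using sumW[OF k k] by simp
    then show ?thesis using z by simp
  qed
  have intU: "U $$ (i, j) \<in> O2" if "i < d" "j < d" for i j
  proof -
    have "U $$ (i, j) = (\<Sum>l = 0..<d. G $$ (i, l) * ?S $$ (l, j))"
      unfolding U_def by (rule mult_mat_index[OF c(1) S that])
    moreover have "?S $$ (l, j) \<in> O2" if "l < d" for l
      using int(3)[OF that \<open>j < d\<close>] that \<open>j < d\<close> c(3) by (cases "l = j") (auto simp: carrier_matD)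
    ultimately show ?thesis using int(1) that by (simp only:) (intro O2_sum O2_mult; simp)
  qed
  \<comment> \<open>The integral matrix \<open>U\<close> plays the role of the inverse
    \<open>V\<close>.\<close>
  obtain e u where eu: "u dvd 1" "det W * 4 ^ e = to_fract u"
    using det_valuation_even[OF W(1) diagW _ U intU W(3)] sumW int(2) by auto
  have UW: "det U * det W = 1" using det_mult[OF U W(1)] W(2) by simp
  obtain u' where u': "1 = u * u'" using eu(1) by (elim dvdE)
  then have uu: "to_fract u * to_fract u' = 1" by (metis to_fract_1 to_fract_mult)
  have "det U = det U * (det W * 4 ^ e) * to_fract u'" unfolding eu using uu by (simp add: mult.assoc)
  also have "\<dots> = (det U * det W) * 4 ^ e * to_fract u'" by (simp only: mult.assoc)
  finally have dU: "det U = 4 ^ e * to_fract u'" unfolding UW by simp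
  have "det G \<in> O2" "det H \<in> O2" using det_integral[OF c(1)] det_integral[OF c(2)] int by auto
  then obtain g h where gh: "det G = to_fract g" "det H = to_fract h" by (auto simp: O2_def)
  have "to_fract (g * h) = to_fract 1" using detGH gh by simp
  then have h1: "h dvd 1" unfolding to_fract_eq_iff by (metis dvd_triv_right)
  have "det ?S = (det G * det H) * det ?S" by (simp add: detGH)
  also have "\<dots> = det H * det U" unfolding detU by (simp only: ac_simps)
  also have "\<dots> = to_fract (4 ^ e * (h * u'))" unfolding dU gh by (simp add: ac_simps)
  finally have "det ?S = to_fract (4 ^ e * (h * u'))" .
  moreover have "h * u' dvd 1" using h1 u' by (metis dvd_triv_right is_unit_mult_iff)
  ultimately show ?thesis by blast
qed

text \<open>Right multiplication by T turns the alternating matrix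
  \<open>G * T - transpose_mat T * G\<close> into G (T^2 - 1), because T is an isometry. The factor
  det T is kept; it is F(0) in even dimension and becomes 1 when F(1) is nonzero.\<close>

lemma isometry_discriminant:
  fixes G T :: "'a :: field_char_0 mat"
  assumes c: "G \<in> carrier_mat d d" "T \<in> carrier_mat d d"
    and sym: "transpose_mat G = G" and iso: "transpose_mat T * G * T = G"
  shows "\<exists>s. det G * (det (T - 1\<^sub>m d) * det (T + 1\<^sub>m d)) = s\<^sup>2 * det T"
proof -
  note [simp] = c carrier_matD[OF c(1)] carrier_matD[OF c(2)]
  note sq = square_mat_simps[where n = d] transpose_mult_square[where n = d] one_mult_square[where n = d]
  let ?I = "1\<^sub>m d :: 'a mat"
  let ?N = "G * T - transpose_mat T * G"
  have N: "?N \<in> carrier_mat d d" by (simp add: sq)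
  have Nt: "transpose_mat ?N = transpose_mat T * G - G * T"
    by (simp add: sq sym)
  have sk: "?N $$ (k, l) = - ?N $$ (l, k)" if "k < d" "l < d" for k l
  proof -
    have "?N $$ (l, k) = transpose_mat ?N $$ (k, l)" using that N by simp
    also have "\<dots> = - ?N $$ (k, l)" unfolding Nt using that c by simp
    finally show ?thesis by simp
  qed
  have "?N $$ (k, k) = 0" if "k < d" for k
  proof -
    have z: "x = 0" if "x = - x" for x :: 'a
    proof -
      have "2 * x = x + x" by (rule mult_2)
      also have "\<dots> = 0" by (subst that) simp
      finally show ?thesis by simp
    qed
    show ?thesis by (rule z[OF sk[OF that that]])
  qed
  then obtain s where s: "det ?N = s\<^sup>2" using det_alternating_square[OF N _ sk] by blast
  have TGT: "transpose_mat T * (G * T) = G" using iso by (simp add: sq)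
  have D: "(T - ?I) * (T + ?I) \<in> carrier_mat d d" "T - ?I \<in> carrier_mat d d" "T + ?I \<in> carrier_mat d d"
    by (simp_all add: sq)
  have "?N * T = G * (T * T) - G" using TGT by (simp add: sq)
  also have "T * T = (T - ?I) * (T + ?I) + ?I"
    by (simp add: sq) (intro eq_matI; simp add: sq)
  also have "G * \<dots> - G = G * ((T - ?I) * (T + ?I))"
    by (subst square_mat_simps(6)[where n = d]; simp add: sq D)
  finally have "det ?N * det T = det G * det ((T - ?I) * (T + ?I))"
    using det_mult[OF N c(2)] det_mult[OF c(1) D(1)] by simp
  also have "det ((T - ?I) * (T + ?I)) = det (T - ?I) * det (T + ?I)" by (rule det_mult[OF D(2,3)])
  finally show ?thesis using s by metis
qed

section \<open>Integral matrices attached to an even unimodular lattice\<close>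

lemma linear_expand:
  fixes f :: "z2 vec \<Rightarrow> q2"
  assumes add: "\<And>x y. x \<in> carrier_vec d \<Longrightarrow> y \<in> carrier_vec d \<Longrightarrow> f (x + y) = f x + f y"
    and smult: "\<And>c x. x \<in> carrier_vec d \<Longrightarrow> f (c \<cdot>\<^sub>v x) = to_fract c * f x"
    and x: "x \<in> carrier_vec d"
  shows "f x = (\<Sum>i = 0..<d. to_fract (x $ i) * f (unit_vec d i))"
proof -
  \<comment> \<open>Truncations of x; consecutive ones differ by a multiple of one unit vector, so
    binary additivity is enough.\<close>
  let ?t = "\<lambda>k. vec d (\<lambda>i. if i < k then x $ i else 0)"
  have "k \<le> d \<Longrightarrow> f (?t k) = (\<Sum>i = 0..<k. to_fract (x $ i) * f (unit_vec d i))" for k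
  proof (induction k)
    case 0
    have "?t 0 = 0 \<cdot>\<^sub>v 0\<^sub>v d" by (intro eq_vecI) auto
    then have "f (?t 0) = to_fract 0 * f (0\<^sub>v d)" using smult[of "0\<^sub>v d" 0] by simp
    then show ?case by simp
  next
    case (Suc k)
    have "?t (Suc k) = ?t k + x $ k \<cdot>\<^sub>v unit_vec d k"
      using Suc.prems by (intro eq_vecI) (auto simp: unit_vec_def less_Suc_eq)
    then have "f (?t (Suc k)) = f (?t k) + to_fract (x $ k) * f (unit_vec d k)"
      using add[of "?t k" "x $ k \<cdot>\<^sub>v unit_vec d k"] smult[of "unit_vec d k" "x $ k"] by simp
    then show ?case using Suc by simp
  qed
  moreover have "?t d = x" using x by (intro eq_vecI) auto
  ultimately show ?thesis by (metis order_refl)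
qed

context z2_lattice
begin

lemma form_gram:
  assumes x: "x \<in> carrier_vec d" and y: "y \<in> carrier_vec d"
  shows "b x y = form_ext d b (map_vec to_fract x) (map_vec to_fract y)"
proof -
  have add_right: "b u (v + w) = b u v + b u w"
    if "u \<in> carrier_vec d" "v \<in> carrier_vec d" "w \<in> carrier_vec d" for u v w
    using that add_left[of v w u] sym[of u "v + w"] sym[of u v] sym[of u w] by simp
  have smult_right: "b u (c \<cdot>\<^sub>v v) = to_fract c * b u v"
    if "u \<in> carrier_vec d" "v \<in> carrier_vec d" for u v c
    using that smult_left[of v u c] sym[of u "c \<cdot>\<^sub>v v"] sym[of u v] by simp
  have "b x y = (\<Sum>i = 0..<d. to_fract (x $ i) * b (unit_vec d i) y)"
    by (rule linear_expand[of d "\<lambda>x. b x y"]) (use add_left smult_left x y in auto)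
  also have "\<dots> = (\<Sum>i = 0..<d. to_fract (x $ i) *
      (\<Sum>j = 0..<d. to_fract (y $ j) * b (unit_vec d i) (unit_vec d j)))"
    by (intro sum.cong refl arg_cong2[of _ _ _ _ "(*)"] linear_expand)
      (use add_right smult_right y in auto)
  also have "\<dots> = form_ext d b (map_vec to_fract x) (map_vec to_fract y)"
    using x y unfolding form_ext_def gram_def
    by (auto simp: scalar_prod_def mult.commute intro!: sum.cong)
  finally show ?thesis .
qed

lemma gram_carrier: "gram d b \<in> carrier_mat d d"
  by (simp add: gram_def)

lemma gram_sym: "transpose_mat (gram d b) = gram d b"
  using sym by (intro eq_matI) (auto simp: gram_def)

lemma map_unit_vec: "i < d \<Longrightarrow> map_vec to_fract (unit_vec d i :: z2 vec) = unit_vec d i"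
  by (intro eq_vecI) (auto simp: unit_vec_def)

lemma gram_isometry:
  assumes T: "T \<in> carrier_mat d d"
    and iso: "\<And>x y. x \<in> carrier_vec d \<Longrightarrow> y \<in> carrier_vec d \<Longrightarrow> b (T *\<^sub>v x) (T *\<^sub>v y) = b x y"
  shows "transpose_mat (map_mat to_fract T) * gram d b * map_mat to_fract T = gram d b"
proof (rule eq_matI)
  let ?T = "map_mat to_fract T" and ?G = "gram d b"
  have T': "?T \<in> carrier_mat d d" and G: "?G \<in> carrier_mat d d" using T gram_carrier by auto
  fix i j assume "i < dim_row ?G" "j < dim_col ?G"
  then have ij: "i < d" "j < d" using G by auto
  have Te: "map_vec to_fract (T *\<^sub>v unit_vec d i) = col ?T i" if "i < d" for i
    using T that by (intro eq_vecI) auto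
  have "(transpose_mat ?T * ?G * ?T) $$ (i, j) = (transpose_mat ?T * (?G * ?T)) $$ (i, j)"
    using T' G by (subst assoc_mult_mat[of _ d d _ d _ d]) auto
  also have "\<dots> = row (transpose_mat ?T) i \<bullet> col (?G * ?T) j"
    using ij T' G T by (intro index_mult_mat(1)) auto
  also have "\<dots> = col ?T i \<bullet> (?G *\<^sub>v col ?T j)"
    using ij T' T by (subst col_mult2[OF G T' ij(2)]) auto
  also have "\<dots> = form_ext d b (map_vec to_fract (T *\<^sub>v unit_vec d i)) (map_vec to_fract (T *\<^sub>v unit_vec d j))"
    using Te ij by (simp add: form_ext_def)
  also have "\<dots> = b (T *\<^sub>v unit_vec d i) (T *\<^sub>v unit_vec d j)"
    using T by (intro form_gram[symmetric]) auto
  also have "\<dots> = ?G $$ (i, j)" using iso ij by (simp add: gram_def)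
  finally show "(transpose_mat ?T * ?G * ?T) $$ (i, j) = ?G $$ (i, j)" .
qed (use T gram_carrier in auto)

lemma form_ext_unit:
  "i < d \<Longrightarrow> y \<in> carrier_vec d \<Longrightarrow> form_ext d b (unit_vec d i) y = (gram d b *\<^sub>v y) $ i"
  unfolding form_ext_def using gram_carrier by (intro scalar_prod_left_unit) auto

lemma dual_lattice_iff:
  assumes "y \<in> carrier_vec d" "\<And>i. i < d \<Longrightarrow> (gram d b *\<^sub>v y) $ i \<in> O2"
  shows "y \<in> dual_lattice d b"
proof -
  have "form_ext d b x y \<in> range to_fract" if xl: "x \<in> lattice_in_ext d" for x
  proof -
    obtain x0 where x0: "x0 \<in> carrier_vec d" "x = map_vec to_fract x0"
      using xl unfolding lattice_in_ext_def by blast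
    have "form_ext d b x y = (\<Sum>i = 0..<d. to_fract (x0 $ i) * (gram d b *\<^sub>v y) $ i)"
      using x0 gram_carrier unfolding form_ext_def by (auto simp: scalar_prod_def intro!: sum.cong)
    also have "\<dots> \<in> O2" using assms(2) by (intro O2_sum O2_mult) auto
    finally show ?thesis by (simp add: O2_def)
  qed
  then show ?thesis using assms(1) by (auto simp: dual_lattice_def)
qed

lemma unimodular_gram:
  assumes uni: "unimodular d b" and even: "even_lattice d b"
  obtains H where "H \<in> carrier_mat d d" "gram d b * H = 1\<^sub>m d"
    "\<And>i j. i < d \<Longrightarrow> j < d \<Longrightarrow> gram d b $$ (i, j) \<in> O2"
    "\<And>i j. i < d \<Longrightarrow> j < d \<Longrightarrow> H $$ (i, j) \<in> O2"
    "\<And>i. i < d \<Longrightarrow> \<exists>z\<in>O2. H $$ (i, i) = 2 * z"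
proof -
  let ?G = "gram d b"
  note G = gram_carrier
  have eq: "dual_lattice d b = lattice_in_ext d" using uni by (simp add: unimodular_def)
  have lat: "\<exists>x. x \<in> carrier_vec d \<and> y = map_vec to_fract x" if "y \<in> dual_lattice d b" for y
    using that unfolding eq lattice_in_ext_def by auto
  have intG: "?G $$ (i, j) \<in> O2" if ij: "i < d" "j < d" for i j
  proof -
    have u: "unit_vec d k \<in> lattice_in_ext d" if "k < d" for k
      unfolding lattice_in_ext_def using map_unit_vec[OF that] by (metis image_eqI unit_vec_carrier)
    have "unit_vec d j \<in> dual_lattice d b" using u[OF ij(2)] by (simp only: eq)
    then have "\<forall>x\<in>lattice_in_ext d. form_ext d b x (unit_vec d j) \<in> range to_fract"
      by (simp add: dual_lattice_def)
    then have "form_ext d b (unit_vec d i) (unit_vec d j) \<in> range to_fract" using u[OF ij(1)] by blast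
    also have "form_ext d b (unit_vec d i) (unit_vec d j) = (?G *\<^sub>v unit_vec d j) $ i"
      using ij by (intro form_ext_unit) auto
    also have "\<dots> = ?G $$ (i, j)" using ij G by simp
    finally show ?thesis by (simp add: O2_def)
  qed
  \<comment> \<open>A kernel vector pairs to 0 with everything, so it lies in the dual and hence in
    the lattice, where nondegeneracy applies.\<close>
  have "det ?G \<noteq> 0"
  proof
    assume "det ?G = 0"
    then obtain v where v: "v \<in> carrier_vec d" "v \<noteq> 0\<^sub>v d" "?G *\<^sub>v v = 0\<^sub>v d"
      using det_0_iff_vec_prod_zero_field[OF G] by blast
    have "v \<in> dual_lattice d b" by (rule dual_lattice_iff) (use v in auto)
    then obtain x where x: "x \<in> carrier_vec d" "v = map_vec to_fract x" using lat by blast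
    have "b x y = 0" if y: "y \<in> carrier_vec d" for y
    proof -
      have "b x y = b y x" using sym x y by blast
      also have "\<dots> = map_vec to_fract y \<bullet> (?G *\<^sub>v v)"
        using form_gram[OF y x(1)] x(2) by (simp add: form_ext_def)
      also have "\<dots> = 0" unfolding v(3) using y by simp
      finally show ?thesis .
    qed
    then have "x = 0\<^sub>v d" using nondegenerate x(1) by blast
    then show False using v(2) x(2) by auto
  qed
  then have "det ?G dvd 1" by (simp add: dvd_field_iff)
  then obtain H where H: "H \<in> carrier_mat d d" "?G * H = 1\<^sub>m d"
    by (rule inverse_mat_exists[OF G])
  have GH: "?G *\<^sub>v col H j = unit_vec d j" if "j < d" for j
    using col_mult2[OF G H(1) that] col_one[OF that] unfolding H(2) by metis
  have colH: "\<exists>x. x \<in> carrier_vec d \<and> col H j = map_vec to_fract x" if j: "j < d" for j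
    by (rule lat, rule dual_lattice_iff) (use j H GH[OF j] in \<open>auto simp: unit_vec_def\<close>)
  have intH: "H $$ (i, j) \<in> O2" if "i < d" "j < d" for i j
  proof -
    obtain x where x: "x \<in> carrier_vec d" "col H j = map_vec to_fract x" using colH \<open>j < d\<close> by blast
    have "H $$ (i, j) = col H j $ i" using that H by simp
    also have "\<dots> = to_fract (x $ i)" unfolding x(2) using x that by simp
    finally show ?thesis by simp
  qed
  have evenH: "\<exists>z\<in>O2. H $$ (i, i) = 2 * z" if i: "i < d" for i
  proof -
    obtain x where x: "x \<in> carrier_vec d" "col H i = map_vec to_fract x" using colH i by blast
    have "b x x = col H i \<bullet> (?G *\<^sub>v col H i)" using form_gram[OF x(1) x(1)] x(2) by (simp add: form_ext_def)
    also have "\<dots> = H $$ (i, i)" unfolding GH[OF i] using i H by simp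
    finally have "H $$ (i, i) = b x x" ..
    moreover obtain z where "b x x = to_fract (2 * z)" using even x by (auto simp: even_lattice_def)
    ultimately show ?thesis by (intro bexI[of _ "to_fract z"]) auto
  qed
  show thesis by (rule that[OF H intG intH evenH])
qed

end

lemma poly_map_to_fract: "poly (map_poly to_fract F) (to_fract x) = to_fract (poly F x)"
  by simp

lemma det_neg:
  assumes "(A :: 'a :: comm_ring_1 mat) \<in> carrier_mat d d"
  shows "det (- A) = (- 1) ^ d * det A"
proof -
  have "- A = (- 1) \<cdot>\<^sub>m A" by (intro eq_matI) auto
  then show ?thesis using assms by simp
qed

lemma star_symmetric_value_1:
  assumes "star_symmetric F" "poly F 1 \<noteq> 0"
  shows "poly F 0 = 1"
proof -
  have "poly F 1 = inverse (poly F 0) * poly (reflect_poly F) 1"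
    using assms(1) unfolding star_symmetric_def by (metis poly_smult)
  moreover have "poly (reflect_poly F) 1 = poly F 1"
    by (simp add: poly_reflect_poly_nz)
  ultimately have "inverse (poly F 0) * poly F 1 = 1 * poly F 1" by simp
  then have "inverse (poly F 0) = 1" using assms(2) by (simp only: mult_cancel_right) simp
  then show ?thesis by (metis inverse_1 inverse_inverse_eq)
qed

lemma minus_one_power_tri: "(- 1 :: 'a :: ring_1) ^ ((2 * n) * (2 * n - 1) div 2) = (- 1) ^ n"
proof -
  have "(2 * n) * (2 * n - 1) div 2 = n * (2 * n - 1)" by (simp add: mult.assoc)
  then show ?thesis by (cases n) (auto simp: minus_one_power_iff)
qed

lemma necessity:
  assumes lat: "z2_lattice d b" and even: "even_lattice d b" and uni: "unimodular d b"
    and disc: "same_square_class (disc d b) 1" and iso: "isometry d b T" and F: "char_poly T = F"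
    and deg: "degree F = 2 * n" and star: "star_symmetric (map_poly to_fract F)"
  shows "even (v2 (poly F 1)) \<and> even (v2 (poly F (- 1))) \<and>
    (poly F 1 * poly F (- 1) \<noteq> 0 \<longrightarrow>
         same_square_class (to_fract ((- 1) ^ n * poly F 1 * poly F (- 1))) 1)"
proof -
  interpret z2_lattice d b by (rule lat)
  let ?T = "map_mat to_fract T" and ?G = "gram d b" and ?I = "1\<^sub>m d :: q2 mat"
  have T: "T \<in> carrier_mat d d" using iso by (simp add: isometry_def)
  then have T': "?T \<in> carrier_mat d d" by simp
  have d: "d = 2 * n" using degree_monic_char_poly[OF T] F deg by simp
  note G = gram_carrier
  have TGT: "transpose_mat ?T * ?G * ?T = ?G"
    by (rule gram_isometry[OF T]) (use iso in \<open>auto simp: isometry_def\<close>)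
  obtain H where H: "H \<in> carrier_mat d d" "?G * H = 1\<^sub>m d"
    "\<And>i j. i < d \<Longrightarrow> j < d \<Longrightarrow> ?G $$ (i, j) \<in> O2"
    "\<And>i j. i < d \<Longrightarrow> j < d \<Longrightarrow> H $$ (i, j) \<in> O2"
    "\<And>i. i < d \<Longrightarrow> \<exists>z\<in>O2. H $$ (i, i) = 2 * z"
    using unimodular_gram[OF uni even] by blast
  have cp: "to_fract (poly F x) = det (to_fract x \<cdot>\<^sub>m ?I - ?T)" for x
    using poly_char_poly[OF T', of "to_fract x"] F to_fract_hom.char_poly_hom[OF T]
    by simp
  have one: "1 \<cdot>\<^sub>m ?I = ?I" by (intro eq_matI) auto
  have sgn: "(- 1 :: q2) ^ d = 1" by (simp add: d)
  have F1: "to_fract (poly F 1) = det (?I - ?T)" using cp[of 1] one by simp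
  have neg1: "- (?T - ?I) = ?I - ?T" "- (?T + ?I) = - 1 \<cdot>\<^sub>m ?I - ?T" "- (- ?T) = ?T"
    "?I - (- ?T) = ?T + ?I" "- ?T = 0 \<cdot>\<^sub>m ?I - ?T"
    using T by (auto intro!: eq_matI)
  have Fm1: "to_fract (poly F (- 1)) = det (?T + ?I)"
    using cp[of "- 1"] det_neg[of "?T + ?I" d] T' by (simp add: neg1 sgn)
  have detm: "det (?T - ?I) = det (?I - ?T)"
    using det_neg[of "?T - ?I" d] T' by (simp add: neg1 sgn minus_carrier_mat)
  have F0: "to_fract (poly F 0) = det ?T"
    using cp[of 0] det_neg[OF T'] by (simp add: neg1 sgn)
  have intT: "?T $$ (i, j) \<in> O2" if "i < d" "j < d" for i j using that T by simp
  have "v2 (poly F 1) = 0 \<or> even (v2 (poly F 1))"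
  proof (cases "poly F 1 = 0")
    case False
    then have "det (?I - ?T) \<noteq> 0" using F1 by (metis to_fract_eq_0_iff)
    from isometry_valuation_even[OF G H(1) T' H(2) gram_sym TGT H(3,4) intT H(5) this]
    obtain e u where "u dvd 1" "to_fract (poly F 1) = to_fract (4 ^ e * u)" using F1 by auto
    then show ?thesis unfolding to_fract_eq_iff by (auto simp: even_v2_iff)
  qed (simp add: v2_def)
  moreover have "v2 (poly F (- 1)) = 0 \<or> even (v2 (poly F (- 1)))"
  proof (cases "poly F (- 1) = 0")
    case False
    then have nz: "det (?I - (- ?T)) \<noteq> 0" using Fm1 neg1 by (metis to_fract_eq_0_iff)
    have mT: "- ?T \<in> carrier_mat d d" using T' by simp
    have iT: "(- ?T) $$ (i, j) \<in> O2" if "i < d" "j < d" for i j using that T by simp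
    have "transpose_mat (- ?T) * ?G * (- ?T) = ?G"
    proof -
      have "transpose_mat (- ?T) = - transpose_mat ?T" by (intro eq_matI) auto
      then show ?thesis using TGT T' G by (simp add: uminus_mult_left_mat uminus_mult_right_mat)
    qed
    from isometry_valuation_even[OF G H(1) mT H(2) gram_sym this H(3,4) iT H(5) nz]
    obtain e u where "u dvd 1" "to_fract (poly F (- 1)) = to_fract (4 ^ e * u)"
      using Fm1 neg1 by auto
    then show ?thesis unfolding to_fract_eq_iff by (auto simp: even_v2_iff)
  qed (simp add: v2_def)
  moreover have "same_square_class (to_fract ((- 1) ^ n * poly F 1 * poly F (- 1))) 1"
    if nz: "poly F 1 * poly F (- 1) \<noteq> 0"
  proof -
    \<comment> \<open>Since F(1) is nonzero, F(0) = 1, and therefore det T = 1.\<close>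
    have "poly (map_poly to_fract F) 1 \<noteq> 0" using nz poly_map_to_fract[of F 1] by auto
    from star_symmetric_value_1[OF star this]
    have "to_fract (poly F 0) = 1" using poly_map_to_fract[of F 0] by simp
    then have detT: "det ?T = 1" using F0 by simp
    obtain r where r: "det ?G * (det (?T - ?I) * det (?T + ?I)) = r\<^sup>2 * det ?T"
      using isometry_discriminant[OF G T' gram_sym TGT] by blast
    let ?f = "to_fract (poly F 1 * poly F (- 1))"
    have e1: "det ?G * ?f = r\<^sup>2" using r detT F1 Fm1 detm by simp
    obtain s where s: "s \<noteq> 0" "(- 1) ^ n * det ?G = s\<^sup>2"
      using disc unfolding same_square_class_def disc_def d minus_one_power_tri by auto
    have g0: "det ?G \<noteq> 0" using s by auto
    have f0: "?f \<noteq> 0" using nz by (metis to_fract_eq_0_iff)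
    \<comment> \<open>Both numerator factors are squares: the first is the discriminant, the second
      the determinant of an alternating matrix.\<close>
    have "to_fract ((- 1) ^ n * poly F 1 * poly F (- 1)) = (- 1) ^ n * ?f" by (simp add: mult.assoc)
    also have "\<dots> = ((- 1) ^ n * det ?G) * (det ?G * ?f) / (det ?G)\<^sup>2"
      using g0 by (simp add: power2_eq_square)
    also have "\<dots> = (s * r / det ?G)\<^sup>2" unfolding s(2) e1 by (simp add: power_divide power_mult_distrib)
    finally have "to_fract ((- 1) ^ n * poly F 1 * poly F (- 1)) = 1 * (s * r / det ?G)\<^sup>2" by simp
    moreover have "to_fract ((- 1) ^ n * poly F 1 * poly F (- 1)) \<noteq> 0" using nz by auto
    ultimately show ?thesis unfolding same_square_class_def
      by (metis mult_zero_right one_neq_zero power_zero_numeral)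
  qed
  ultimately show ?thesis by auto
qed

section \<open>Companion matrices and diagonalizability\<close>

interpretation to_ac_hom: inj_comm_ring_hom "to_ac :: 'a :: field \<Rightarrow> 'a alg_closure"
  by unfold_locales auto

interpretation to_ac_poly_hom: map_poly_inj_comm_ring_hom "to_ac :: 'a :: field \<Rightarrow> 'a alg_closure" ..

definition companion :: "nat \<Rightarrow> 'a :: comm_ring_1 poly \<Rightarrow> 'a mat" where
  "companion N p = mat N N (\<lambda>(i, j). if Suc j < N then (if i = Suc j then 1 else 0) else - coeff p i)"

lemma companion_carrier [simp]: "companion N p \<in> carrier_mat N N"
  and companion_dim [simp]: "dim_row (companion N p) = N" "dim_col (companion N p) = N"
  by (simp_all add: companion_def)

lemma (in comm_ring_hom) companion_hom:
  "map_mat hom (companion N p) = companion N (map_poly hom p)"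
  by (rule eq_matI) (auto simp: companion_def hom_distribs)

text \<open>Stated over the field because the change to a lattice basis is made with matrices over
  \<open>q2\<close>.\<close>

definition diagonalizable :: "q2 mat \<Rightarrow> bool" where
  "diagonalizable T \<longleftrightarrow> (\<exists>D. diagonal_mat D \<and> similar_mat (map_mat to_ac T) D)"

lemma semisimple_iff: "semisimple T \<longleftrightarrow> diagonalizable (map_mat to_fract T)"
proof -
  have "map_mat (\<lambda>x. to_ac (to_fract x)) T = map_mat to_ac (map_mat to_fract T)"
    by (intro eq_matI) auto
  then show ?thesis by (simp add: semisimple_def diagonalizable_def)
qed

lemma diagonalizable_similar:
  assumes "similar_mat A B" "diagonalizable B"
  shows "diagonalizable A"
proof -
  have "similar_mat (map_mat to_ac A) (map_mat to_ac B)"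
  proof -
    obtain n P Q where w: "A \<in> carrier_mat n n" "B \<in> carrier_mat n n" "P \<in> carrier_mat n n"
      "Q \<in> carrier_mat n n" "P * Q = 1\<^sub>m n" "Q * P = 1\<^sub>m n" "A = P * B * Q"
      using similar_matD[OF assms(1)] by auto
    have "map_mat to_ac A = map_mat to_ac P * map_mat to_ac B * map_mat to_ac Q"
      unfolding w(7) to_ac_hom.mat_hom_mult[OF mult_carrier_mat[OF w(3,2)] w(4)]
        to_ac_hom.mat_hom_mult[OF w(3,2)] ..
    moreover have "map_mat to_ac P * map_mat to_ac Q = 1\<^sub>m n" "map_mat to_ac Q * map_mat to_ac P = 1\<^sub>m n"
      using to_ac_hom.mat_hom_mult[OF w(3,4)] to_ac_hom.mat_hom_mult[OF w(4,3)]
      unfolding w(5,6) to_ac_hom.mat_hom_one by simp_all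
    ultimately show ?thesis using w(1-4)
      by (intro similar_matI[of _ _ "map_mat to_ac P" "map_mat to_ac Q" n]) auto
  qed
  moreover obtain D where "diagonal_mat D" "similar_mat (map_mat to_ac B) D"
    using assms(2) by (auto simp: diagonalizable_def)
  ultimately show ?thesis unfolding diagonalizable_def by (metis similar_mat_trans)
qed

lemma similar_mat_carrier:
  assumes "similar_mat A B" "A \<in> carrier_mat n n"
  shows "B \<in> carrier_mat n n"
  using assms similar_mat_witD2(5) unfolding similar_mat_def by blast

lemma diagonalizable_four_block:
  assumes "A \<in> carrier_mat n n" "B \<in> carrier_mat m m" "diagonalizable A" "diagonalizable B"
  shows "diagonalizable (four_block_mat A (0\<^sub>m n m) (0\<^sub>m m n) B)"
proof -
  obtain D E where DE: "diagonal_mat D" "similar_mat (map_mat to_ac A) D"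
    "diagonal_mat E" "similar_mat (map_mat to_ac B) E"
    using assms(3,4) by (auto simp: diagonalizable_def)
  have D: "D \<in> carrier_mat n n"
    by (rule similar_mat_carrier[OF DE(2)]) (simp add: assms)
  have E: "E \<in> carrier_mat m m"
    by (rule similar_mat_carrier[OF DE(4)]) (simp add: assms)
  have "map_mat to_ac (four_block_mat A (0\<^sub>m n m) (0\<^sub>m m n) B)
      = four_block_mat (map_mat to_ac A) (0\<^sub>m n m) (0\<^sub>m m n) (map_mat to_ac B)"
    using assms(1,2) by (subst map_four_block_mat) (auto intro!: cong_four_block_mat eq_matI)
  moreover have "similar_mat \<dots> (four_block_mat D (0\<^sub>m n m) (0\<^sub>m m n) E)"
    by (rule similar_mat_four_block_0_0[OF DE(2,4)]) (use assms(1,2) in auto)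
  moreover have "diagonal_mat (four_block_mat D (0\<^sub>m n m) (0\<^sub>m m n) E)"
    using DE(1,3) D E by (auto simp: diagonal_mat_def)
  ultimately show ?thesis unfolding diagonalizable_def by auto
qed

lemma diagonalizable_uminus:
  assumes "diagonalizable A"
  shows "diagonalizable (- A)"
proof -
  obtain D where D: "diagonal_mat D" "similar_mat (map_mat to_ac A) D"
    using assms by (auto simp: diagonalizable_def)
  have "map_mat to_ac (- A) = (- 1) \<cdot>\<^sub>m map_mat to_ac A" by (intro eq_matI) auto
  moreover have "similar_mat \<dots> ((- 1) \<cdot>\<^sub>m D)" using D(2) by (rule similar_mat_smult)
  moreover have "diagonal_mat ((- 1) \<cdot>\<^sub>m D)" using D(1) by (auto simp: diagonal_mat_def)
  ultimately show ?thesis unfolding diagonalizable_def by auto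
qed

text \<open>With A = P D Q the inverse is P E Q where D E = 1; then D has no zero on its diagonal,
  and E is diagonal as well. It serves the dual half of a hyperbolic lattice.\<close>

lemma diagonalizable_inverse_transpose:
  assumes A: "A \<in> carrier_mat n n" and B: "B \<in> carrier_mat n n" and AB: "A * B = 1\<^sub>m n"
    and dA: "diagonalizable A"
  shows "diagonalizable (transpose_mat B)"
proof -
  let ?A = "map_mat to_ac A" and ?B = "map_mat to_ac B"
  note sq = square_mat_simps[where n = n] transpose_mult_square[where n = n] one_mult_square[where n = n]
  have A': "?A \<in> carrier_mat n n" and B': "?B \<in> carrier_mat n n" using A B by auto
  have AB': "?A * ?B = 1\<^sub>m n"
    using to_ac_hom.mat_hom_mult[OF A B] AB by (simp add: to_ac_hom.mat_hom_one)
  obtain D where D: "diagonal_mat D" "similar_mat ?A D" using dA by (auto simp: diagonalizable_def)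
  then obtain P Q where w: "similar_mat_wit ?A D P Q" by (auto simp: similar_mat_def)
  note PQ = similar_mat_witD2[OF A' w]
  note c[simp] = A B A' B' PQ(5-7)
  define E where "E = Q * (?B * P)"
  have E: "E \<in> carrier_mat n n" unfolding E_def by (simp add: sq)
  have "D * E = (Q * P) * (D * (Q * (?B * P)))" unfolding PQ(2) using E[unfolded E_def] by (simp add: E_def sq)
  also have "\<dots> = Q * ((P * D * Q) * ?B) * P" by (simp add: sq)
  also have "\<dots> = 1\<^sub>m n" unfolding PQ(3)[symmetric] AB' using PQ(2) by (simp add: sq)
  finally have DE: "D * E = 1\<^sub>m n" .
  have ij: "D $$ (i, i) * E $$ (i, j) = (if i = j then 1 else 0)" if "i < n" "j < n" for i j
  proof -
    have "(if i = j then 1 else 0) = (D * E) $$ (i, j)" unfolding DE using that by simp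
    also have "\<dots> = (\<Sum>l = 0..<n. D $$ (i, l) * E $$ (l, j))"
      by (rule mult_mat_index[OF PQ(5) E that])
    also have "\<dots> = (\<Sum>l = 0..<n. if l = i then D $$ (i, i) * E $$ (i, j) else 0)"
      using D(1) that PQ(5) by (intro sum.cong) (auto simp: diagonal_mat_def)
    finally show ?thesis using that by simp
  qed
  have dE: "E $$ (i, j) = 0" if "i < n" "j < n" "i \<noteq> j" for i j
    using ij[of i j] ij[of i i] that by auto
  have BP: "?B = P * (E * Q)"
  proof -
    have "P * (E * Q) = (P * Q) * (?B * (P * Q))" unfolding E_def by (simp add: sq)
    then show ?thesis unfolding PQ(1) by (simp add: sq)
  qed
  have "transpose_mat ?B = transpose_mat Q * transpose_mat E * transpose_mat P"
    unfolding BP using E by (simp add: sq)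
  moreover have "transpose_mat Q * transpose_mat P = 1\<^sub>m n" "transpose_mat P * transpose_mat Q = 1\<^sub>m n"
    using transpose_mult_square[OF PQ(6,7)] transpose_mult_square[OF PQ(7,6)] unfolding PQ(1,2)
    by (metis transpose_one)+
  ultimately have "similar_mat (transpose_mat ?B) (transpose_mat E)"
    using E by (intro similar_matI[of _ _ "transpose_mat Q" "transpose_mat P" n]) (simp_all add: sq)
  moreover have "map_mat to_ac (transpose_mat B) = transpose_mat ?B" by (intro eq_matI) auto
  moreover have "diagonal_mat (transpose_mat E)" using dE E by (auto simp: diagonal_mat_def)
  ultimately show ?thesis unfolding diagonalizable_def by auto
qed

text \<open>Coprimality with the derivative as a Bezout identity, which passes to the algebraic
  closure by mapping coefficients.\<close>

definition separable :: "'a :: field poly \<Rightarrow> bool" where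
  "separable p \<longleftrightarrow> (\<exists>u v. u * p + v * pderiv p = 1)"

text \<open>The rows of the Vandermonde matrix are left eigenvectors of the companion
  matrix.\<close>

lemma companion_distinct_roots:
  fixes p :: "'a :: field poly"
  assumes as: "distinct as" "length as = N" and p: "p = (\<Prod>a\<leftarrow>as. [:- a, 1:])"
  shows "\<exists>D. diagonal_mat D \<and> similar_mat (companion N p) D" "char_poly (companion N p) = p"
proof -
  let ?C = "companion N p"
  define V where "V = mat N N (\<lambda>(i, j). (as ! i) ^ j)"
  define D where "D = mat N N (\<lambda>(i, j). if i = j then as ! i else 0)"
  have c[simp]: "V \<in> carrier_mat N N" "D \<in> carrier_mat N N" by (auto simp: V_def D_def)
  have "lead_coeff (\<Prod>a\<leftarrow>as. [:- a, 1:]) = 1 \<and> degree (\<Prod>a\<leftarrow>as. [:- a, 1:]) = length as"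
  proof (induction as)
    case (Cons a as)
    let ?P = "\<Prod>a\<leftarrow>as. [:- a, 1:]"
    have "?P \<noteq> 0" using Cons by auto
    then have "degree ([:- a, 1:] * ?P) = Suc (length as)" using Cons
      by (subst degree_mult_eq) auto
    moreover have "lead_coeff ([:- a, 1:] * ?P) = 1"
    proof -
      have "lead_coeff ?P = 1" using Cons by blast
      then show ?thesis unfolding lead_coeff_mult by simp
    qed
    ultimately show ?case by (simp del: mult_pCons_left)
  qed simp
  then have deg: "degree p = N" and lead: "coeff p N = 1" using as(2) p by auto
  have root: "poly p a = 0" if "a \<in> set as" for a
    using that unfolding p by (auto simp: poly_prod_list prod_list_zero_iff)
  have pow: "(\<Sum>i<N. coeff p i * a ^ i) = - (a ^ N)" if "a \<in> set as" for a
  proof -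
    have "poly p a = (\<Sum>i\<le>N. coeff p i * a ^ i)" by (simp add: poly_altdef deg)
    also have "\<dots> = (\<Sum>i<N. coeff p i * a ^ i) + a ^ N"
      by (simp add: lessThan_Suc_atMost[symmetric] lead)
    finally show ?thesis using root[OF that] by (simp add: eq_neg_iff_add_eq_0)
  qed
  have VC: "V * ?C = D * V"
  proof (rule eq_matI)
    fix i j assume "i < dim_row (D * V)" "j < dim_col (D * V)"
    then have ij: "i < N" "j < N" by (auto simp: V_def D_def)
    have "(D * V) $$ (i, j) = (\<Sum>l = 0..<N. D $$ (i, l) * V $$ (l, j))"
      by (rule mult_mat_index[OF c(2,1) ij])
    also have "\<dots> = (\<Sum>l = 0..<N. if l = i then as ! i * (as ! i) ^ j else 0)"
      using ij by (intro sum.cong) (auto simp: D_def V_def)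
    also have "\<dots> = (as ! i) ^ Suc j" using ij by simp
    finally have r: "(D * V) $$ (i, j) = (as ! i) ^ Suc j" .
    have "(V * ?C) $$ (i, j) = (\<Sum>l = 0..<N. V $$ (i, l) * ?C $$ (l, j))"
      by (rule mult_mat_index[OF c(1) companion_carrier ij])
    also have "\<dots> = (as ! i) ^ Suc j"
    proof (cases "Suc j < N")
      case True
      have "(\<Sum>l = 0..<N. V $$ (i, l) * ?C $$ (l, j)) = (\<Sum>l = 0..<N. if l = Suc j then (as ! i) ^ Suc j else 0)"
        using ij True by (intro sum.cong) (auto simp: V_def companion_def)
      then show ?thesis using True by simp
    next
      case False
      then have N: "N = Suc j" using ij by simp
      have "(\<Sum>l = 0..<N. V $$ (i, l) * ?C $$ (l, j)) = (\<Sum>l = 0..<N. - (coeff p l * (as ! i) ^ l))"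
        using ij False by (intro sum.cong) (auto simp: V_def companion_def)
      also have "\<dots> = - (\<Sum>l<N. coeff p l * (as ! i) ^ l)"
        by (simp add: sum_negf atLeast0LessThan)
      also have "\<dots> = (as ! i) ^ N" using pow[of "as ! i"] as(2) ij by simp
      finally show ?thesis unfolding N .
    qed
    finally show "(V * ?C) $$ (i, j) = (D * V) $$ (i, j)" using r by simp
  qed (auto simp: V_def D_def companion_def)
  have "det V \<noteq> 0"
  proof
    assume "det V = 0"
    then obtain v where v: "v \<in> carrier_vec N" "v \<noteq> 0\<^sub>v N" "V *\<^sub>v v = 0\<^sub>v N"
      using det_0_iff_vec_prod_zero_field[OF c(1)] by blast
    \<comment> \<open>A kernel vector of \<open>V\<close> is the coefficient vector of a nonzero
      polynomial of degree less than N that vanishes at N points.\<close>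
    define q where "q = (\<Sum>j<N. monom (v $ j) j)"
    have cq: "coeff q k = (if k < N then v $ k else 0)" for k
      unfolding q_def by (simp add: coeff_sum)
    have "q \<noteq> 0"
    proof
      assume "q = 0"
      then have "v $ k = 0" if "k < N" for k using cq[of k] that by simp
      then have "v = 0\<^sub>v N" using v(1) by (intro eq_vecI) auto
      then show False using v(2) by simp
    qed
    have "poly q (as ! i) = 0" if "i < N" for i
    proof -
      have "poly q (as ! i) = (\<Sum>j<N. v $ j * (as ! i) ^ j)"
        by (simp add: q_def poly_sum poly_monom)
      also have "\<dots> = (V *\<^sub>v v) $ i"
        using that v(1) by (auto simp: V_def scalar_prod_def atLeast0LessThan mult.commute intro!: sum.cong)
      finally show ?thesis using that v(3) by simp
    qed
    then have "set as \<subseteq> {x. poly q x = 0}" using as(2) by (auto simp: in_set_conv_nth)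
    then have "card (set as) \<le> card {x. poly q x = 0}"
      using poly_roots_finite[OF \<open>q \<noteq> 0\<close>] by (intro card_mono) auto
    also have "\<dots> \<le> degree q" by (rule card_poly_roots_bound[OF \<open>q \<noteq> 0\<close>])
    finally have "N \<le> degree q" using as distinct_card by fastforce
    moreover have "degree q < N"
    proof -
      have "N \<noteq> 0" using v(1,2) by auto
      moreover have "degree q \<le> N - 1" by (rule degree_le) (auto simp: cq)
      ultimately show ?thesis by simp
    qed
    ultimately show False by simp
  qed
  then have "det V dvd 1" by (simp add: dvd_field_iff)
  then obtain W where W: "W \<in> carrier_mat N N" "V * W = 1\<^sub>m N" "W * V = 1\<^sub>m N"
    by (rule inverse_mat_exists[OF c(1)])
  note sq = square_mat_simps[where n = N] one_mult_square[where n = N]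
  have "?C = (W * V) * ?C" unfolding W by simp
  also have "\<dots> = W * (V * ?C)" using W(1) by (simp add: sq)
  also have "\<dots> = W * D * V" unfolding VC using W by (simp add: sq)
  finally have sim: "similar_mat ?C D"
    using W by (intro similar_matI[of _ _ W V N]) (simp_all add: sq)
  have dD: "diagonal_mat D" by (auto simp: diagonal_mat_def D_def)
  show "\<exists>D. diagonal_mat D \<and> similar_mat ?C D" using sim dD by blast
  have "char_poly ?C = char_poly D" by (rule char_poly_similar[OF sim])
  also have "\<dots> = (\<Prod>a\<leftarrow>diag_mat D. [:- a, 1:])"
    by (rule char_poly_upper_triangular[OF c(2)]) (auto simp: upper_triangular_def D_def)
  also have "diag_mat D = as"
    using as(2) by (intro nth_equalityI) (auto simp: diag_mat_def D_def)
  finally show "char_poly ?C = p" using p by simp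
qed

lemma separable_companion:
  fixes p :: "q2 poly"
  assumes sep: "separable p" and monic: "lead_coeff p = 1" and deg: "degree p = N"
  shows "diagonalizable (companion N p)" "char_poly (companion N p) = p"
proof -
  let ?p = "map_poly to_ac p"
  have lc: "lead_coeff ?p = 1" using monic by simp
  then have "?p \<noteq> 0" by auto
  from alg_closed_imp_factorization[OF this] obtain A where
    A0: "size A = degree ?p" "?p = smult (lead_coeff ?p) (\<Prod>x\<in>#A. [:-x, 1:])" by blast
  have A: "size A = degree ?p" "?p = (\<Prod>x\<in>#A. [:-x, 1:])"
    using A0 unfolding lc by simp_all
  obtain as where as: "mset as = A" using ex_mset by blast
  have len: "length as = N" using A(1) as deg by (simp flip: size_mset)
  have pas: "?p = (\<Prod>a\<leftarrow>as. [:- a, 1:])"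
    unfolding A(2) as[symmetric] by (simp add: prod_mset_prod_list flip: mset_map)
  obtain u v where uv: "u * p + v * pderiv p = 1" using sep by (auto simp: separable_def)
  have pd: "map_poly to_ac (pderiv p) = pderiv ?p"
    by (rule poly_eqI) (simp add: coeff_pderiv)
  have bez: "map_poly to_ac u * ?p + map_poly to_ac v * pderiv ?p = 1"
    using arg_cong[OF uv, of "map_poly to_ac"] unfolding pd[symmetric]
    by (simp add: to_ac_poly_hom.hom_mult to_ac_poly_hom.hom_add)
  have "distinct as"
  proof (rule ccontr)
    assume "\<not> distinct as"
    then obtain xs ys zs y where d: "as = xs @ [y] @ ys @ [y] @ zs"
      using not_distinct_decomp by blast
    define r where "r = (\<Prod>a\<leftarrow>xs @ ys @ zs. [:- a, 1:])"
    have e: "?p = [:- y, 1:] * ([:- y, 1:] * r)" unfolding pas d r_def by (simp add: ac_simps del: mult_pCons_left mult_pCons_right)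
    have "poly ?p y = 0" "poly (pderiv ?p) y = 0"
      unfolding e by (simp_all add: pderiv_mult del: mult_pCons_left mult_pCons_right)
    then have "poly (map_poly to_ac u * ?p + map_poly to_ac v * pderiv ?p) y = 0" by simp
    then show False unfolding bez by simp
  qed
  note res = companion_distinct_roots[OF this len pas]
  show "diagonalizable (companion N p)"
    unfolding diagonalizable_def to_ac_hom.companion_hom using res(1) .
  have "map_poly to_ac (char_poly (companion N p)) = map_poly to_ac p"
    using res(2) to_ac_hom.char_poly_hom[OF companion_carrier, of N p] by (simp add: to_ac_hom.companion_hom)
  then show "char_poly (companion N p) = p" by simp
qed

section \<open>Realizable polynomials\<close>

text \<open>Existence of the lattice in terms of integral matrices only. In rank 2n the sign of the
  discriminant is (-1)^n; asking for the square of a unit of \<open>z2\<close> states unimodularity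
  and discriminant 1 at once.\<close>

definition realizable :: "z2 poly \<Rightarrow> bool" where
  "realizable F \<longleftrightarrow> (\<exists>n G T. G \<in> carrier_mat (2 * n) (2 * n) \<and> T \<in> carrier_mat (2 * n) (2 * n) \<and>
     transpose_mat G = G \<and> (\<forall>i<2 * n. 2 dvd G $$ (i, i)) \<and> transpose_mat T * G * T = G \<and>
     (\<exists>s. s dvd 1 \<and> (- 1) ^ n * det G = s\<^sup>2) \<and> char_poly T = F \<and> semisimple T)"

text \<open>Off-diagonal terms come in equal pairs, which leaves the diagonal modulo 2.\<close>

lemma symmetric_even_form:
  fixes G :: "'a :: comm_ring_1 mat"
  assumes G: "G \<in> carrier_mat d d" "transpose_mat G = G" and even: "\<forall>i<d. 2 dvd G $$ (i, i)"
    and x: "x \<in> carrier_vec d"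
  shows "2 dvd x \<bullet> (G *\<^sub>v x)"
proof -
  have s: "G $$ (i, j) = G $$ (j, i)" if "i < d" "j < d" for i j
    using arg_cong[OF G(2), of "\<lambda>M. M $$ (i, j)"] G(1) that by simp
  have "k \<le> d \<Longrightarrow> 2 dvd (\<Sum>i = 0..<k. \<Sum>j = 0..<k. x $ i * (G $$ (i, j) * x $ j))" for k
  proof (induction k)
    case (Suc k)
    have e: "(\<Sum>i = 0..<Suc k. \<Sum>j = 0..<Suc k. x $ i * (G $$ (i, j) * x $ j))
      = (\<Sum>i = 0..<k. \<Sum>j = 0..<k. x $ i * (G $$ (i, j) * x $ j))
        + (\<Sum>i = 0..<k. x $ i * (G $$ (i, k) * x $ k)) + (\<Sum>j = 0..<k. x $ k * (G $$ (k, j) * x $ j))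
        + G $$ (k, k) * (x $ k * x $ k)"
    proof -
      have gen: "(\<Sum>i = 0..<Suc k. \<Sum>j = 0..<Suc k. f i j)
        = (\<Sum>i = 0..<k. \<Sum>j = 0..<k. f i j) + (\<Sum>i = 0..<k. f i k) + (\<Sum>j = 0..<k. f k j) + f k k"
        for f :: "nat \<Rightarrow> nat \<Rightarrow> 'a"
        by (simp add: sum.distrib add.assoc)
      show ?thesis unfolding gen by (simp only: ac_simps)
    qed
    have eq: "(\<Sum>j = 0..<k. x $ k * (G $$ (k, j) * x $ j)) = (\<Sum>i = 0..<k. x $ i * (G $$ (i, k) * x $ k))"
    proof (rule sum.cong)
      fix j assume j: "j \<in> {0..<k}"
      have kj: "G $$ (k, j) = G $$ (j, k)" by (rule s) (use Suc.prems j in auto)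
      show "x $ k * (G $$ (k, j) * x $ j) = x $ j * (G $$ (j, k) * x $ k)"
        unfolding kj by (simp only: ac_simps)
    qed simp
    have e2: "(\<Sum>i = 0..<Suc k. \<Sum>j = 0..<Suc k. x $ i * (G $$ (i, j) * x $ j))
      = (\<Sum>i = 0..<k. \<Sum>j = 0..<k. x $ i * (G $$ (i, j) * x $ j))
        + 2 * (\<Sum>i = 0..<k. x $ i * (G $$ (i, k) * x $ k)) + G $$ (k, k) * (x $ k * x $ k)"
      unfolding e eq by (simp only: mult_2 add.assoc)
    have "2 dvd G $$ (k, k) * (x $ k * x $ k)" using even Suc.prems by simp
    then show ?case unfolding e2 using Suc by (intro dvd_add) auto
  qed simp
  moreover have "x \<bullet> (G *\<^sub>v x) = (\<Sum>i = 0..<d. \<Sum>j = 0..<d. x $ i * (G $$ (i, j) * x $ j))"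
    using G(1) x by (auto simp: scalar_prod_def sum_distrib_left intro!: sum.cong)
  ultimately show ?thesis by simp
qed

lemma map_vec_smult_prod:
  fixes x y :: "z2 vec"
  assumes "x \<in> carrier_vec d" "y \<in> carrier_vec d"
  shows "map_vec to_fract x \<bullet> map_vec to_fract y = to_fract (x \<bullet> y)"
  using assms by (auto simp: scalar_prod_def intro!: sum.cong)

lemma realizable_imp_lattice:
  assumes "realizable F"
  shows "\<exists>d b T. z2_lattice d b \<and> even_lattice d b \<and> unimodular d b \<and>
    same_square_class (disc d b) 1 \<and> isometry d b T \<and> semisimple T \<and> char_poly T = F"
proof -
  obtain n G T s where G: "G \<in> carrier_mat (2 * n) (2 * n)" and T: "T \<in> carrier_mat (2 * n) (2 * n)"
    and sym: "transpose_mat G = G" and even: "\<forall>i<2 * n. 2 dvd G $$ (i, i)"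
    and TGT: "transpose_mat T * G * T = G" and s: "s dvd 1" "(- 1) ^ n * det G = s\<^sup>2"
    and F: "char_poly T = F" "semisimple T"
    using assms unfolding realizable_def by blast
  define d where "d = 2 * n"
  note G = G[folded d_def] and T = T[folded d_def] and even = even[folded d_def]
  define b where "b x y = to_fract (x \<bullet> (G *\<^sub>v y))" for x y
  have "s\<^sup>2 dvd 1" using s(1) by (simp add: power2_eq_square is_unit_mult_iff)
  then have uG: "det G dvd 1" unfolding s(2)[symmetric] is_unit_mult_iff by simp
  then obtain H where H: "H \<in> carrier_mat d d" "G * H = 1\<^sub>m d" "H * G = 1\<^sub>m d"
    by (rule inverse_mat_exists[OF G])
  have Gx: "G *\<^sub>v x \<in> carrier_vec d" if "x \<in> carrier_vec d" for x using G that by simp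
  have HGx: "H *\<^sub>v (G *\<^sub>v x) = x" if "x \<in> carrier_vec d" for x
    using assoc_mult_mat_vec[OF H(1) G that] H(3) that by simp
  have gs: "x \<bullet> (G *\<^sub>v y) = (G *\<^sub>v x) \<bullet> y" if "x \<in> carrier_vec d" "y \<in> carrier_vec d" for x y
    using transpose_vec_mult_scalar[OF G that(2,1)] sym that by simp
  have lat: "z2_lattice d b"
  proof
    fix x y z :: "z2 vec" and c :: z2
    show "b (x + y) z = b x z + b y z" if "x \<in> carrier_vec d" "y \<in> carrier_vec d" "z \<in> carrier_vec d"
      using that Gx unfolding b_def by (simp add: add_scalar_prod_distrib)
    show "b (c \<cdot>\<^sub>v x) y = to_fract c * b x y" if "x \<in> carrier_vec d" "y \<in> carrier_vec d"
      using that G unfolding b_def by simp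
    show "b x y = b y x" if "x \<in> carrier_vec d" "y \<in> carrier_vec d"
      unfolding b_def gs[OF that] using comm_scalar_prod[OF Gx[OF that(1)] that(2)] by simp
    show "x = 0\<^sub>v d" if x: "x \<in> carrier_vec d" and 0: "\<And>y. y \<in> carrier_vec d \<Longrightarrow> b x y = 0"
    proof -
      have "G *\<^sub>v x = 0\<^sub>v d"
      proof (rule eq_vecI)
        fix i assume "i < dim_vec (0\<^sub>v d :: z2 vec)"
        then have i: "i < d" by simp
        have "(G *\<^sub>v x) $ i = (G *\<^sub>v x) \<bullet> unit_vec d i" using Gx[OF x] i by simp
        also have "\<dots> = x \<bullet> (G *\<^sub>v unit_vec d i)" using gs[OF x] i by simp
        also have "\<dots> = 0" using 0[of "unit_vec d i"] i unfolding b_def by simp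
        finally show "(G *\<^sub>v x) $ i = 0\<^sub>v d $ i" using i by simp
      qed (use G in simp)
      then have "x = H *\<^sub>v 0\<^sub>v d" using HGx[OF x] by simp
      also have "\<dots> = 0\<^sub>v d" using H(1) by (intro eq_vecI) auto
      finally show ?thesis .
    qed
  qed
  have ev: "even_lattice d b"
    unfolding even_lattice_def b_def
  proof
    fix x :: "z2 vec" assume "x \<in> carrier_vec d"
    from symmetric_even_form[OF G sym even this] obtain z where "x \<bullet> (G *\<^sub>v x) = 2 * z" by (elim dvdE)
    then show "\<exists>z. to_fract (x \<bullet> (G *\<^sub>v x)) = to_fract (2 * z)" by metis
  qed
  have gram: "gram d b = map_mat to_fract G"
    using G unfolding gram_def b_def by (intro eq_matI) auto
  have Gy: "map_mat to_fract G *\<^sub>v map_vec to_fract y = map_vec to_fract (G *\<^sub>v y)" if "y \<in> carrier_vec d" for y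
    using to_fract_hom.mult_mat_vec_hom[OF G that] by simp
  have uni: "unimodular d b"
    unfolding unimodular_def
  proof (intro equalityI subsetI)
    fix y assume "y \<in> lattice_in_ext d"
    then obtain y0 where y0: "y0 \<in> carrier_vec d" "y = map_vec to_fract y0"
      unfolding lattice_in_ext_def by blast
    have "form_ext d b x y \<in> range to_fract" if xl: "x \<in> lattice_in_ext d" for x
    proof -
      obtain x0 where x0: "x0 \<in> carrier_vec d" "x = map_vec to_fract x0"
        using xl unfolding lattice_in_ext_def by blast
      show ?thesis unfolding form_ext_def gram y0(2) x0(2) Gy[OF y0(1)]
        using map_vec_smult_prod[OF x0(1) Gx[OF y0(1)]] by simp
    qed
    then show "y \<in> dual_lattice d b" using y0 unfolding dual_lattice_def by auto
  next
    fix y assume y: "y \<in> dual_lattice d b"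
    then have yc: "y \<in> carrier_vec d" by (simp add: dual_lattice_def)
    let ?G = "map_mat to_fract G" and ?H = "map_mat to_fract H"
    \<comment> \<open>Pairing y with the unit vectors shows that G y is integral, and y is recovered
      from it by the integral inverse of G.\<close>
    have GyO: "(?G *\<^sub>v y) $ i \<in> range to_fract" if i: "i < d" for i
    proof -
      have "map_vec to_fract (unit_vec d i) \<in> lattice_in_ext d"
        unfolding lattice_in_ext_def by simp
      then have "form_ext d b (map_vec to_fract (unit_vec d i)) y \<in> range to_fract"
        using y unfolding dual_lattice_def by blast
      moreover have "map_vec to_fract (unit_vec d i :: z2 vec) = unit_vec d i"
        by (intro eq_vecI) (auto simp: unit_vec_def)
      moreover have "form_ext d b (unit_vec d i) y = (?G *\<^sub>v y) $ i"
        unfolding form_ext_def gram by (rule scalar_prod_left_unit[OF mult_mat_vec_carrier[OF _ yc] i]) (use G in simp)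
      ultimately show ?thesis by simp
    qed
    then have "\<forall>i. \<exists>w. i < d \<longrightarrow> (?G *\<^sub>v y) $ i = to_fract w" by blast
    then obtain w where w: "\<And>i. i < d \<Longrightarrow> (?G *\<^sub>v y) $ i = to_fract (w i)" by metis
    have wv: "?G *\<^sub>v y = map_vec to_fract (vec d w)"
      using w G by (intro eq_vecI) auto
    have "?H * ?G = 1\<^sub>m d"
      using to_fract_hom.mat_hom_mult[OF H(1) G] unfolding H(3) to_fract_hom.mat_hom_one by simp
    then have "y = ?H *\<^sub>v (?G *\<^sub>v y)"
      using assoc_mult_mat_vec[of ?H d d ?G d y] H(1) G yc by simp
    also have "\<dots> = map_vec to_fract (H *\<^sub>v vec d w)"
      unfolding wv using to_fract_hom.mult_mat_vec_hom[OF H(1), of "vec d w"] by simp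
    finally have "y = map_vec to_fract (H *\<^sub>v vec d w)" .
    moreover have "H *\<^sub>v vec d w \<in> carrier_vec d" using H(1) by simp
    ultimately show "y \<in> lattice_in_ext d" unfolding lattice_in_ext_def by blast
  qed
  have "disc d b = to_fract s ^ 2"
  proof -
    have "disc d b = (- 1) ^ n * to_fract (det G)"
      unfolding disc_def gram to_fract_hom.hom_det minus_one_power_tri[of n, folded d_def] ..
    also have "\<dots> = to_fract ((- 1) ^ n * det G)" by simp
    finally show ?thesis unfolding s(2) by simp
  qed
  moreover have "s \<noteq> 0" using s(1) by auto
  ultimately have disc: "same_square_class (disc d b) 1"
    unfolding same_square_class_def by (intro conjI exI[of _ "to_fract s"]) auto
  \<comment> \<open>Comparing determinants in the isometry equation gives det T = 1 or -1, so T is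
    bijective on the lattice.\<close>
  have "det T * det T * det G = det G"
  proof -
    have tT: "transpose_mat T \<in> carrier_mat d d" using T by simp
    have "det (transpose_mat T * G * T) = det T * det G * det T"
      using det_mult[OF mult_carrier_mat[OF tT G] T] det_mult[OF tT G] det_transpose[OF T] by simp
    then show ?thesis unfolding TGT by (simp add: ac_simps)
  qed
  then have "det T * det T = 1" using uG by auto
  then have "det T dvd 1" by (metis dvd_triv_left)
  then obtain S where S: "S \<in> carrier_mat d d" "T * S = 1\<^sub>m d" "S * T = 1\<^sub>m d"
    by (rule inverse_mat_exists[OF T])
  have bij: "bij_betw (\<lambda>x. T *\<^sub>v x) (carrier_vec d) (carrier_vec d)"
  proof (rule bij_betw_byWitness[where f' = "\<lambda>x. S *\<^sub>v x"])
    show "\<forall>x\<in>carrier_vec d. S *\<^sub>v (T *\<^sub>v x) = x"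
      using assoc_mult_mat_vec[OF S(1) T] unfolding S(3) by simp
    show "\<forall>x\<in>carrier_vec d. T *\<^sub>v (S *\<^sub>v x) = x"
      using assoc_mult_mat_vec[OF T S(1)] unfolding S(2) by simp
  qed (use S(1) T in auto)
  have isob: "b (T *\<^sub>v x) (T *\<^sub>v y) = b x y" if "x \<in> carrier_vec d" "y \<in> carrier_vec d" for x y
  proof -
    have tT: "transpose_mat T \<in> carrier_mat d d" using T by simp
    have Ty: "T *\<^sub>v y \<in> carrier_vec d" using T that by simp
    have "(T *\<^sub>v x) \<bullet> (G *\<^sub>v (T *\<^sub>v y)) = x \<bullet> (transpose_mat T *\<^sub>v (G *\<^sub>v (T *\<^sub>v y)))"
      using transpose_vec_mult_scalar[OF tT Gx[OF Ty] that(1)] by simp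
    also have "transpose_mat T *\<^sub>v (G *\<^sub>v (T *\<^sub>v y)) = (transpose_mat T * G * T) *\<^sub>v y"
      using assoc_mult_mat_vec[OF mult_carrier_mat[OF tT G] T that(2)] assoc_mult_mat_vec[OF tT G Ty] by simp
    finally show ?thesis unfolding TGT b_def by simp
  qed
  have "isometry d b T" unfolding isometry_def using T bij isob by auto
  then show ?thesis using lat ev uni disc F by blast
qed

section \<open>Orthogonal sums and the change from T to -T\<close>

lemma char_poly_four_block:
  fixes A B :: "'a :: idom mat"
  assumes A: "A \<in> carrier_mat n n" and B: "B \<in> carrier_mat m m"
  shows "char_poly (four_block_mat A (0\<^sub>m n m) (0\<^sub>m m n) B) = char_poly A * char_poly B"
proof -
  have "char_poly_matrix (four_block_mat A (0\<^sub>m n m) (0\<^sub>m m n) B)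
      = four_block_mat (char_poly_matrix A) (0\<^sub>m n m) (0\<^sub>m m n) (char_poly_matrix B)"
    using assms by (intro eq_matI) (auto simp: char_poly_matrix_def)
  then show ?thesis unfolding char_poly_def
    using det_four_block_mat_lower_left_zero[of "char_poly_matrix A" n "0\<^sub>m n m" m "0\<^sub>m m n" "char_poly_matrix B"] A B
    by simp
qed

lemma block_diag_mult:
  fixes A B C D :: "'a :: semiring_1 mat"
  assumes "A \<in> carrier_mat n n" "B \<in> carrier_mat m m" "C \<in> carrier_mat n n" "D \<in> carrier_mat m m"
  shows "four_block_mat A (0\<^sub>m n m) (0\<^sub>m m n) B * four_block_mat C (0\<^sub>m n m) (0\<^sub>m m n) D
    = four_block_mat (A * C) (0\<^sub>m n m) (0\<^sub>m m n) (B * D)"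
  by (subst mult_four_block_mat[OF assms(1) zero_carrier_mat zero_carrier_mat assms(2) assms(3) zero_carrier_mat zero_carrier_mat assms(4)])
    (use assms in \<open>auto intro!: cong_four_block_mat\<close>)

lemma block_diag_transpose:
  assumes "A \<in> carrier_mat n n" "B \<in> carrier_mat m m"
  shows "transpose_mat (four_block_mat A (0\<^sub>m n m) (0\<^sub>m m n) B)
    = four_block_mat (transpose_mat A) (0\<^sub>m n m) (0\<^sub>m m n) (transpose_mat B)"
  using assms by (intro eq_matI) auto

lemma realizable_mult:
  assumes "realizable F1" "realizable F2"
  shows "realizable (F1 * F2)"
proof -
  obtain n G T s where G: "G \<in> carrier_mat (2 * n) (2 * n)" and T: "T \<in> carrier_mat (2 * n) (2 * n)"
    and sym: "transpose_mat G = G" and even: "\<forall>i<2 * n. 2 dvd G $$ (i, i)"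
    and TGT: "transpose_mat T * G * T = G" and s: "s dvd 1" "(- 1) ^ n * det G = s\<^sup>2"
    and F: "char_poly T = F1" "semisimple T"
    using assms(1) unfolding realizable_def by blast
  obtain m H S r where H: "H \<in> carrier_mat (2 * m) (2 * m)" and S: "S \<in> carrier_mat (2 * m) (2 * m)"
    and symH: "transpose_mat H = H" and evenH: "\<forall>i<2 * m. 2 dvd H $$ (i, i)"
    and SHS: "transpose_mat S * H * S = H" and r: "r dvd 1" "(- 1) ^ m * det H = r\<^sup>2"
    and F': "char_poly S = F2" "semisimple S"
    using assms(2) unfolding realizable_def by blast
  let ?b = "\<lambda>A B :: z2 mat. four_block_mat A (0\<^sub>m (2 * n) (2 * m)) (0\<^sub>m (2 * m) (2 * n)) B"
  have c: "?b A B \<in> carrier_mat (2 * (n + m)) (2 * (n + m))"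
    if "A \<in> carrier_mat (2 * n) (2 * n)" "B \<in> carrier_mat (2 * m) (2 * m)" for A B
    using four_block_carrier_mat[OF that] by (simp add: algebra_simps)
  have tT: "transpose_mat T \<in> carrier_mat (2 * n) (2 * n)" and tS: "transpose_mat S \<in> carrier_mat (2 * m) (2 * m)"
    using T S by auto
  have iso: "transpose_mat (?b T S) * ?b G H * ?b T S = ?b G H"
    unfolding block_diag_transpose[OF T S] block_diag_mult[OF tT tS G H]
      block_diag_mult[OF mult_carrier_mat[OF tT G] mult_carrier_mat[OF tS H] T S] TGT SHS ..
  have "det (?b G H) = det G * det H"
    by (rule det_four_block_mat_lower_left_zero[OF G zero_carrier_mat refl H])
  then have "(- 1) ^ (n + m) * det (?b G H) = ((- 1) ^ n * det G) * ((- 1) ^ m * det H)"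
    by (simp add: power_add ac_simps)
  also have "\<dots> = (s * r)\<^sup>2" unfolding s r by (simp add: power_mult_distrib)
  finally have det: "(- 1) ^ (n + m) * det (?b G H) = (s * r)\<^sup>2" .
  have "map_mat to_fract (?b T S) = four_block_mat (map_mat to_fract T) (0\<^sub>m (2 * n) (2 * m))
      (0\<^sub>m (2 * m) (2 * n)) (map_mat to_fract S)"
    using T S by (intro eq_matI) auto
  then have ss: "semisimple (?b T S)"
    unfolding semisimple_iff using diagonalizable_four_block[of "map_mat to_fract T" "2 * n" "map_mat to_fract S" "2 * m"] T S F(2) F'(2)
    by (simp add: semisimple_iff)
  have sy: "transpose_mat (?b G H) = ?b G H" unfolding block_diag_transpose[OF G H] sym symH ..
  have ev: "\<forall>i<2 * (n + m). 2 dvd ?b G H $$ (i, i)"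
    using G H even evenH by auto
  have sr: "s * r dvd 1" using s(1) r(1) by (simp add: is_unit_mult_iff)
  show ?thesis unfolding realizable_def
    by (intro exI[of _ "n + m"] exI[of _ "?b G H"] exI[of _ "?b T S"] exI[of _ "s * r"] conjI c G H T S sy ev iso sr det ss)
      (simp add: char_poly_four_block[OF T S] F(1) F'(1))
qed

lemma char_poly_uminus:
  fixes A :: "'a :: {idom,ring_char_0} mat"
  assumes A: "A \<in> carrier_mat n n"
  shows "char_poly (- A) = smult ((- 1) ^ n) (char_poly A \<circ>\<^sub>p [:0, - 1:])"
proof -
  have "poly (char_poly (- A)) x = poly (smult ((- 1) ^ n) (char_poly A \<circ>\<^sub>p [:0, - 1:])) x" for x
  proof -
    have "x \<cdot>\<^sub>m 1\<^sub>m n - (- A) = - ((- x) \<cdot>\<^sub>m 1\<^sub>m n - A)" using A by (intro eq_matI) auto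
    moreover have "(- x) \<cdot>\<^sub>m 1\<^sub>m n - A \<in> carrier_mat n n" using A by (auto intro: minus_carrier_mat)
    ultimately have "det (x \<cdot>\<^sub>m 1\<^sub>m n - (- A)) = (- 1) ^ n * det ((- x) \<cdot>\<^sub>m 1\<^sub>m n - A)"
      using det_neg by metis
    then show ?thesis
      using poly_char_poly[of "- A" n x] poly_char_poly[OF A, of "- x"] A by (simp add: poly_pcompose)
  qed
  then show ?thesis by (intro poly_eq_poly_eq_iff[THEN iffD1] ext)
qed

text \<open>Replacing T by -T exchanges the roles of 1 and -1.\<close>

lemma realizable_reflect_sign:
  assumes "realizable F"
  shows "realizable (F \<circ>\<^sub>p [:0, - 1:])"
proof -
  obtain n G T s where G: "G \<in> carrier_mat (2 * n) (2 * n)" and T: "T \<in> carrier_mat (2 * n) (2 * n)"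
    and sym: "transpose_mat G = G" and even: "\<forall>i<2 * n. 2 dvd G $$ (i, i)"
    and TGT: "transpose_mat T * G * T = G" and s: "s dvd 1" "(- 1) ^ n * det G = s\<^sup>2"
    and F: "char_poly T = F" "semisimple T"
    using assms unfolding realizable_def by blast
  have "transpose_mat (- T) = - transpose_mat T" by (intro eq_matI) auto
  then have "transpose_mat (- T) * G * (- T) = G" using TGT T G by simp
  moreover have "char_poly (- T) = F \<circ>\<^sub>p [:0, - 1:]" using char_poly_uminus[OF T] F(1) by simp
  moreover have "map_mat to_fract (- T) = - map_mat to_fract T" by (intro eq_matI) auto
  then have "semisimple (- T)" using F(2) diagonalizable_uminus by (simp add: semisimple_iff)
  ultimately show ?thesis unfolding realizable_def using G T sym even s
    by (intro exI[of _ n] exI[of _ G] exI[of _ "- T"]) auto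
qed

section \<open>From a quadratic space over the field to a lattice\<close>

lemma transpose_mult_entry:
  fixes A B :: "'a :: comm_ring_1 mat"
  assumes A: "A \<in> carrier_mat d d" and B: "B \<in> carrier_mat d d" and ij: "i < d" "j < d"
  shows "(transpose_mat B * (A * B)) $$ (i, j) = col B i \<bullet> (A *\<^sub>v col B j)"
proof -
  have "(transpose_mat B * (A * B)) $$ (i, j) = row (transpose_mat B) i \<bullet> col (A * B) j"
    using ij A B by (intro index_mult_mat(1)) auto
  then show ?thesis using ij B by (subst (asm) col_mult2[OF A B ij(2)]) auto
qed

text \<open>A lattice in a quadratic space over the field is given by a basis \<open>B\<close> inside a set \<open>M\<close>
  on which the form is integral and even; no stable basis matrix has to be computed, because
  the matrix of the isometry is recovered from the Gram matrix, which is invertible over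
  the 2-adic integers.\<close>

lemma realizable_by_basis:
  fixes G T B :: "q2 mat" and M :: "q2 vec set"
  assumes G: "G \<in> carrier_mat (2 * n) (2 * n)" and T: "T \<in> carrier_mat (2 * n) (2 * n)"
    and B: "B \<in> carrier_mat (2 * n) (2 * n)"
    and sym: "transpose_mat G = G" and iso: "transpose_mat T * G * T = G"
    and int: "\<And>x y. x \<in> M \<Longrightarrow> y \<in> M \<Longrightarrow> x \<bullet> (G *\<^sub>v y) \<in> O2"
    and even: "\<And>x. x \<in> M \<Longrightarrow> \<exists>z\<in>O2. x \<bullet> (G *\<^sub>v x) = 2 * z"
    and stable: "\<And>x. x \<in> M \<Longrightarrow> T *\<^sub>v x \<in> M"
    and basis: "\<And>j. j < 2 * n \<Longrightarrow> col B j \<in> M"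
    and det: "(- 1) ^ n * det G = r\<^sup>2" "det B * det B * det G = to_fract u" "u dvd 1"
    and cp: "char_poly T = map_poly to_fract F" and diag: "diagonalizable T"
  shows "realizable F"
proof -
  define d where "d = 2 * n"
  note c = G[folded d_def] T[folded d_def] B[folded d_def]
  note sq = square_mat_simps[where n = d] transpose_mult_square[where n = d] one_mult_square[where n = d]
  note [simp] = c
  have "det B \<noteq> 0" using det(2,3) by auto
  then have "det B dvd 1" by (simp add: dvd_field_iff)
  then obtain S where S[simp]: "S \<in> carrier_mat d d" and BS: "B * S = 1\<^sub>m d" "S * B = 1\<^sub>m d"
    by (rule inverse_mat_exists[OF c(3)])
  \<comment> \<open>Both matrices consist of values of the form on \<open>M\<close> and are
    therefore integral. In the basis B the isometry has the matrix \<open>?G\<close> inverse times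
    \<open>?K\<close>.\<close>
  let ?G = "transpose_mat B * (G * B)" and ?K = "transpose_mat B * (G * (T * B))"
  have Gc[simp]: "?G \<in> carrier_mat d d" and Kc[simp]: "?K \<in> carrier_mat d d" by (simp_all add: sq)
  have colB: "col B j \<in> M" if "j < d" for j using basis that by (simp add: d_def)
  have Gij: "?G $$ (i, j) = col B i \<bullet> (G *\<^sub>v col B j)" if "i < d" "j < d" for i j
    by (rule transpose_mult_entry[OF c(1,3) that])
  have "?G $$ (i, j) \<in> O2" if "i < d" "j < d" for i j
    unfolding Gij[OF that] using int colB that by blast
  then obtain G0 where G0: "G0 \<in> carrier_mat d d" "?G = map_mat to_fract G0"
    by (rule integral_mat_lift[OF Gc])
  have "?K $$ (i, j) \<in> O2" if "i < d" "j < d" for i j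
  proof -
    have "?K $$ (i, j) = (transpose_mat B * ((G * T) * B)) $$ (i, j)" by (simp add: sq)
    also have "\<dots> = col B i \<bullet> ((G * T) *\<^sub>v col B j)"
      by (rule transpose_mult_entry[OF _ c(3) that]) (simp add: sq)
    also have "(G * T) *\<^sub>v col B j = G *\<^sub>v (T *\<^sub>v col B j)"
      by (rule assoc_mult_mat_vec[OF c(1,2)]) (use that carrier_matD[OF c(3)] in \<open>simp add: carrier_vecI\<close>)
    finally show ?thesis using int colB stable that by simp
  qed
  then obtain K0 where K0: "K0 \<in> carrier_mat d d" "?K = map_mat to_fract K0"
    by (rule integral_mat_lift[OF Kc])
  have detG: "det ?G = to_fract u"
  proof -
    have "det ?G = det B * (det G * det B)"
      using det_mult[of "transpose_mat B" d "G * B"] det_mult[OF c(1,3)] det_transpose[OF c(3)]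
      by (simp add: sq)
    then show ?thesis using det(2) by (simp add: ac_simps)
  qed
  then have "to_fract (det G0) = to_fract u" unfolding G0(2) by (simp add: to_fract_hom.hom_det)
  then have dG0: "det G0 = u" by simp
  then obtain H0 where H0: "H0 \<in> carrier_mat d d" "G0 * H0 = 1\<^sub>m d" "H0 * G0 = 1\<^sub>m d"
    using inverse_mat_exists[OF G0(1)] det(3) by metis
  let ?H = "map_mat to_fract H0"
  have Hc[simp]: "?H \<in> carrier_mat d d" "H0 \<in> carrier_mat d d" using H0 by auto
  have HG: "?H * ?G = 1\<^sub>m d"
    using to_fract_hom.mat_hom_mult[OF H0(1) G0(1)] unfolding H0(3) G0(2) to_fract_hom.mat_hom_one by simp
  define T0 where "T0 = H0 * K0"
  have T0c: "T0 \<in> carrier_mat d d" unfolding T0_def by (rule mult_carrier_mat[OF H0(1) K0(1)])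
  let ?T = "S * (T * B)"
  have Tc[simp]: "?T \<in> carrier_mat d d" by (simp add: sq)
  have BSx: "B * (S * A) = A" if "A \<in> carrier_mat d d" for A
  proof -
    have "B * (S * A) = (B * S) * A" using that by (simp add: sq)
    then show ?thesis unfolding BS using that by (simp add: sq)
  qed
  have GT: "?G * ?T = ?K" by (simp add: sq BSx)
  have "map_mat to_fract T0 = ?H * ?K"
    unfolding T0_def K0(2) by (rule to_fract_hom.mat_hom_mult[OF H0(1) K0(1)])
  also have "\<dots> = (?H * ?G) * ?T"
    unfolding GT[symmetric] by (rule square_mat_simps(4)[where n = d, symmetric]) (simp_all del: map_carrier_mat)
  finally have T0: "map_mat to_fract T0 = ?T" unfolding HG by (simp add: sq)
  have StBt: "transpose_mat S * (transpose_mat B * A) = A" if "A \<in> carrier_mat d d" for A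
  proof -
    have "transpose_mat S * transpose_mat B = 1\<^sub>m d"
      using transpose_mult_square[OF c(3) S] unfolding BS by simp
    moreover have "transpose_mat S * (transpose_mat B * A) = (transpose_mat S * transpose_mat B) * A"
      using that by (simp add: sq)
    ultimately show ?thesis using that by (simp add: sq)
  qed
  have iso': "transpose_mat T * (G * (T * A)) = G * A" if "A \<in> carrier_mat d d" for A
  proof -
    have "transpose_mat T * (G * (T * A)) = (transpose_mat T * G * T) * A" using that by (simp add: sq)
    then show ?thesis unfolding iso .
  qed
  have "transpose_mat ?T * ?G * ?T = ?G"
    by (simp add: sq BSx StBt iso')
  then have "map_mat to_fract (transpose_mat T0 * G0 * T0) = map_mat to_fract G0"
    unfolding T0[symmetric] G0(2)
    using to_fract_hom.mat_hom_mult[of "transpose_mat T0 * G0" d d T0 d]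
      to_fract_hom.mat_hom_mult[of "transpose_mat T0" d d G0 d] T0c G0(1)
    by (simp add: map_mat_transpose)
  then have isoT0: "transpose_mat T0 * G0 * T0 = G0" by (rule to_fract_hom.mat_hom_inj)
  have "map_mat to_fract (transpose_mat G0) = map_mat to_fract G0"
    unfolding map_mat_transpose[symmetric] G0(2)[symmetric] using sym by (simp add: sq)
  then have symG0: "transpose_mat G0 = G0" by (rule to_fract_hom.mat_hom_inj)
  have evenG0: "2 dvd G0 $$ (i, i)" if i: "i < 2 * n" for i
  proof -
    have i': "i < d" using i by (simp add: d_def)
    obtain z where z: "z \<in> O2" "col B i \<bullet> (G *\<^sub>v col B i) = 2 * z" using even colB[OF i'] by blast
    then obtain z0 where "z = to_fract z0" by (elim O2_E)
    moreover have "to_fract (G0 $$ (i, i)) = 2 * z"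
      using Gij[OF i' i'] z(2) G0 i' by simp
    ultimately have "to_fract (G0 $$ (i, i)) = to_fract (2 * z0)" by simp
    then show ?thesis unfolding to_fract_eq_iff by simp
  qed
  have "to_fract ((- 1) ^ n * det G0) = (- 1) ^ n * (det B * det B * det G)"
    unfolding det(2) dG0 by simp
  also have "\<dots> = (r * det B)\<^sup>2"
    unfolding power_mult_distrib det(1)[symmetric] by (simp only: power2_eq_square ac_simps)
  finally have rB: "(r * det B)\<^sup>2 = to_fract ((- 1) ^ n * det G0)" ..
  \<comment> \<open>The determinant of G is a square only in the field. After the change of basis it
    is integral, and its root is integral as well.\<close>
  have "(r * det B)\<^sup>2 \<in> O2" unfolding rB by (rule to_fract_in_O2)
  then have "r * det B \<in> O2" by (rule O2_square_root)
  then obtain s where s: "r * det B = to_fract s" by (elim O2_E)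
  have "to_fract ((- 1) ^ n * det G0) = to_fract (s\<^sup>2)" using rB s by simp
  then have s2: "(- 1) ^ n * det G0 = s\<^sup>2" unfolding to_fract_eq_iff .
  have "s\<^sup>2 dvd 1" unfolding s2[symmetric] dG0 is_unit_mult_iff using det(3)
    by (cases "Parity.even n") auto
  then have su: "s dvd 1" by (simp add: power2_eq_square is_unit_mult_iff)
  have sim: "similar_mat (map_mat to_fract T0) T"
    by (rule similar_matI[of _ _ S B d]) (simp_all add: BS T0 sq)
  have "map_poly to_fract (char_poly T0) = map_poly to_fract F"
    using char_poly_similar[OF sim] cp to_fract_hom.char_poly_hom[OF T0c] by simp
  then have cpT0: "char_poly T0 = F" by simp
  have "semisimple T0" unfolding semisimple_iff by (rule diagonalizable_similar[OF sim diag])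
  then show ?thesis unfolding realizable_def
    using G0(1)[unfolded d_def] T0c[unfolded d_def] symG0 evenG0 isoT0 s2 su cpT0 by blast
qed

section \<open>Hyperbolic isometries\<close>

lemma companion_map: "map_mat to_fract (companion N p) = companion N (map_poly to_fract p)"
  by (rule to_fract_hom.companion_hom)

lemma char_poly_companion_z2:
  fixes H :: "z2 poly"
  assumes "lead_coeff H = 1" "degree H = N" "separable (map_poly to_fract H)"
  shows "char_poly (companion N H) = H" "semisimple (companion N H)"
proof -
  have "lead_coeff (map_poly to_fract H) = 1" "degree (map_poly to_fract H) = N" using assms by auto
  note c = separable_companion[OF assms(3) this]
  have "map_poly to_fract (char_poly (companion N H)) = map_poly to_fract H"
    using c(2) to_fract_hom.char_poly_hom[OF companion_carrier, of N H] by (simp add: companion_map)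
  then show "char_poly (companion N H) = H" by simp
  show "semisimple (companion N H)" unfolding semisimple_iff companion_map by (rule c(1))
qed

text \<open>For nonzero x one has C (x - W) = -x (1/x - C); take determinants.\<close>

lemma char_poly_inverse:
  fixes C W :: "'a :: field_char_0 mat"
  assumes C: "C \<in> carrier_mat N N" and W: "W \<in> carrier_mat N N" and CW: "C * W = 1\<^sub>m N"
  shows "smult (poly (char_poly C) 0) (char_poly W) = reflect_poly (char_poly C)"
proof -
  note sq = square_mat_simps[where n = N] one_mult_square[where n = N]
  let ?H = "char_poly C"
  have deg: "degree ?H = N" using degree_monic_char_poly[OF C] by simp
  have H0: "poly ?H 0 = (- 1) ^ N * det C"
  proof -
    have "0 \<cdot>\<^sub>m 1\<^sub>m N - C = - C" using C by (intro eq_matI) auto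
    then show ?thesis using poly_char_poly[OF C, of 0] det_neg[OF C] by simp
  qed
  have ev: "poly (smult (poly ?H 0) (char_poly W)) x = poly (reflect_poly ?H) x" if x: "x \<noteq> 0" for x
  proof -
    have xW: "x \<cdot>\<^sub>m 1\<^sub>m N - W \<in> carrier_mat N N" using W by (auto intro: minus_carrier_mat)
    have xC: "inverse x \<cdot>\<^sub>m 1\<^sub>m N - C \<in> carrier_mat N N" using C by (auto intro: minus_carrier_mat)
    have "C * (x \<cdot>\<^sub>m 1\<^sub>m N - W) = C * (x \<cdot>\<^sub>m 1\<^sub>m N) - C * W"
      using C W by (simp add: sq)
    also have "\<dots> = x \<cdot>\<^sub>m C - 1\<^sub>m N"
      unfolding CW using mult_smult_distrib[OF C one_carrier_mat, of x] C by simp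
    also have "\<dots> = (- x) \<cdot>\<^sub>m (inverse x \<cdot>\<^sub>m 1\<^sub>m N - C)"
      using C x by (intro eq_matI) (auto simp: algebra_simps)
    finally have "det C * det (x \<cdot>\<^sub>m 1\<^sub>m N - W) = (- x) ^ N * det (inverse x \<cdot>\<^sub>m 1\<^sub>m N - C)"
      using det_mult[OF C xW] xC C by simp
    then have "det C * poly (char_poly W) x = (- x) ^ N * poly ?H (inverse x)"
      using poly_char_poly[OF C] poly_char_poly[OF W] by simp
    then have "(- 1) ^ N * (det C * poly (char_poly W) x) = (- 1) ^ N * ((- x) ^ N * poly ?H (inverse x))"
      by simp
    also have "\<dots> = x ^ N * poly ?H (inverse x)"
      by (simp add: mult.assoc[symmetric] power_mult_distrib[symmetric])
    finally show ?thesis by (simp add: H0 poly_reflect_poly_nz[OF x] deg mult.assoc)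
  qed
  have "[:0, 1:] * smult (poly ?H 0) (char_poly W) = [:0, 1:] * reflect_poly ?H"
  proof (intro poly_eq_poly_eq_iff[THEN iffD1] ext)
    fix x
    show "poly ([:0, 1:] * smult (poly ?H 0) (char_poly W)) x = poly ([:0, 1:] * reflect_poly ?H) x"
      using ev[of x] by (cases "x = 0") simp_all
  qed
  then show ?thesis by simp
qed

text \<open>A free module and its dual with the evaluation pairing. The companion matrix acts on the
  first and its inverse transpose on the second, which contributes the reciprocal polynomial. Both
  halves are isotropic, so the form is even.\<close>

lemma realizable_hyperbolic:
  fixes H :: "z2 poly"
  assumes monic: "lead_coeff H = 1" and sep: "separable (map_poly to_fract H)"
    and c: "c * poly H 0 = 1"
  shows "realizable (H * smult c (reflect_poly H))"
proof -
  define N where "N = degree H"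
  let ?C = "companion N H"
  note sq = square_mat_simps[where n = N] one_mult_square[where n = N] transpose_mult_square[where n = N]
  have cpC: "char_poly ?C = H" "semisimple ?C" using char_poly_companion_z2[OF monic _ sep] N_def by auto
  have "0 \<cdot>\<^sub>m 1\<^sub>m N - ?C = - ?C" by (intro eq_matI) auto
  then have "poly H 0 = (- 1) ^ N * det ?C"
    using poly_char_poly[OF companion_carrier, of N H 0] det_neg[OF companion_carrier, of N H] cpC(1) by simp
  then have "det ?C dvd 1" using c by (metis dvd_mult_unit_iff dvd_triv_right is_unit_mult_iff)
  then obtain W where W[simp]: "W \<in> carrier_mat N N" and CW: "?C * W = 1\<^sub>m N" "W * ?C = 1\<^sub>m N"
    by (rule inverse_mat_exists[OF companion_carrier])
  note [simp] = carrier_matD[OF W]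
  let ?C' = "map_mat to_fract ?C" and ?W' = "map_mat to_fract W"
  have CW': "?C' * ?W' = 1\<^sub>m N"
    using to_fract_hom.mat_hom_mult[OF companion_carrier W, of H] CW(1) to_fract_hom.mat_hom_one by metis
  have C'c: "?C' \<in> carrier_mat N N" "?W' \<in> carrier_mat N N" by simp_all
  have "smult (to_fract (poly H 0)) (map_poly to_fract (char_poly W)) = reflect_poly (map_poly to_fract H)"
    using char_poly_inverse[OF C'c CW'] to_fract_hom.char_poly_hom[OF companion_carrier, of N H]
      to_fract_hom.char_poly_hom[OF W] cpC(1) poly_map_to_fract[of H 0] by simp
  also have "reflect_poly (map_poly to_fract H) = map_poly to_fract (reflect_poly H)"
    by (intro poly_eqI) (auto simp: coeff_reflect_poly)
  finally have "map_poly to_fract (smult (poly H 0) (char_poly W)) = map_poly to_fract (reflect_poly H)" by simp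
  then have "smult (poly H 0) (char_poly W) = reflect_poly H" unfolding fract_poly_eq_iff .
  then have cpW: "char_poly W = smult c (reflect_poly H)"
    using c by (metis smult_1_left smult_smult)
  let ?T = "four_block_mat ?C (0\<^sub>m N N) (0\<^sub>m N N) (transpose_mat W)"
  let ?G = "four_block_mat (0\<^sub>m N N) (1\<^sub>m N) (1\<^sub>m N) (0\<^sub>m N N) :: z2 mat"
  have Tt: "transpose_mat ?T = four_block_mat (transpose_mat ?C) (0\<^sub>m N N) (0\<^sub>m N N) W"
    using block_diag_transpose[OF companion_carrier, of "transpose_mat W" N N H] by simp
  have CtWt: "transpose_mat ?C * transpose_mat W = 1\<^sub>m N"
    using transpose_mult_square[OF W companion_carrier, of H] CW(2) by simp
  have e1: "transpose_mat ?T * ?G = four_block_mat (0\<^sub>m N N) (transpose_mat ?C) W (0\<^sub>m N N)"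
    unfolding Tt
    by (subst mult_four_block_mat[where ?nr1.0 = N and ?n1.0 = N and ?n2.0 = N and ?nr2.0 = N and ?nc1.0 = N and ?nc2.0 = N])
      (auto intro!: cong_four_block_mat simp: sq)
  have e2: "\<dots> * ?T = ?G"
    by (subst mult_four_block_mat[where ?nr1.0 = N and ?n1.0 = N and ?n2.0 = N and ?nr2.0 = N and ?nc1.0 = N and ?nc2.0 = N])
      (auto intro!: cong_four_block_mat simp: sq CtWt CW)
  have iso: "transpose_mat ?T * ?G * ?T = ?G" unfolding e1 e2 ..
  have "det ?G = det (0\<^sub>m N N * 0\<^sub>m N N - 1\<^sub>m N * 1\<^sub>m N :: z2 mat)"
    by (rule det_four_block_mat) auto
  also have "(0\<^sub>m N N * 0\<^sub>m N N - 1\<^sub>m N * 1\<^sub>m N :: z2 mat) = - 1\<^sub>m N" by (intro eq_matI) auto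
  finally have "det ?G = (- 1) ^ N" using det_neg[OF one_carrier_mat, of N] by simp
  then have det: "(- 1) ^ N * det ?G = 1\<^sup>2" by (simp add: power_mult_distrib[symmetric])
  have "char_poly ?T = H * smult c (reflect_poly H)"
    using char_poly_four_block[OF companion_carrier, of "transpose_mat W" N N H] cpC(1) cpW char_poly_transpose_mat[OF W] by simp
  moreover have "semisimple ?T"
  proof -
    have "diagonalizable (transpose_mat ?W')"
      by (rule diagonalizable_inverse_transpose[OF C'c CW']) (use cpC(2) in \<open>simp only: semisimple_iff\<close>)
    then have "diagonalizable (four_block_mat ?C' (0\<^sub>m N N) (0\<^sub>m N N) (transpose_mat ?W'))"
      using cpC(2) by (intro diagonalizable_four_block) (auto simp: semisimple_iff)
    moreover have "map_mat to_fract ?T = four_block_mat ?C' (0\<^sub>m N N) (0\<^sub>m N N) (transpose_mat ?W')"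
      using W by (intro eq_matI) auto
    ultimately show ?thesis by (simp add: semisimple_iff)
  qed
  moreover have "?G \<in> carrier_mat (2 * N) (2 * N)" "?T \<in> carrier_mat (2 * N) (2 * N)"
    by (simp_all add: mult_2)
  moreover have "transpose_mat ?G = ?G" by (intro eq_matI) auto
  moreover have "\<forall>i<2 * N. 2 dvd ?G $$ (i, i)" by auto
  ultimately show ?thesis unfolding realizable_def using iso det
    by (intro exI[of _ N] exI[of _ ?G] exI[of _ ?T]) (auto intro: exI[of _ 1])
qed

section \<open>Shift-invariant forms on polynomials\<close>

definition vpoly :: "'a :: comm_ring_1 vec \<Rightarrow> 'a poly" where
  "vpoly x = (\<Sum>i<dim_vec x. monom (x $ i) i)"

lemma coeff_vpoly: "coeff (vpoly x) i = (if i < dim_vec x then x $ i else 0)"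
  by (simp add: vpoly_def coeff_sum)

lemma vpoly_vec_coeff:
  assumes "\<And>i. N \<le> i \<Longrightarrow> coeff r i = 0"
  shows "vpoly (vec N (coeff r)) = r"
  by (rule poly_eqI) (simp add: coeff_vpoly assms)

text \<open>Multiplication by X raises the degree to at most N, so subtracting one multiple of F
  completes the reduction modulo F.\<close>

lemma vpoly_companion:
  assumes x: "x \<in> carrier_vec N" and F: "lead_coeff F = 1" "degree F = N" "N > 0"
  shows "vpoly (companion N F *\<^sub>v x) = pCons 0 (vpoly x) - smult (x $ (N - 1)) F"
proof (rule poly_eqI)
  fix i
  have cx: "(companion N F *\<^sub>v x) $ i = (if i = 0 then 0 else x $ (i - 1)) - coeff F i * x $ (N - 1)" if i: "i < N"
  proof -
    have "(companion N F *\<^sub>v x) $ i = (\<Sum>j = 0..<N. companion N F $$ (i, j) * x $ j)"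
      using x i by (auto simp: scalar_prod_def intro!: sum.cong)
    also have "{0..<N} = insert (N - 1) {0..<N - 1}" using F(3) by auto
    also have "(\<Sum>j\<in>insert (N - 1) {0..<N - 1}. companion N F $$ (i, j) * x $ j)
        = companion N F $$ (i, N - 1) * x $ (N - 1) + (\<Sum>j = 0..<N - 1. companion N F $$ (i, j) * x $ j)"
      by simp
    also have "(\<Sum>j = 0..<N - 1. companion N F $$ (i, j) * x $ j)
        = (\<Sum>j = 0..<N - 1. if i = Suc j then x $ j else 0)"
      using i by (intro sum.cong) (auto simp: companion_def)
    also have "\<dots> = (if i = 0 then 0 else x $ (i - 1))"
    proof (cases i)
      case (Suc k)
      then have "(\<Sum>j = 0..<N - 1. if i = Suc j then x $ j else 0) = (\<Sum>j = 0..<N - 1. if j = k then x $ k else 0)"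
        by (intro sum.cong) auto
      then show ?thesis using Suc i by auto
    qed simp
    also have "companion N F $$ (i, N - 1) = - coeff F i" using i by (auto simp: companion_def)
    finally show ?thesis by simp
  qed
  show "coeff (vpoly (companion N F *\<^sub>v x)) i = coeff (pCons 0 (vpoly x) - smult (x $ (N - 1)) F) i"
  proof (cases "i < N")
    case True
    have "coeff (vpoly (companion N F *\<^sub>v x)) i = (companion N F *\<^sub>v x) $ i"
      using True by (simp add: coeff_vpoly del: index_mult_mat_vec)
    then show ?thesis unfolding cx[OF True] using x True
      by (auto simp: coeff_vpoly coeff_pCons mult.commute split: nat.split)
  next
    case False
    then consider "i = N" | "i > N" by linarith
    then show ?thesis
    proof cases
      case 1
      then show ?thesis using x F by (auto simp: coeff_vpoly coeff_pCons split: nat.split)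
    next
      case 2
      then show ?thesis using x F by (auto simp: coeff_vpoly coeff_pCons coeff_eq_0 split: nat.split)
    qed
  qed
qed

lemma monom_vec: "i < N \<Longrightarrow> vpoly (unit_vec N i) = monom 1 i"
  by (rule poly_eqI) (auto simp: coeff_vpoly unit_vec_def)

definition gram_poly :: "nat \<Rightarrow> ('a poly \<Rightarrow> 'a poly \<Rightarrow> 'a) \<Rightarrow> 'a :: comm_ring_1 mat" where
  "gram_poly N b = mat N N (\<lambda>(i, j). b (monom 1 i) (monom 1 j))"

lemma gram_poly_carrier [simp]: "gram_poly N b \<in> carrier_mat N N"
  and gram_poly_dim [simp]: "dim_row (gram_poly N b) = N" "dim_col (gram_poly N b) = N"
  by (simp_all add: gram_poly_def)

text \<open>Multiplication by X is an isometry of the form on all polynomials. Finite rank comes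
  from a monic polynomial in the radical, which stands in for a form on a quotient ring.\<close>

locale poly_form =
  fixes b :: "'a :: field poly \<Rightarrow> 'a poly \<Rightarrow> 'a"
  assumes b_add: "b (p + q) r = b p r + b q r"
    and b_smult: "b (smult c p) r = c * b p r"
    and b_sym: "b p q = b q p"
    and b_shift: "b (pCons 0 p) (pCons 0 q) = b p q"
begin

lemma b_add_right: "b r (p + q) = b r p + b r q"
  by (metis b_add b_sym)

lemma b_smult_right: "b r (smult c p) = c * b r p"
  by (metis b_smult b_sym)

lemma b_0 [simp]: "b 0 r = 0" "b r 0 = 0"
  using b_smult[of 0 0 r] b_smult_right[of r 0 0] by simp_all

lemma b_uminus: "b (- p) r = - b p r" "b r (- p) = - b r p"
  using b_smult[of "- 1" p r] b_smult_right[of r "- 1" p] by simp_all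

lemma b_diff: "b (p - q) r = b p r - b q r" "b r (p - q) = b r p - b r q"
  unfolding diff_conv_add_uminus b_add b_add_right b_uminus by simp_all

lemma b_sum: "b (\<Sum>i\<in>A. f i) r = (\<Sum>i\<in>A. b (f i) r)" "b r (\<Sum>i\<in>A. f i) = (\<Sum>i\<in>A. b r (f i))"
  by (induction A rule: infinite_finite_induct) (simp_all add: b_add b_add_right)

lemma b_vpoly:
  assumes x: "x \<in> carrier_vec N" and y: "y \<in> carrier_vec N"
  shows "b (vpoly x) (vpoly y) = x \<bullet> (gram_poly N b *\<^sub>v y)"
proof -
  have e: "monom (a :: 'a) i = smult a (monom 1 i)" for a i by (simp add: smult_monom)
  have "b (vpoly x) (vpoly y) = (\<Sum>i<N. \<Sum>j<N. x $ i * (y $ j * b (monom 1 i) (monom 1 j)))"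
    unfolding vpoly_def e[of "x $ _"] e[of "y $ _"] carrier_vecD[OF x] carrier_vecD[OF y]
    by (simp only: b_sum(1) b_smult) (simp only: b_sum(2) b_smult_right sum_distrib_left)
  also have "\<dots> = x \<bullet> (gram_poly N b *\<^sub>v y)"
    using x y by (auto simp: scalar_prod_def gram_poly_def sum_distrib_left atLeast0LessThan mult.commute
        intro!: sum.cong)
  finally show ?thesis .
qed

lemma gram_poly_sym: "transpose_mat (gram_poly N b) = gram_poly N b"
  by (rule eq_matI) (auto simp: gram_poly_def b_sym)

text \<open>As F lies in the radical, reduction modulo F does not change any value of the
  form.\<close>

lemma companion_isometry:
  assumes F: "lead_coeff F = 1" "degree F = N" "N > 0" and rad: "\<And>s. b F s = 0"
  shows "transpose_mat (companion N F) * gram_poly N b * companion N F = gram_poly N b"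
proof -
  let ?C = "companion N F" and ?G = "gram_poly N b"
  have C: "?C \<in> carrier_mat N N" by simp
  have "transpose_mat ?C * ?G * ?C = transpose_mat ?C * (?G * ?C)"
    by (rule assoc_mult_mat[of _ N N _ N _ N]) simp_all
  also have "\<dots> = ?G"
  proof (rule eq_matI)
    fix i j assume "i < dim_row ?G" "j < dim_col ?G"
    then have ij: "i < N" "j < N" by auto
    have colC: "col ?C k = ?C *\<^sub>v unit_vec N k" if "k < N" for k
      using that by (intro eq_vecI) auto
    have left: "b (vpoly (?C *\<^sub>v unit_vec N k)) s = b (pCons 0 (monom 1 k)) s"
      "b s (vpoly (?C *\<^sub>v unit_vec N k)) = b s (pCons 0 (monom 1 k))" if "k < N" for k s
    proof -
      have "b s F = 0" using rad b_sym by metis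
      then show "b (vpoly (?C *\<^sub>v unit_vec N k)) s = b (pCons 0 (monom 1 k)) s"
        "b s (vpoly (?C *\<^sub>v unit_vec N k)) = b s (pCons 0 (monom 1 k))"
        using that by (simp_all add: vpoly_companion[OF _ F] monom_vec b_diff b_smult b_smult_right rad)
    qed
    have "(transpose_mat ?C * (?G * ?C)) $$ (i, j) = col ?C i \<bullet> (?G *\<^sub>v col ?C j)"
      by (rule transpose_mult_entry[OF _ C ij]) simp
    also have "\<dots> = b (vpoly (col ?C i)) (vpoly (col ?C j))"
      by (rule b_vpoly[symmetric]) (use ij in \<open>auto simp: carrier_vecI\<close>)
    also have "\<dots> = b (monom 1 i) (monom 1 j)"
      unfolding colC[OF ij(1)] colC[OF ij(2)] left(1)[OF ij(1)] left(2)[OF ij(2)] by (rule b_shift)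
    finally show "(transpose_mat ?C * (?G * ?C)) $$ (i, j) = ?G $$ (i, j)"
      using ij by (simp add: gram_poly_def)
  qed auto
  finally show ?thesis .
qed

end

section \<open>Projecting away an eigenvector\<close>

lemma det_four_block_schur_right:
  fixes A :: "'a :: idom mat"
  assumes c: "A \<in> carrier_mat n n" "B \<in> carrier_mat n m" "C \<in> carrier_mat m n" "D \<in> carrier_mat m m"
    and D': "D' \<in> carrier_mat m m" "D' * D = 1\<^sub>m m"
  shows "det (four_block_mat A B C D) = det D * det (A - B * D' * C)"
proof -
  let ?L = "four_block_mat (1\<^sub>m n) (B * D') (0\<^sub>m m n) (1\<^sub>m m)"
  let ?R = "four_block_mat (A - B * D' * C) (0\<^sub>m n m) C D"
  have BD: "B * D' \<in> carrier_mat n m" using c D' by auto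
  have S: "A - B * D' * C \<in> carrier_mat n n" using c D' by auto
  have e1: "1\<^sub>m n * (A - B * D' * C) + B * D' * C = A" using c S BD by (intro eq_matI) auto
  have e2: "1\<^sub>m n * 0\<^sub>m n m + B * D' * D = B" using c D'
    by (simp add: assoc_mult_mat[of B n m D' m D m])
  have e3: "0\<^sub>m m n * (A - B * D' * C) + 1\<^sub>m m * C = C" using c S by auto
  have e4: "0\<^sub>m m n * 0\<^sub>m n m + 1\<^sub>m m * D = D" using c by auto
  have "?L * ?R = four_block_mat A B C D"
    by (subst mult_four_block_mat[OF one_carrier_mat BD zero_carrier_mat one_carrier_mat S zero_carrier_mat c(3,4)])
       (simp only: e1 e2 e3 e4)
  then have "det (four_block_mat A B C D) = det ?L * det ?R"
    using c BD S by (metis det_mult four_block_carrier_mat one_carrier_mat)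
  also have "det ?L = 1"
    by (subst det_four_block_mat_lower_left_zero[OF _ BD refl]) auto
  also have "det ?R = det (A - B * D' * C) * det D"
    by (rule det_four_block_mat_upper_right_zero[OF S refl c(3,4)])
  finally show ?thesis by simp
qed

text \<open>Here E is an eigenvector for \<open>\<sigma>\<close>, which is its own inverse. The
  shift multiplies pairings with E by \<open>\<sigma>\<close>, so products of two of them are
  invariant. For c = \<open>b E E\<close> this is the form of the orthogonal projections.\<close>

lemma (in poly_form) projection_form:
  assumes "\<And>s. b (pCons 0 E) s = \<sigma> * b E s" "\<sigma> * \<sigma> = 1"
  shows "poly_form (\<lambda>r s. b r s - b r E * b s E / c)"
proof
  have sh: "b (pCons 0 p) E = \<sigma> * b p E" for p
  proof -
    have "b p E = b (pCons 0 E) (pCons 0 p)" by (metis b_shift b_sym)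
    also have "\<dots> = \<sigma> * b (pCons 0 p) E" unfolding assms(1) by (metis b_sym)
    finally have "\<sigma> * b p E = (\<sigma> * \<sigma>) * b (pCons 0 p) E" by simp
    then show ?thesis using assms(2) by simp
  qed
  fix p q r k
  show "b (p + q) r - b (p + q) E * b r E / c = b p r - b p E * b r E / c + (b q r - b q E * b r E / c)"
    by (simp add: b_add algebra_simps add_divide_distrib)
  show "b (smult k p) r - b (smult k p) E * b r E / c = k * (b p r - b p E * b r E / c)"
    by (simp add: b_smult algebra_simps)
  show "b p q - b p E * b q E / c = b q p - b q E * b p E / c"
    by (simp add: b_sym mult.commute)
  have "b (pCons 0 p) E * b (pCons 0 q) E = (\<sigma> * \<sigma>) * (b p E * b q E)"
    unfolding sh by (simp only: ac_simps)
  then show "b (pCons 0 p) (pCons 0 q) - b (pCons 0 p) E * b (pCons 0 q) E / c = b p q - b p E * b q E / c"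
    using assms(2) by (simp add: b_shift)
qed

text \<open>Exchanging the last monomial for the monic E is a base change of determinant 1. The
  Schur complement of the corner entry c is the projected form.\<close>

lemma (in poly_form) det_projection:
  assumes E: "lead_coeff E = 1" "degree E = N" and c: "b E E = c" "c \<noteq> 0"
  shows "det (gram_poly (Suc N) b) = c * det (gram_poly N (\<lambda>r s. b r s - b r E * b s E / c))"
proof -
  let ?G = "gram_poly (Suc N) b"
  define Q where "Q = mat (Suc N) (Suc N) (\<lambda>(i, j). if j < N then (if i = j then 1 else 0) else coeff E i)"
  have Q: "Q \<in> carrier_mat (Suc N) (Suc N)" by (simp add: Q_def)
  have detQ: "det Q = 1"
  proof -
    have "coeff E N = 1" using E by simp
    then have "diag_mat Q = map (\<lambda>_. 1) [0..<Suc N]"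
      by (simp add: diag_mat_def Q_def less_Suc_eq)
    moreover have "upper_triangular Q" by (auto simp: upper_triangular_def Q_def)
    ultimately show ?thesis using det_upper_triangular[OF _ Q] by (simp add: map_replicate_const)
  qed
  have vcol: "vpoly (col Q j) = (if j < N then monom 1 j else E)" if j: "j < Suc N" for j
  proof (cases "j < N")
    case True
    then have "col Q j = unit_vec (Suc N) j" by (intro eq_vecI) (auto simp: Q_def unit_vec_def)
    then show ?thesis using True monom_vec[of j "Suc N"] by simp
  next
    case False
    then have "col Q j = vec (Suc N) (coeff E)" using j by (intro eq_vecI) (auto simp: Q_def)
    then show ?thesis using False E vpoly_vec_coeff[of "Suc N" E] by (simp add: coeff_eq_0)
  qed
  let ?w = "mat N 1 (\<lambda>(i, _). b (monom 1 i) E)"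
  let ?w' = "mat 1 N (\<lambda>(_, i). b (monom 1 i) E)"
  let ?c = "mat 1 1 (\<lambda>_. c)" and ?c' = "mat 1 1 (\<lambda>_. inverse c)"
  have blocks: "transpose_mat Q * (?G * Q) = four_block_mat (gram_poly N b) ?w ?w' ?c"
  proof (rule eq_matI)
    fix i j assume "i < dim_row (four_block_mat (gram_poly N b) ?w ?w' ?c)"
      "j < dim_col (four_block_mat (gram_poly N b) ?w ?w' ?c)"
    then have ij: "i < Suc N" "j < Suc N" by auto
    have "(transpose_mat Q * (?G * Q)) $$ (i, j) = col Q i \<bullet> (?G *\<^sub>v col Q j)"
      by (rule transpose_mult_entry[OF _ Q ij]) simp
    also have "\<dots> = b (vpoly (col Q i)) (vpoly (col Q j))"
      by (rule b_vpoly[symmetric]) (use ij Q in \<open>auto simp: carrier_vecI\<close>)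
    finally show "(transpose_mat Q * (?G * Q)) $$ (i, j) = four_block_mat (gram_poly N b) ?w ?w' ?c $$ (i, j)"
      using ij c(1) b_sym by (auto simp: vcol gram_poly_def)
  qed (auto simp: Q_def)
  have GQ: "?G * Q \<in> carrier_mat (Suc N) (Suc N)" by (rule mult_carrier_mat[OF gram_poly_carrier Q])
  have Qt: "transpose_mat Q \<in> carrier_mat (Suc N) (Suc N)" using Q by simp
  have "det ?G = det (transpose_mat Q * (?G * Q))"
    unfolding det_mult[OF Qt GQ] det_mult[OF gram_poly_carrier Q] det_transpose[OF Q] detQ by simp
  also have "\<dots> = det ?c * det (gram_poly N b - ?w * ?c' * ?w')"
    unfolding blocks
    by (rule det_four_block_schur_right) (use c in \<open>auto simp: scalar_prod_def intro!: eq_matI\<close>)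
  also have "det ?c = c" by (subst det_single) auto
  also have "gram_poly N b - ?w * ?c' * ?w' = gram_poly N (\<lambda>r s. b r s - b r E * b s E / c)"
    by (rule eq_matI) (auto simp: gram_poly_def scalar_prod_def divide_inverse ac_simps)
  finally show ?thesis .
qed

section \<open>The unimodular Toeplitz form\<close>

text \<open>The linear functional that takes the value \<open>f i\<close> at the i-th power of
  X.\<close>

definition lin :: "(nat \<Rightarrow> 'a :: comm_ring_1) \<Rightarrow> 'a poly \<Rightarrow> 'a" where
  "lin f p = (\<Sum>i\<le>degree p. coeff p i * f i)"

lemma lin_bound: "degree p \<le> N \<Longrightarrow> lin f p = (\<Sum>i\<le>N. coeff p i * f i)"
  unfolding lin_def by (rule sum.mono_neutral_left) (auto simp: coeff_eq_0)

lemma lin_add: "lin f (p + q) = lin f p + lin f q"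
proof -
  let ?N = "max (degree p) (degree q)"
  have "degree (p + q) \<le> ?N" by (rule degree_add_le_max)
  then show ?thesis
    using lin_bound[of p ?N f] lin_bound[of q ?N f] lin_bound[of "p + q" ?N f]
    by (simp add: sum.distrib algebra_simps)
qed

lemma lin_smult: "lin f (smult c p) = c * lin f p"
proof -
  have "lin f (smult c p) = (\<Sum>i\<le>degree p. coeff (smult c p) i * f i)"
    by (rule lin_bound) (rule degree_smult_le)
  then show ?thesis by (simp add: lin_def sum_distrib_left mult.assoc)
qed

lemma lin_pCons: "lin f (pCons a p) = a * f 0 + lin (\<lambda>i. f (Suc i)) p"
proof -
  have "lin f (pCons a p) = (\<Sum>i\<le>Suc (degree p). coeff (pCons a p) i * f i)"
    by (rule lin_bound) (rule degree_pCons_le)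
  also have "\<dots> = a * f 0 + (\<Sum>i\<le>degree p. coeff p i * f (Suc i))"
    by (subst sum.atMost_Suc_shift) simp
  finally show ?thesis by (simp add: lin_def)
qed

lemma lin_0 [simp]: "lin f 0 = 0" "lin (\<lambda>_. 0) p = 0"
  by (simp_all add: lin_def)

lemma lin_swap: "lin (\<lambda>i. lin (\<lambda>j. h i j) q) p = lin (\<lambda>j. lin (\<lambda>i. h i j) p) q"
  unfolding lin_def sum_distrib_left
  by (subst sum.swap) (intro sum.cong refl, simp add: mult.left_commute)

lemma lin_monom: "lin f (monom a k) = a * f k"
  by (simp add: lin_bound[OF degree_monom_le] if_distrib[of "\<lambda>x. x * _"] cong: if_cong)

text \<open>Coefficients of the power series 1 / R for R with constant term 1.\<close>

function series_inverse :: "'a :: comm_ring_1 poly \<Rightarrow> nat \<Rightarrow> 'a" where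
  "series_inverse R m = (if m = 0 then 1 else - (\<Sum>t\<in>{1..m}. coeff R t * series_inverse R (m - t)))"
  by auto
termination by (relation "measure snd") auto

declare series_inverse.simps [simp del]

lemma series_inverse_rec:
  assumes "coeff R 0 = 1"
  shows "(\<Sum>t\<le>m. coeff R t * series_inverse R (m - t)) = (if m = 0 then 1 else 0)"
proof -
  have "{..m} = insert 0 {1..m}" by auto
  then have "(\<Sum>t\<le>m. coeff R t * series_inverse R (m - t))
      = series_inverse R m + (\<Sum>t\<in>{1..m}. coeff R t * series_inverse R (m - t))"
    using assms by simp
  then show ?thesis by (subst (asm) series_inverse.simps) auto
qed

locale toeplitz =
  fixes F :: "z2 poly" and n :: nat
  assumes monic: "lead_coeff F = 1" and deg: "degree F = 2 * n" and pos: "n > 0"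
    and anti: "reflect_poly F = - F"
begin

definition g :: "nat \<Rightarrow> z2" where
  "g = series_inverse (reflect_poly F)"

text \<open>The symmetric sequence with \<open>c k = 0\<close> for \<open>\<bar>k\<bar> < n\<close>, \<open>c n = 1\<close>, and satisfying the
  linear recurrence with characteristic polynomial \<open>F\<close>.\<close>

definition c :: "int \<Rightarrow> z2" where
  "c k = (if \<bar>k\<bar> < int n then 0 else g (nat (\<bar>k\<bar> - int n)))"

lemma coeff_F: "i \<le> 2 * n \<Longrightarrow> coeff F (2 * n - i) = - coeff F i"
  using arg_cong[OF anti, of "\<lambda>p. coeff p i"] by (simp add: coeff_reflect_poly deg)

lemma F_top: "coeff F (2 * n) = 1"
  using monic deg by simp

lemma F_bot: "coeff F 0 = - 1"
  using coeff_F[of "2 * n"] F_top by simp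

lemma g_0: "g 0 = 1"
  by (simp add: g_def series_inverse.simps)

lemma g_rec: "(\<Sum>t\<le>m. coeff (reflect_poly F) t * g (m - t)) = (if m = 0 then 1 else 0)"
  unfolding g_def using monic by (intro series_inverse_rec) (simp add: coeff_reflect_poly)

lemma c_sym: "c (- k) = c k" by (simp add: c_def)

lemma c_mid: "\<bar>k\<bar> < int n \<Longrightarrow> c k = 0" by (simp add: c_def)

lemma c_n: "c (int n) = 1" "c (- int n) = 1" using pos by (simp_all add: c_def g_0)

text \<open>For j <= n the arguments i - j are at least -n. There c agrees with the one-sided
  sequence \<open>h\<close>, the shifted coefficients of the power series inverse of the reversed F,
  except for c(-n) = 1, which is met only for j = n and i = 0. Its contribution F(0) = -1 cancels
  the constant term 1 of the power series identity.\<close>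

lemma recurrence_low:
  assumes j: "j \<le> int n"
  shows "(\<Sum>i\<le>2 * n. coeff F i * c (int i - j)) = 0"
proof -
  define h where "h k = (if k \<ge> int n then g (nat (k - int n)) else 0)" for k
  define m where "m = nat (int n - j)"
  have ch: "c (int i - j) = h (int i - j) + (if i = 0 \<and> m = 0 then 1 else 0)" for i
  proof (cases "i = 0 \<and> m = 0")
    case True
    then have "j = int n" using j by (simp add: m_def)
    then show ?thesis using True pos c_n by (simp add: h_def)
  next
    case False
    then have "int i - j > - int n" using j by (auto simp: m_def)
    then show ?thesis using False by (auto simp: h_def c_def)
  qed
  have hR: "(\<Sum>i\<le>2 * n. coeff F i * h (int i - j)) = (if m = 0 then 1 else 0)"
  proof -
    let ?R = "reflect_poly F"
    have "(\<Sum>i\<le>2 * n. coeff F i * h (int i - j)) = (\<Sum>t\<le>2 * n. coeff F (2 * n - t) * h (int (2 * n - t) - j))"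
      by (rule sum.reindex_bij_witness[of _ "\<lambda>t. 2 * n - t" "\<lambda>t. 2 * n - t"]) auto
    also have "\<dots> = (\<Sum>t\<le>2 * n. if t \<le> m then coeff ?R t * g (m - t) else 0)"
    proof (rule sum.cong)
      fix t assume t: "t \<in> {..2 * n}"
      have R: "coeff ?R t = coeff F (2 * n - t)" using t by (simp add: coeff_reflect_poly deg)
      have "h (int (2 * n - t) - j) = (if t \<le> m then g (m - t) else 0)"
      proof (cases "t \<le> m")
        case True
        then have "int n \<le> int (2 * n - t) - j" using t j by (auto simp: m_def)
        moreover have "nat (int (2 * n - t) - j - int n) = m - t" using t j True by (auto simp: m_def nat_diff_distrib)
        ultimately show ?thesis using True by (simp add: h_def)
      next
        case False
        then have "\<not> int n \<le> int (2 * n - t) - j" using t j by (auto simp: m_def)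
        then show ?thesis using False by (simp add: h_def)
      qed
      then show "coeff F (2 * n - t) * h (int (2 * n - t) - j) = (if t \<le> m then coeff ?R t * g (m - t) else 0)"
        by (simp add: R)
    qed simp
    also have "\<dots> = (\<Sum>t\<in>{..2 * n} \<inter> {..m}. coeff ?R t * g (m - t))"
      by (simp add: sum.inter_restrict del: Int_atMost)
    also have "\<dots> = (\<Sum>t\<le>m. coeff ?R t * g (m - t))"
      by (rule sum.mono_neutral_left) (auto simp: coeff_reflect_poly deg)
    also have "\<dots> = (if m = 0 then 1 else 0)" by (rule g_rec)
    finally show ?thesis .
  qed
  have "(\<Sum>i\<le>2 * n. coeff F i * c (int i - j))
      = (\<Sum>i\<le>2 * n. coeff F i * h (int i - j)) + (\<Sum>i\<le>2 * n. if i = 0 then (if m = 0 then coeff F 0 else 0) else 0)"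
    unfolding sum.distrib[symmetric] by (intro sum.cong) (auto simp: ch distrib_left)
  then show ?thesis unfolding hR using F_bot by simp
qed

text \<open>For j > n, reversing the order of summation leads back to \<open>recurrence_low\<close>
  by the symmetry of c and the antisymmetry of F.\<close>

lemma recurrence: "(\<Sum>i\<le>2 * n. coeff F i * c (int i - j)) = 0"
proof (cases "j \<le> int n")
  case False
  have "(\<Sum>i\<le>2 * n. coeff F i * c (int i - j)) = (\<Sum>t\<le>2 * n. coeff F (2 * n - t) * c (int (2 * n - t) - j))"
    by (rule sum.reindex_bij_witness[of _ "\<lambda>t. 2 * n - t" "\<lambda>t. 2 * n - t"]) auto
  also have "\<dots> = (\<Sum>t\<le>2 * n. - (coeff F t * c (int t - (2 * int n - j))))"
  proof (rule sum.cong)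
    fix t assume t: "t \<in> {..2 * n}"
    have "c (int (2 * n - t) - j) = c (- (int t - (2 * int n - j)))" using t by (intro arg_cong[of _ _ c]) auto
    then show "coeff F (2 * n - t) * c (int (2 * n - t) - j) = - (coeff F t * c (int t - (2 * int n - j)))"
      using coeff_F[of t] t by (simp add: c_sym del: minus_diff_eq)
  qed simp
  also have "\<dots> = 0" using recurrence_low[of "2 * int n - j"] False by (simp add: sum_negf)
  finally show ?thesis .
qed (rule recurrence_low)

definition \<beta> :: "q2 poly \<Rightarrow> q2 poly \<Rightarrow> q2" where
  "\<beta> r s = lin (\<lambda>i. lin (\<lambda>j. to_fract (c (int i - int j))) s) r"

sublocale poly_form \<beta>
proof
  fix p q r :: "q2 poly" and k :: q2
  show "\<beta> (p + q) r = \<beta> p r + \<beta> q r" by (simp add: \<beta>_def lin_add)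
  show "\<beta> (smult k p) r = k * \<beta> p r" by (simp add: \<beta>_def lin_smult)
  have cc: "c (int i - int j) = c (int j - int i)" for i j using c_sym[of "int i - int j"] by simp
  show "\<beta> p q = \<beta> q p" unfolding \<beta>_def by (subst lin_swap) (simp add: cc[symmetric] lin_def cc)
  show "\<beta> (pCons 0 p) (pCons 0 q) = \<beta> p q" by (simp add: \<beta>_def lin_pCons)
qed

lemma \<beta>_monom: "\<beta> (monom 1 i) (monom 1 j) = to_fract (c (int i - int j))"
  by (simp add: \<beta>_def lin_monom)

abbreviation FQ :: "q2 poly" where "FQ \<equiv> map_poly to_fract F"

lemma FQ: "lead_coeff FQ = 1" "degree FQ = 2 * n"
  using monic deg by simp_all

lemma radical: "\<beta> FQ s = 0"
proof -
  have "lin (\<lambda>i. to_fract (c (int i - int j))) FQ = 0" for j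
  proof -
    have "lin (\<lambda>i. to_fract (c (int i - int j))) FQ = to_fract (\<Sum>i\<le>2 * n. coeff F i * c (int i - int j))"
      by (simp add: lin_def deg del: to_fract_sum) (simp add: to_fract_sum)
    then show ?thesis by (simp add: recurrence)
  qed
  then show ?thesis unfolding \<beta>_def by (subst lin_swap) simp
qed

lemma \<beta>_integral:
  assumes "\<And>i. coeff r i \<in> O2" "\<And>i. coeff s i \<in> O2"
  shows "\<beta> r s \<in> O2"
  unfolding \<beta>_def lin_def using assms by (intro O2_sum O2_mult) auto

text \<open>Constants are isotropic since c(0) = 0, cross terms are doubled, and the shift reduces
  the rest to a lower degree.\<close>

lemma \<beta>_even:
  assumes "\<And>i. coeff r i \<in> O2"
  shows "\<exists>z\<in>O2. \<beta> r r = 2 * z"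
  using assms
proof (induction r)
  case (pCons a r)
  have r: "coeff r i \<in> O2" for i using pCons.prems[of "Suc i"] by simp
  have a: "a \<in> O2" using pCons.prems[of 0] by simp
  obtain z where z: "z \<in> O2" "\<beta> r r = 2 * z" using pCons.IH r by blast
  have e: "pCons a r = [:a:] + pCons 0 r" by simp
  have a0: "\<beta> [:a:] [:a:] = 0" by (simp add: \<beta>_def lin_pCons c_mid pos)
  have "\<beta> (pCons a r) (pCons a r) = \<beta> [:a:] [:a:] + 2 * \<beta> [:a:] (pCons 0 r) + \<beta> (pCons 0 r) (pCons 0 r)"
    by (subst (1 2) e) (simp only: b_add b_add_right b_sym[of "pCons 0 r" "[:a:]"] mult_2 add.assoc)
  also have "\<dots> = 2 * (\<beta> [:a:] (pCons 0 r) + z)" by (simp add: a0 b_shift z(2) algebra_simps)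
  finally have "\<beta> (pCons a r) (pCons a r) = 2 * (\<beta> [:a:] (pCons 0 r) + z)" .
  moreover have "\<beta> [:a:] (pCons 0 r) \<in> O2"
    using a r by (intro \<beta>_integral) (auto simp: coeff_pCons split: nat.split)
  ultimately show ?case using z(1) by blast
qed (auto intro: bexI[of _ 0])

text \<open>Indices in the same half differ by less than n, so both diagonal blocks vanish. The
  other two blocks are triangular with diagonal entries c(n) or c(-n), which are 1.\<close>

lemma det_gram: "det (gram_poly (2 * n) \<beta>) = (- 1) ^ n"
proof -
  let ?U = "mat n n (\<lambda>(i, j). to_fract (c (int i - int (j + n))))"
  let ?L = "mat n n (\<lambda>(i, j). to_fract (c (int (i + n) - int j)))"
  have "gram_poly (2 * n) \<beta> = four_block_mat (0\<^sub>m n n) ?U ?L (0\<^sub>m n n)"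
    by (rule eq_matI) (auto simp: gram_poly_def \<beta>_monom intro!: c_mid)
  then have "det (gram_poly (2 * n) \<beta>) = det (0\<^sub>m n n * 0\<^sub>m n n - ?U * ?L)"
    using det_four_block_mat[of "0\<^sub>m n n" n ?U ?L "0\<^sub>m n n"] by simp
  also have "0\<^sub>m n n * 0\<^sub>m n n - ?U * ?L = - (?U * ?L)" by (rule eq_matI) auto
  also have "det (- (?U * ?L)) = (- 1) ^ n * (det ?U * det ?L)"
  proof -
    have U: "?U \<in> carrier_mat n n" and L: "?L \<in> carrier_mat n n" by simp_all
    show ?thesis unfolding det_neg[OF mult_carrier_mat[OF U L]] det_mult[OF U L] ..
  qed
  also have "det ?U = 1"
  proof -
    have "upper_triangular ?U" by (auto simp: upper_triangular_def intro!: c_mid)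
    moreover have "diag_mat ?U = map (\<lambda>_. 1) [0..<n]" using c_n by (auto simp: diag_mat_def)
    ultimately show ?thesis using det_upper_triangular[of ?U n] by (simp add: map_replicate_const)
  qed
  also have "det ?L = 1"
  proof -
    have "det ?L = prod_list (diag_mat ?L)"
      by (rule det_lower_triangular[of n]) (auto intro!: c_mid)
    moreover have "diag_mat ?L = map (\<lambda>_. 1) [0..<n]" using c_n by (auto simp: diag_mat_def)
    ultimately show ?thesis by (simp add: map_replicate_const)
  qed
  finally show ?thesis by simp
qed

lemma realizable_separable:
  assumes sep: "separable FQ"
  shows "realizable F"
proof -
  let ?G = "gram_poly (2 * n) \<beta>" and ?T = "companion (2 * n) FQ"
  let ?M = "{x \<in> carrier_vec (2 * n). \<forall>i<2 * n. x $ i \<in> O2}"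
  have iv: "coeff (vpoly x) i \<in> O2" if "x \<in> ?M" for x i using that by (auto simp: coeff_vpoly)
  have N: "2 * n > 0" using pos by simp
  show ?thesis
  proof (rule realizable_by_basis[of ?G n ?T "1\<^sub>m (2 * n)" ?M 1 "(- 1) ^ n"])
    show "transpose_mat ?T * ?G * ?T = ?G"
      by (rule companion_isometry[OF FQ N]) (rule radical)
    show "x \<bullet> (?G *\<^sub>v y) \<in> O2" if "x \<in> ?M" "y \<in> ?M" for x y
      using \<beta>_integral[of "vpoly x" "vpoly y"] iv that b_vpoly[of x "2 * n" y] by simp
    show "\<exists>z\<in>O2. x \<bullet> (?G *\<^sub>v x) = 2 * z" if "x \<in> ?M" for x
      using \<beta>_even[of "vpoly x"] iv that b_vpoly[of x "2 * n" x] by simp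
    show "?T *\<^sub>v x \<in> ?M" if x: "x \<in> ?M" for x
    proof -
      have "(?T *\<^sub>v x) $ i \<in> O2" if i: "i < 2 * n" for i
      proof -
        have "(?T *\<^sub>v x) $ i = (\<Sum>j = 0..<2 * n. ?T $$ (i, j) * x $ j)"
          using x i by (auto simp: scalar_prod_def intro!: sum.cong)
        also have "\<dots> \<in> O2" using x i by (intro O2_sum O2_mult) (auto simp: companion_def)
        finally show ?thesis .
      qed
      then show ?thesis using x by (auto intro: carrier_vecI)
    qed
    show "col (1\<^sub>m (2 * n)) j \<in> ?M" if "j < 2 * n" for j using that by (auto simp: unit_vec_def)
    show "(- 1) ^ n * det ?G = 1\<^sup>2" unfolding det_gram by (simp add: power_mult_distrib[symmetric])
    show "det (1\<^sub>m (2 * n)) * det (1\<^sub>m (2 * n)) * det ?G = to_fract ((- 1) ^ n)" unfolding det_gram by simp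
    show "(- 1 :: z2) ^ n dvd 1" by (cases "even n") auto
    show "char_poly ?T = FQ" "diagonalizable ?T" using separable_companion[OF sep FQ] by simp_all
  qed (simp_all add: gram_poly_sym)
qed

text \<open>E is F divided by X - \<open>\<sigma>\<close>, so X acts on it as
  \<open>\<sigma>\<close> modulo the radical, and pairing with E is proportional to evaluation at
  \<open>\<sigma>\<close>. Pairing with the monomial of degree n - 1 determines the factor: only the
  leading coefficient of E meets a nonzero value of c.\<close>

lemma eigenvector_form:
  assumes E: "lead_coeff E = 1" and eig: "pCons 0 E - smult \<sigma> E = FQ" and \<sigma>: "\<sigma> * \<sigma> = 1"
  shows "\<beta> (pCons 0 E) s = \<sigma> * \<beta> E s" "\<beta> E s = \<sigma> ^ (n - 1) * poly s \<sigma>"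
proof -
  show X: "\<beta> (pCons 0 E) s = \<sigma> * \<beta> E s" for s
    using radical[of s] unfolding eig[symmetric] by (simp add: b_diff b_smult)
  have sh: "\<beta> E (pCons 0 s) = \<sigma> * \<beta> E s" for s
  proof -
    have "\<beta> E s = \<sigma> * \<beta> E (pCons 0 s)" using X[of "pCons 0 s"] by (simp add: b_shift)
    then have "\<sigma> * \<beta> E s = (\<sigma> * \<sigma>) * \<beta> E (pCons 0 s)" by simp
    then show ?thesis using \<sigma> by simp
  qed
  have ev: "\<beta> E s = poly s \<sigma> * \<beta> E 1" for s
  proof (induction s)
    case (pCons a s)
    have e: "pCons a s = smult a 1 + pCons 0 s" by (simp add: one_pCons)
    have "\<beta> E (pCons a s) = a * \<beta> E 1 + \<sigma> * \<beta> E s"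
      unfolding e by (simp only: b_add_right b_smult_right sh)
    then show ?case using pCons by (simp add: algebra_simps)
  qed simp
  have "degree E + 1 = 2 * n"
  proof -
    have "E \<noteq> 0" using E by auto
    then have "degree (smult \<sigma> E) < degree (pCons 0 E)"
      by (metis degree_pCons_eq degree_smult_le le_imp_less_Suc)
    then have "degree (pCons 0 E - smult \<sigma> E) = degree (pCons 0 E)"
      by (metis degree_add_eq_left degree_minus diff_conv_add_uminus)
    then show ?thesis using eig FQ \<open>E \<noteq> 0\<close> by simp
  qed
  then have dE: "degree E = 2 * n - 1" by simp
  have "\<beta> E (monom 1 (n - 1)) = (\<Sum>i\<le>2 * n - 1. coeff E i * to_fract (c (int i - int (n - 1))))"
    by (simp only: \<beta>_def lin_monom mult_1_left) (simp only: lin_def dE)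
  also have "\<dots> = (\<Sum>i\<le>2 * n - 1. if i = 2 * n - 1 then 1 else 0)"
  proof (rule sum.cong)
    fix i assume i: "i \<in> {..2 * n - 1}"
    show "coeff E i * to_fract (c (int i - int (n - 1))) = (if i = 2 * n - 1 then 1 else 0)"
    proof (cases "i = 2 * n - 1")
      case True
      then have "int i - int (n - 1) = int n" using pos by simp
      then show ?thesis using True E dE c_n(1) by simp
    next
      case False
      then have "\<bar>int i - int (n - 1)\<bar> < int n" using i pos by auto
      then show ?thesis using False c_mid by simp
    qed
  qed simp
  finally have "\<sigma> ^ (n - 1) * \<beta> E 1 = 1" using ev[of "monom 1 (n - 1)"] by (simp add: poly_monom)
  then have "\<sigma> ^ (n - 1) * (\<sigma> ^ (n - 1) * \<beta> E 1) = \<sigma> ^ (n - 1)" by simp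
  then have "(\<sigma> * \<sigma>) ^ (n - 1) * \<beta> E 1 = \<sigma> ^ (n - 1)" by (simp only: power_mult_distrib mult.assoc)
  then have "\<beta> E 1 = \<sigma> ^ (n - 1)" using \<sigma> by simp
  then show "\<beta> E s = \<sigma> ^ (n - 1) * poly s \<sigma>" using ev[of s] by (simp add: mult.commute)
qed

end

section \<open>Separable polynomials without the roots 1 and -1\<close>

locale self_reciprocal =
  fixes P :: "z2 poly" and m :: nat
  assumes P_monic: "lead_coeff P = 1" and P_deg: "degree P = 2 * m" and P_refl: "reflect_poly P = P"
    and P_1: "poly P 1 \<noteq> 0" and P_m1: "poly P (- 1) \<noteq> 0"
begin

abbreviation PQ :: "q2 poly" where "PQ \<equiv> map_poly to_fract P"

definition p1 :: q2 where "p1 = poly PQ 1"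

text \<open>With this sign the norms of the two eigenvectors are 2 \<open>p1\<close> and -2
  \<open>p2\<close>, and condition (b) says that \<open>p1 * p2\<close> is a square.\<close>

definition p2 :: q2 where "p2 = (- 1) ^ m * poly PQ (- 1)"

lemma p1_eq: "p1 = to_fract (poly P 1)"
  unfolding p1_def using poly_map_to_fract[of P 1] by simp

lemma PQ_m1: "poly PQ (- 1) = to_fract (poly P (- 1))"
  using poly_map_to_fract[of P "- 1"] by simp

lemma p2_eq: "p2 = to_fract ((- 1) ^ m * poly P (- 1))"
  unfolding p2_def PQ_m1 by simp

lemma p1_nz: "p1 \<noteq> 0" using P_1 by (simp add: p1_eq)

lemma p2_nz: "p2 \<noteq> 0" using P_m1 by (simp add: p2_eq)

lemma PQ_m1_p2: "poly PQ (- 1) = (- 1) ^ m * p2"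
  by (simp add: p2_def mult.assoc[symmetric] power_mult_distrib[symmetric])

lemma P_nz: "P \<noteq> 0" using P_1 by auto

sublocale toeplitz "[:- 1, 0, 1:] * P" "Suc m"
proof
  have d: "degree [:- 1, 0, 1 :: z2:] = 2" by simp
  show "lead_coeff ([:- 1, 0, 1:] * P) = 1" unfolding lead_coeff_mult using P_monic by simp
  show "degree ([:- 1, 0, 1:] * P) = 2 * Suc m"
    using P_nz P_deg by (subst degree_mult_eq) simp_all
  have "reflect_poly [:- 1, 0, 1 :: z2:] = - [:- 1, 0, 1:]" by (simp add: reflect_poly_def)
  then show "reflect_poly ([:- 1, 0, 1:] * P) = - ([:- 1, 0, 1:] * P)"
    by (simp only: reflect_poly_mult P_refl minus_mult_left)
qed simp

lemma FQ_eq: "FQ = [:- 1, 0, 1:] * PQ"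
  by (simp only: fract_poly_mult) (simp add: map_poly_pCons)

text \<open>Each of the two eigenvectors contains the linear factor of the other eigenvalue: (X + 1)
  \<open>K\<close> is \<open>FQ\<close>, so X acts on \<open>K\<close> as -1, and on
  \<open>K'\<close> as 1.\<close>

abbreviation K :: "q2 poly" where "K \<equiv> [:- 1, 1:] * PQ"

abbreviation K' :: "q2 poly" where "K' \<equiv> [:1, 1:] * PQ"

lemma PQ_monic: "lead_coeff PQ = 1" "degree PQ = 2 * m"
proof -
  have "lead_coeff PQ = to_fract (lead_coeff P)" by simp
  then show "lead_coeff PQ = 1" unfolding P_monic by simp
qed (simp add: P_deg)

lemma K_monic: "lead_coeff K = 1" "lead_coeff K' = 1" "degree K = Suc (2 * m)"
proof -
  have nz: "PQ \<noteq> 0" using P_nz by simp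
  show "lead_coeff K = 1" "lead_coeff K' = 1" unfolding lead_coeff_mult PQ_monic(1) by simp_all
  show "degree K = Suc (2 * m)" using nz PQ_monic by (subst degree_mult_eq) simp_all
qed

lemma \<beta>_K: "\<beta> (pCons 0 K) s = - 1 * \<beta> K s" "\<beta> K s = (- 1) ^ m * poly s (- 1)"
proof -
  have e: "pCons 0 K - smult (- 1) K = FQ"
  proof -
    have "pCons 0 K - smult (- 1) K = [:1, 1:] * K" by simp
    also have "\<dots> = ([:1, 1:] * [:- 1, 1:]) * PQ" by (simp only: mult.assoc)
    also have "[:1, 1:] * [:- 1, 1:] = [:- 1, 0, 1 :: q2:]" by simp
    finally show ?thesis unfolding FQ_eq .
  qed
  show "\<beta> (pCons 0 K) s = - 1 * \<beta> K s" "\<beta> K s = (- 1) ^ m * poly s (- 1)"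
    using eigenvector_form[OF K_monic(1) e] by simp_all
qed

lemma \<beta>_K': "\<beta> K' s = poly s 1"
proof -
  have e: "pCons 0 K' - smult 1 K' = FQ"
  proof -
    have "pCons 0 K' - smult 1 K' = [:- 1, 1:] * K'" by simp
    also have "\<dots> = ([:- 1, 1:] * [:1, 1:]) * PQ" by (simp only: mult.assoc)
    also have "[:- 1, 1:] * [:1, 1:] = [:- 1, 0, 1 :: q2:]" by simp
    finally show ?thesis unfolding FQ_eq .
  qed
  show ?thesis using eigenvector_form(2)[OF K_monic(2) e] by simp
qed

lemma K_eval: "poly K (- 1) = - 2 * ((- 1) ^ m * p2)"
  unfolding poly_mult PQ_m1_p2 by simp

lemma \<beta>_KK: "\<beta> K K = - 2 * p2"
  unfolding \<beta>_K(2) K_eval by (simp add: mult.assoc[symmetric] power_mult_distrib[symmetric])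

text \<open>In \<open>b1\<close> the eigenvector \<open>K\<close> of the Toeplitz form of \<open>(X\<^sup>2 - 1) P\<close>, and in \<open>b2\<close> also the
  resulting eigenvector \<open>PQ\<close>, is projected away. It then generates the radical, so the shift acts on the
  quotient with characteristic polynomial \<open>K\<close>, respectively \<open>PQ\<close>.\<close>

definition b1 :: "q2 poly \<Rightarrow> q2 poly \<Rightarrow> q2" where
  "b1 r s = \<beta> r s - \<beta> r K * \<beta> s K / (- 2 * p2)"

lemma b1_eq: "b1 r s = \<beta> r s + poly r (- 1) * poly s (- 1) / (2 * p2)"
proof -
  have "\<beta> r K * \<beta> s K = ((- 1) ^ m * (- 1) ^ m) * (poly r (- 1) * poly s (- 1))"
    unfolding b_sym[of _ K] \<beta>_K(2) by (simp only: ac_simps)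
  also have "\<dots> = poly r (- 1) * poly s (- 1)" by (simp add: power_mult_distrib[symmetric])
  finally show ?thesis by (simp add: b1_def)
qed

sublocale b1: poly_form b1
  unfolding b1_def by (rule projection_form[OF \<beta>_K(1)]) simp

lemma b1_K: "b1 K s = 0"
  using p2_nz by (simp add: b1_def \<beta>_KK b_sym[of s K] del: mult_pCons_left)

lemma det_b1: "det (gram_poly (Suc (2 * m)) b1) = (- 1) ^ m / (2 * p2)"
proof -
  have "(- 1) ^ Suc m = (- 2 * p2) * det (gram_poly (Suc (2 * m)) b1)"
    using det_projection[OF K_monic(1,3) \<beta>_KK] p2_nz det_gram unfolding b1_def[abs_def] by simp
  then show ?thesis using p2_nz by (simp add: field_simps)
qed

text \<open>Pairings with 2 \<open>PQ\<close> = \<open>K'\<close> - \<open>K\<close> are evaluations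
  at 1 and -1; the projection removes the evaluation at -1.\<close>

lemma b1_PQ: "b1 PQ s = poly s 1 / 2"
proof -
  have "smult 2 PQ = K' - K" by (simp only: left_diff_distrib[symmetric]) simp
  then have "2 * \<beta> PQ s = poly s 1 - (- 1) ^ m * poly s (- 1)"
    by (metis b_smult b_diff(1) \<beta>_K(2) \<beta>_K')
  then have "\<beta> PQ s = (poly s 1 - (- 1) ^ m * poly s (- 1)) / 2" by (simp add: field_simps)
  then show ?thesis unfolding b1_eq PQ_m1_p2 using p2_nz by (simp add: field_simps)
qed

definition b2 :: "q2 poly \<Rightarrow> q2 poly \<Rightarrow> q2" where
  "b2 r s = b1 r s - b1 r PQ * b1 s PQ / (p1 / 2)"

lemma b1_PQPQ: "b1 PQ PQ = p1 / 2"
  by (simp add: b1_PQ p1_def)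

lemma b2_eq: "b2 r s = \<beta> r s + poly r (- 1) * poly s (- 1) / (2 * p2) - poly r 1 * poly s 1 / (2 * p1)"
proof -
  have e: "b1 r PQ = poly r 1 / 2" for r by (rule trans[OF b1.b_sym b1_PQ])
  show ?thesis unfolding b2_def e unfolding b1_eq using p1_nz by (simp add: field_simps)
qed

sublocale b2: poly_form b2
  unfolding b2_def
proof (rule b1.projection_form)
  fix s
  \<comment> \<open>X P = P + (X - 1) P, and \<open>K\<close> is in the radical of
    \<open>b1\<close>.\<close>
  have e: "pCons 0 PQ = PQ + K" by simp
  show "b1 (pCons 0 PQ) s = 1 * b1 PQ s" unfolding e b1.b_add b1_K by simp
qed simp

lemma b2_PQ: "b2 PQ s = 0"
  using p1_nz by (simp add: b2_def b1_PQPQ b1.b_sym[of s PQ])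

lemma det_b2: "det (gram_poly (2 * m) b2) = (- 1) ^ m / (p1 * p2)"
proof -
  have "(- 1) ^ m / (2 * p2) = p1 / 2 * det (gram_poly (2 * m) b2)"
    using b1.det_projection[OF PQ_monic b1_PQPQ] p1_nz det_b1 unfolding b2_def[abs_def] by simp
  then show ?thesis using p1_nz p2_nz by (simp add: field_simps)
qed

end

text \<open>A unit s is odd, so y and s x agree modulo 2. For the second claim, y - s x and y + s x
  are both even. These are the numerators over 2 in integrality, respectively evenness, of the
  neighbouring lattice.\<close>

lemma two_dvd_twisted:
  fixes x y :: z2
  assumes "2 dvd x - y" "2 dvd x' - y'" and s: "s dvd 1"
  shows "2 dvd y * y' - s\<^sup>2 * (x * x')" "4 dvd y * y - s\<^sup>2 * (x * x)"
proof -
  have s1: "2 dvd s - 1"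
    using s z2_unit_iff[of s] z2_unit_iff[of 1] two_dvd_diff[of s 1] by simp
  have y: "2 dvd y - s * x" if "2 dvd x - y" for x y
  proof -
    have "y - s * x = - (x - y) - (s - 1) * x" by (simp add: algebra_simps)
    then show ?thesis using that s1 by (metis dvd_diff dvd_minus_iff dvd_mult2)
  qed
  have "y * y' - s\<^sup>2 * (x * x') = (y - s * x) * y' + (s * x) * (y' - s * x')"
    by (simp add: algebra_simps power2_eq_square)
  then show "2 dvd y * y' - s\<^sup>2 * (x * x')" using y assms(1,2) by (metis dvd_add dvd_mult dvd_mult2)
  have "y + s * x = (y - s * x) + 2 * (s * x)" by simp
  then have "2 dvd y + s * x" using y[OF assms(1)] by (metis dvd_add dvd_triv_left)
  then have "2 * 2 dvd (y - s * x) * (y + s * x)" using y[OF assms(1)] by (intro mult_dvd_mono)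
  moreover have "(y - s * x) * (y + s * x) = y * y - s\<^sup>2 * (x * x)"
    by (simp add: algebra_simps power2_eq_square)
  ultimately show "4 dvd y * y - s\<^sup>2 * (x * x)" by simp
qed

context self_reciprocal
begin

lemma parity: "2 dvd poly P 1 - poly P (- 1)"
proof -
  have "2 dvd poly p 1 - poly p (- 1 :: z2)" for p :: "z2 poly"
  proof (induction p)
    case (pCons a p)
    have "poly (pCons a p) 1 - poly (pCons a p) (- 1) = (poly p 1 - poly p (- 1)) + 2 * poly p (- 1)"
      by simp
    then show ?case using pCons by (metis dvd_add dvd_triv_left)
  qed simp
  then show ?thesis .
qed

text \<open>The two nonintegral terms of \<open>b2\<close> compensate each other, because \<open>w / u\<close> is a square, on the
  lattice of the polynomials whose values at 1 and -1 are divisible by \<open>2 ^ i\<close> and \<open>2 ^ j\<close> with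
  quotients of equal parity.\<close>

lemma realizable_no_roots:
  assumes m: "m > 0" and u: "u dvd 1" "poly P 1 = 4 ^ i * u"
    and w: "w dvd 1" "(- 1) ^ m * poly P (- 1) = 4 ^ j * w" and s: "s dvd 1" "w = s\<^sup>2 * u"
    and sep: "separable PQ"
  shows "realizable P"
proof -
  define N where "N = 2 * m"
  have N: "N > 0" "degree PQ = N" using m PQ_monic by (auto simp: N_def)
  have p1': "p1 = 4 ^ i * to_fract u" unfolding p1_eq u by simp
  have p2': "p2 = 4 ^ j * to_fract w" unfolding p2_eq w by simp
  have uw0: "to_fract u \<noteq> 0" "to_fract w \<noteq> 0" using u w by auto
  have four: "(4 :: q2) ^ k = 2 ^ k * 2 ^ k" "(4 :: z2) ^ k = 2 ^ k * 2 ^ k" for k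
    by (subst power_mult_distrib[symmetric], simp)+
  have Pm1: "poly P (- 1) = (- 1) ^ m * (4 ^ j * w)"
    unfolding w(2)[symmetric] by (simp add: mult.assoc[symmetric] power_mult_distrib[symmetric])
  have sg: "2 dvd (- 1) ^ m * x - (x :: z2)" for x by (cases "even m") auto
  \<comment> \<open>P(1) and P(-1) have the same parity, so either both are units or neither
    is.\<close>
  have ij: "i = 0 \<longleftrightarrow> j = 0"
  proof -
    have d: "2 dvd 4 ^ i * u - 4 ^ j * w"
    proof -
      have "4 ^ i * u - 4 ^ j * w = (poly P 1 - poly P (- 1)) + ((- 1) ^ m * (4 ^ j * w) - 4 ^ j * w)"
        unfolding u(2) Pm1 by simp
      then show ?thesis using parity sg by (metis dvd_add)
    qed
    have nu: "\<not> 2 dvd u" "\<not> 2 dvd w" using u(1) w(1) by (simp_all add: z2_unit_iff)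
    have ev: "2 dvd 4 ^ k * (x :: z2)" if "k > 0" for k x
      using that four by (metis dvd_mult2 dvd_power)
    have "i = 0 \<Longrightarrow> j > 0 \<Longrightarrow> False" using d ev[of j w] nu by (simp add: dvd_diff_left_iff)
    moreover have "j = 0 \<Longrightarrow> i > 0 \<Longrightarrow> False" using d ev[of i u] nu by (simp add: dvd_diff_right_iff)
    ultimately show ?thesis by blast
  qed
  let ?G = "gram_poly N b2" and ?T = "companion N PQ"
  define M where "M = {x \<in> carrier_vec N. (\<forall>k<N. x $ k \<in> O2) \<and>
    (\<exists>a b. 2 dvd a - b \<and> poly (vpoly x) 1 = 2 ^ i * to_fract a \<and> poly (vpoly x) (- 1) = 2 ^ j * to_fract b)}"
  have iv: "coeff (vpoly x) k \<in> O2" if "x \<in> M" for x k using that by (auto simp: coeff_vpoly M_def)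
  \<comment> \<open>Division of the values by \<open>2 ^ i\<close> and \<open>2 ^ j\<close> leaves
    the denominators 2 u and 2 w, and w = s^2 u brings both terms over 2 w.\<close>
  have pair: "x \<bullet> (?G *\<^sub>v y) = \<beta> (vpoly x) (vpoly y) + to_fract (b * b' - s\<^sup>2 * (a * a')) / (2 * to_fract w)"
    if xy: "x \<in> M" "y \<in> M" and ab: "poly (vpoly x) 1 = 2 ^ i * to_fract a" "poly (vpoly x) (- 1) = 2 ^ j * to_fract b"
      "poly (vpoly y) 1 = 2 ^ i * to_fract a'" "poly (vpoly y) (- 1) = 2 ^ j * to_fract b'" for x y a b a' b'
  proof -
    have "x \<bullet> (?G *\<^sub>v y) = b2 (vpoly x) (vpoly y)"
      by (rule b2.b_vpoly[symmetric]) (use xy in \<open>auto simp: M_def\<close>)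
    also have "\<dots> = \<beta> (vpoly x) (vpoly y) + (2 ^ j * to_fract b) * (2 ^ j * to_fract b') / (2 * p2)
        - (2 ^ i * to_fract a) * (2 ^ i * to_fract a') / (2 * p1)"
      unfolding b2_eq ab ..
    also have "(2 ^ j * to_fract b) * (2 ^ j * to_fract b') / (2 * p2) = to_fract (b * b') / (2 * to_fract w)"
      unfolding p2' four using uw0 by (simp add: field_simps)
    also have "(2 ^ i * to_fract a) * (2 ^ i * to_fract a') / (2 * p1) = to_fract (s\<^sup>2 * (a * a')) / (2 * to_fract w)"
    proof -
      have "to_fract s \<noteq> 0" using s(1) by auto
      then show ?thesis unfolding p1' four s(2) using uw0 by (simp add: field_simps power2_eq_square)
    qed
    finally show ?thesis by (simp add: diff_divide_distrib)
  qed
  have int: "x \<bullet> (?G *\<^sub>v y) \<in> O2" if xy: "x \<in> M" "y \<in> M" for x y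
  proof -
    obtain a b where ab: "2 dvd a - b" "poly (vpoly x) 1 = 2 ^ i * to_fract a" "poly (vpoly x) (- 1) = 2 ^ j * to_fract b"
      using xy(1) by (auto simp: M_def)
    obtain a' b' where ab': "2 dvd a' - b'" "poly (vpoly y) 1 = 2 ^ i * to_fract a'" "poly (vpoly y) (- 1) = 2 ^ j * to_fract b'"
      using xy(2) by (auto simp: M_def)
    obtain k where k: "b * b' - s\<^sup>2 * (a * a') = 2 * k"
      using two_dvd_twisted(1)[OF ab(1) ab'(1) s(1)] by (elim dvdE)
    have "to_fract (b * b' - s\<^sup>2 * (a * a')) / (2 * to_fract w) = to_fract k * inverse (to_fract w)"
      unfolding k using uw0 by (simp add: field_simps)
    also have "\<dots> \<in> O2" using to_fract_unit_inverse[OF w(1)] by blast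
    finally show ?thesis unfolding pair[OF xy ab(2,3) ab'(2,3)]
      using \<beta>_integral[of "vpoly x" "vpoly y"] iv xy by blast
  qed
  have even: "\<exists>z\<in>O2. x \<bullet> (?G *\<^sub>v x) = 2 * z" if x: "x \<in> M" for x
  proof -
    obtain a b where ab: "2 dvd a - b" "poly (vpoly x) 1 = 2 ^ i * to_fract a" "poly (vpoly x) (- 1) = 2 ^ j * to_fract b"
      using x by (auto simp: M_def)
    obtain k where k: "b * b - s\<^sup>2 * (a * a) = 4 * k"
      using two_dvd_twisted(2)[OF ab(1) ab(1) s(1)] by (elim dvdE)
    have e: "to_fract (b * b - s\<^sup>2 * (a * a)) / (2 * to_fract w) = 2 * (to_fract k * inverse (to_fract w))"
      unfolding k using uw0 by (simp add: field_simps)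
    obtain z where z: "z \<in> O2" "\<beta> (vpoly x) (vpoly x) = 2 * z" using \<beta>_even iv x by blast
    show ?thesis unfolding pair[OF x x ab(2,3) ab(2,3)] e z(2)
      using z(1) to_fract_unit_inverse[OF w(1)] by (intro bexI[of _ "z + to_fract k * inverse (to_fract w)"]) (auto simp: algebra_simps)
  qed
  have stable: "?T *\<^sub>v x \<in> M" if x: "x \<in> M" for x
  proof -
    have xc: "x \<in> carrier_vec N" using x by (simp add: M_def)
    obtain a b where ab: "2 dvd a - b" "poly (vpoly x) 1 = 2 ^ i * to_fract a" "poly (vpoly x) (- 1) = 2 ^ j * to_fract b"
      using x by (auto simp: M_def)
    have "x $ (N - 1) \<in> O2" using x N by (simp add: M_def)
    then obtain t where t: "x $ (N - 1) = to_fract t" by (elim O2_E)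
    have v: "vpoly (?T *\<^sub>v x) = pCons 0 (vpoly x) - smult (to_fract t) PQ"
      using vpoly_companion[OF xc PQ_monic(1) N(2,1)] t by simp
    \<comment> \<open>The values of X x - t P at 1 and -1 divided by \<open>2 ^ i\<close> and
      \<open>2 ^ j\<close>; of the factor \<open>4 ^ i\<close> in P(1) one factor
      \<open>2 ^ i\<close> remains, and similarly at -1.\<close>
    let ?a = "a - t * (2 ^ i * u)" and ?b = "- b - t * ((- 1) ^ m * (2 ^ j * w))"
    have 1: "poly (vpoly (?T *\<^sub>v x)) 1 = 2 ^ i * to_fract ?a"
      unfolding v using ab(2) p1'[unfolded p1_def] by (simp add: four algebra_simps)
    have 2: "poly (vpoly (?T *\<^sub>v x)) (- 1) = 2 ^ j * to_fract ?b"
      unfolding v using ab(3) PQ_m1_p2 p2' by (simp add: four algebra_simps)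
    have 3: "2 dvd ?a - ?b"
    proof -
      have "2 dvd 2 ^ i * u - 2 ^ j * w"
      proof (cases "i = 0")
        case True
        then show ?thesis using ij u(1) w(1) two_dvd_diff[of u w] by (simp add: z2_unit_iff)
      next
        case False
        then have "2 dvd 2 ^ i * u" "2 dvd 2 ^ j * w" using ij by (auto intro: dvd_mult2 dvd_power)
        then show ?thesis by (rule dvd_diff)
      qed
      moreover have "?a - ?b = (a - b) + 2 * b + t * (((- 1) ^ m * (2 ^ j * w) - 2 ^ j * w) - (2 ^ i * u - 2 ^ j * w))"
        by (simp add: algebra_simps)
      ultimately show ?thesis using ab(1) sg by (metis dvd_add dvd_diff dvd_mult dvd_triv_left)
    qed
    have "coeff (vpoly (?T *\<^sub>v x)) k \<in> O2" for k
      unfolding v using iv[OF x] by (auto simp: coeff_pCons coeff_map_poly split: nat.split)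
    then have "(?T *\<^sub>v x) $ k \<in> O2" if "k < N" for k
      using that by (metis coeff_vpoly dim_mult_mat_vec companion_dim(1))
    moreover have "\<exists>a b. 2 dvd a - b \<and> poly (vpoly (?T *\<^sub>v x)) 1 = 2 ^ i * to_fract a
        \<and> poly (vpoly (?T *\<^sub>v x)) (- 1) = 2 ^ j * to_fract b"
      by (intro exI[of _ ?a] exI[of _ ?b] conjI 1 2 3)
    moreover have "?T *\<^sub>v x \<in> carrier_vec N" using xc by (auto intro: carrier_vecI)
    ultimately show ?thesis unfolding M_def by blast
  qed
  \<comment> \<open>The basis consists of A + B X with values \<open>2 ^ i\<close> and
    \<open>2 ^ j\<close> at 1 and -1, of \<open>2 ^ j\<close> (1 - X) with quotients 0 and 2, and of
    multiples of X^2 - 1. A is integral because i and j vanish together.\<close>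
  obtain A where A: "2 * A = 2 ^ i + (2 ^ j :: z2)"
  proof (cases "i = 0")
    case True
    then show ?thesis using that[of 1] ij by simp
  next
    case False
    then have "2 dvd 2 ^ i + (2 ^ j :: z2)" using ij by (intro dvd_add) (auto intro: dvd_power)
    then show ?thesis using that by (elim dvdE) simp
  qed
  define B where "B = A - 2 ^ j"
  have AB: "A + B = 2 ^ i" "A - B = 2 ^ j" unfolding B_def using A by (simp_all add: mult_2 algebra_simps)
  define q :: "nat \<Rightarrow> z2 poly" where
    "q k = (if k = 0 then [:A, B:] else if k = 1 then [:2 ^ j, - (2 ^ j):] else monom 1 (k - 2) * [:- 1, 0, 1:])" for k
  define Q where "Q = mat N N (\<lambda>(k, l). to_fract (coeff (q l) k))"
  have Q: "Q \<in> carrier_mat N N" by (simp add: Q_def)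
  have cq: "coeff (monom 1 l * [:- 1, 0, 1 :: z2:]) k = (if k = l then - 1 else if k = l + 2 then 1 else 0)" for k l
    by (auto simp: coeff_monom_mult coeff_pCons split: nat.split)
  have N2: "N \<ge> 2" using m N_def by simp
  have qdeg: "coeff (q l) k = 0" if "l < N" "N \<le> k" for k l
    using that N2 by (auto simp: q_def cq coeff_pCons split: nat.split)
  have vQ: "vpoly (col Q l) = map_poly to_fract (q l)" if l: "l < N" for l
    using l qdeg[OF l] by (intro poly_eqI) (auto simp: coeff_vpoly Q_def coeff_map_poly)
  have basis: "col Q l \<in> M" if l: "l < N" for l
  proof -
    have ev: "poly (vpoly (col Q l)) 1 = to_fract (poly (q l) 1)" "poly (vpoly (col Q l)) (- 1) = to_fract (poly (q l) (- 1))"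
      unfolding vQ[OF l] using poly_map_to_fract[of "q l" 1] poly_map_to_fract[of "q l" "- 1"] by simp_all
    have "\<exists>a b. 2 dvd a - b \<and> poly (q l) 1 = 2 ^ i * a \<and> poly (q l) (- 1) = 2 ^ j * b"
    proof -
      consider "l = 0" | "l = 1" | "l \<ge> 2" by linarith
      then show ?thesis
      proof cases
        case 1
        then show ?thesis using AB by (intro exI[of _ 1]) (simp add: q_def)
      next
        case 2
        then show ?thesis by (intro exI[of _ 0] exI[of _ 2]) (simp add: q_def)
      next
        case 3
        then show ?thesis by (intro exI[of _ 0]) (simp add: q_def poly_monom)
      qed
    qed
    then obtain a b where "2 dvd a - b" "poly (q l) 1 = 2 ^ i * a" "poly (q l) (- 1) = 2 ^ j * b" by blast
    then have "\<exists>a b. 2 dvd a - b \<and> poly (vpoly (col Q l)) 1 = 2 ^ i * to_fract a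
        \<and> poly (vpoly (col Q l)) (- 1) = 2 ^ j * to_fract b"
      unfolding ev by (intro exI[of _ a] exI[of _ b]) simp
    then show ?thesis unfolding M_def using l by (auto simp: Q_def intro: carrier_vecI)
  qed
  have detQ: "det Q = - (2 ^ i * 2 ^ j)"
  proof -
    obtain e where e: "N = 2 + e" using m N_def by (metis One_nat_def Suc_leI le_Suc_ex mult_2 nat_mult_le_cancel1 mult.right_neutral zero_less_numeral)
    let ?A1 = "mat 2 2 (\<lambda>(k, l). to_fract (coeff (q l) k))"
    let ?A2 = "mat 2 e (\<lambda>(k, l). to_fract (coeff (q (l + 2)) k))"
    let ?A4 = "mat e e (\<lambda>(k, l). to_fract (coeff (q (l + 2)) (k + 2)))"
    have "Q = four_block_mat ?A1 ?A2 (0\<^sub>m e 2) ?A4"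
      by (rule eq_matI) (auto simp: Q_def e q_def coeff_pCons split: nat.split)
    then have "det Q = det ?A1 * det ?A4"
      using det_four_block_mat_lower_left_zero[of ?A1 2 ?A2 e "0\<^sub>m e 2" ?A4] by simp
    also have "det ?A1 = - (2 ^ i * 2 ^ j)"
    proof -
      have "det ?A1 = to_fract (A * - (2 ^ j) - 2 ^ j * B)"
        by (subst det_dim_2) (auto simp: q_def)
      also have "A * - (2 ^ j) - 2 ^ j * B = - (2 ^ i * 2 ^ j)" unfolding AB(1)[symmetric] by (simp add: algebra_simps)
      finally show ?thesis by simp
    qed
    also have "det ?A4 = 1"
    proof -
      have "upper_triangular ?A4" by (auto simp: upper_triangular_def q_def cq)
      moreover have "diag_mat ?A4 = map (\<lambda>_. 1) [0..<e]" by (auto simp: diag_mat_def q_def cq)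
      ultimately show ?thesis using det_upper_triangular[of ?A4 e] by (simp add: map_replicate_const)
    qed
    finally show ?thesis by simp
  qed
  have su: "to_fract s \<noteq> 0" using s(1) by auto
  \<comment> \<open>The squared index of the lattice cancels the powers of 2 in
    \<open>p1 * p2\<close>; the unit u w in the denominator is left.\<close>
  obtain u' where u': "1 = (u * w) * u'" using u(1) w(1) by (metis dvdE is_unit_mult_iff)
  have u'F: "to_fract u' = 1 / (to_fract u * to_fract w)"
    using arg_cong[OF u', of to_fract] uw0 by (simp add: field_simps)
  show ?thesis
  proof (rule realizable_by_basis[of ?G m ?T Q M "inverse (2 ^ i * 2 ^ j * to_fract s * to_fract u)" "(- 1) ^ m * u'", folded N_def])
    show "transpose_mat ?T * ?G * ?T = ?G"
      by (rule b2.companion_isometry[OF PQ_monic(1) N(2,1)]) (rule b2_PQ)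
    show "(- 1) ^ m * det ?G = (inverse (2 ^ i * 2 ^ j * to_fract s * to_fract u))\<^sup>2"
    proof -
      have D: "p1 * p2 = (2 ^ i * 2 ^ j * to_fract s * to_fract u)\<^sup>2"
        unfolding p1' p2' s(2) four by (simp add: power2_eq_square)
      have "(- 1) ^ m * ((- 1) ^ m / x) = inverse x" for x :: q2
        by (cases "even m") (simp_all add: inverse_eq_divide)
      then show ?thesis unfolding N_def det_b2 D power_inverse .
    qed
    show "det Q * det Q * det ?G = to_fract ((- 1) ^ m * u')"
      using uw0 by (simp add: detQ N_def det_b2 p1' p2' four u'F)
    show "(- 1) ^ m * u' dvd 1"
    proof -
      have "u' dvd 1" unfolding u' by (rule dvd_triv_right)
      then show ?thesis by (cases "even m") auto
    qed
    show "char_poly ?T = PQ" "diagonalizable ?T" using separable_companion[OF sep PQ_monic(1) N(2)] by simp_all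
  qed (use int even stable basis Q b2.gram_poly_sym in simp_all)
qed

end

lemma block_vec_split:
  assumes "x \<in> carrier_vec (Suc N)"
  shows "x = vec 1 (\<lambda>_. x $ 0) @\<^sub>v vec N (\<lambda>i. x $ Suc i)"
  using assms by (intro eq_vecI) (auto simp: append_vec_def)

context self_reciprocal
begin

text \<open>In the lattice of the Toeplitz form for \<open>(X\<^sup>2 - 1) P\<close> the eigenvector \<open>(X - 1) P\<close> for the
  eigenvalue -1 has norm twice a unit times \<open>4 ^ j\<close>. After passing to the neighbouring lattice
  containing its quotient by \<open>2 ^ j\<close>, the reflection in it is integral, and composing with it
  turns the eigenvalue -1 into 1. In the coordinates used here the eigenvector is split off.\<close>

lemma realizable_double_root:
  assumes w: "w dvd 1" "(- 1) ^ m * poly P (- 1) = 4 ^ j * w" and sep: "separable K"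
  shows "realizable ([:- 1, 1:] * ([:- 1, 1:] * P))"
proof -
  define N where "N = Suc (2 * m)"
  have N: "N > 0" "degree K = N" using K_monic by (auto simp: N_def)
  have dN: "2 * Suc m = Suc N" by (simp add: N_def)
  have p2': "p2 = 4 ^ j * to_fract w" unfolding p2_eq w by simp
  have w0: "to_fract w \<noteq> 0" using w by auto
  obtain w' where w': "1 = w * w'" using w(1) by (elim dvdE)
  have w'F: "to_fract w' = 1 / to_fract w"
    using arg_cong[OF w', of to_fract] w0 by (simp add: field_simps)
  have four: "(4 :: q2) ^ k = 2 ^ k * 2 ^ k" for k
    by (subst power_mult_distrib[symmetric]) simp
  \<comment> \<open>\<open>K\<close> divided by \<open>2 ^ j\<close> has norm -2 w. It spans the
    first summand, on which the new isometry acts by 1 instead of -1; the second summand carries the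
    projected form \<open>b1\<close>.\<close>
  let ?W = "mat 1 1 (\<lambda>_. - 2 * to_fract w)"
  let ?G = "four_block_mat ?W (0\<^sub>m 1 N) (0\<^sub>m N 1) (gram_poly N b1)"
  let ?C = "companion N K"
  let ?T = "four_block_mat (1\<^sub>m 1) (0\<^sub>m 1 N) (0\<^sub>m N 1) ?C"
  have Wc: "?W \<in> carrier_mat 1 1" and Cc: "?C \<in> carrier_mat N N" and Gc: "gram_poly N b1 \<in> carrier_mat N N"
    by (rule mat_carrier companion_carrier gram_poly_carrier)+
  let ?r = "\<lambda>x :: q2 vec. vec N (\<lambda>i. x $ Suc i) :: q2 vec"
  let ?z = "\<lambda>x :: q2 vec. vec 1 (\<lambda>_. x $ 0) :: q2 vec"
  have mult: "four_block_mat A (0\<^sub>m 1 N) (0\<^sub>m N 1) B *\<^sub>v x = (A *\<^sub>v ?z x) @\<^sub>v (B *\<^sub>v ?r x)"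
    if "A \<in> carrier_mat 1 1" "B \<in> carrier_mat N N" "x \<in> carrier_vec (Suc N)" for A B x
    apply (subst block_vec_split[OF that(3)])
    apply (subst four_block_mat_mult_vec[OF that(1) zero_carrier_mat zero_carrier_mat that(2)])
    using that by (auto intro!: arg_cong2[of _ _ _ _ append_vec] eq_vecI)
  have pair: "x \<bullet> (?G *\<^sub>v y) = - 2 * to_fract w * (x $ 0 * y $ 0) + b1 (vpoly (?r x)) (vpoly (?r y))"
    if xy: "x \<in> carrier_vec (Suc N)" "y \<in> carrier_vec (Suc N)" for x y :: "q2 vec"
  proof -
    have "x \<bullet> (?G *\<^sub>v y) = (?z x @\<^sub>v ?r x) \<bullet> ((?W *\<^sub>v ?z y) @\<^sub>v (gram_poly N b1 *\<^sub>v ?r y))"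
      using mult[OF Wc Gc xy(2)] block_vec_split[OF xy(1)] by simp
    also have "\<dots> = ?z x \<bullet> (?W *\<^sub>v ?z y) + ?r x \<bullet> (gram_poly N b1 *\<^sub>v ?r y)"
      by (rule scalar_prod_append[of _ 1 _ N]) (auto intro: carrier_vecI)
    also have "?r x \<bullet> (gram_poly N b1 *\<^sub>v ?r y) = b1 (vpoly (?r x)) (vpoly (?r y))"
      by (rule b1.b_vpoly[symmetric]) auto
    also have "?z x \<bullet> (?W *\<^sub>v ?z y) = - 2 * to_fract w * (x $ 0 * y $ 0)"
      by (simp add: scalar_prod_def)
    finally show ?thesis .
  qed
  \<comment> \<open>A polynomial with value \<open>2 ^ j * y\<close> at -1 has, up to the sign
    chosen for the eigenvector, the coordinate y / (2 w) along \<open>K\<close> divided by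
    \<open>2 ^ j\<close>. The free summand a adjoins that vector itself.\<close>
  define M where "M = {x \<in> carrier_vec (Suc N). (\<forall>k<N. x $ Suc k \<in> O2) \<and>
    (\<exists>y a. poly (vpoly (?r x)) (- 1) = 2 ^ j * to_fract y \<and> x $ 0 = to_fract y / (2 * to_fract w) + to_fract a)}"
  have iv: "coeff (vpoly (?r x)) k \<in> O2" if "x \<in> M" for x k using that by (auto simp: coeff_vpoly M_def)
  \<comment> \<open>The terms y y' / (2 w) coming from the two summands cancel.\<close>
  have pairM: "x \<bullet> (?G *\<^sub>v x') = \<beta> (vpoly (?r x)) (vpoly (?r x')) - to_fract (y * a' + y' * a + 2 * (w * (a * a')))"
    if xx: "x \<in> M" "x' \<in> M" and h: "poly (vpoly (?r x)) (- 1) = 2 ^ j * to_fract y" "x $ 0 = to_fract y / (2 * to_fract w) + to_fract a"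
      "poly (vpoly (?r x')) (- 1) = 2 ^ j * to_fract y'" "x' $ 0 = to_fract y' / (2 * to_fract w) + to_fract a'"
    for x x' :: "q2 vec" and y y' a a'
  proof -
    have e: "x \<bullet> (?G *\<^sub>v x') = - 2 * to_fract w * (x $ 0 * x' $ 0) + b1 (vpoly (?r x)) (vpoly (?r x'))"
      by (rule pair) (use xx in \<open>simp_all add: M_def\<close>)
    show ?thesis unfolding e unfolding b1_eq h p2' four using w0 by (simp add: field_simps)
  qed
  have int: "x \<bullet> (?G *\<^sub>v y) \<in> O2" if xy: "x \<in> M" "y \<in> M" for x y
  proof -
    obtain c a where h: "poly (vpoly (?r x)) (- 1) = 2 ^ j * to_fract c" "(x :: q2 vec) $ 0 = to_fract c / (2 * to_fract w) + to_fract a"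
      using xy(1) unfolding M_def by blast
    obtain c' a' where h': "poly (vpoly (?r y)) (- 1) = 2 ^ j * to_fract c'" "y $ 0 = to_fract c' / (2 * to_fract w) + to_fract a'"
      using xy(2) unfolding M_def by blast
    show ?thesis unfolding pairM[OF xy h h']
      by (intro O2_diff \<beta>_integral iv xy to_fract_in_O2)
  qed
  have even: "\<exists>z\<in>O2. x \<bullet> (?G *\<^sub>v x) = 2 * z" if x: "x \<in> M" for x
  proof -
    obtain c a where h: "poly (vpoly (?r x)) (- 1) = 2 ^ j * to_fract c" "(x :: q2 vec) $ 0 = to_fract c / (2 * to_fract w) + to_fract a"
      using x unfolding M_def by blast
    obtain z where z: "z \<in> O2" "\<beta> (vpoly (?r x)) (vpoly (?r x)) = 2 * z" using \<beta>_even iv[OF x] by blast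
    have "x \<bullet> (?G *\<^sub>v x) = 2 * (z - to_fract (c * a + w * (a * a)))"
      unfolding pairM[OF x x h h] z(2) by (simp add: algebra_simps)
    moreover have "z - to_fract (c * a + w * (a * a)) \<in> O2" using z(1) by (intro O2_diff to_fract_in_O2)
    ultimately show ?thesis by blast
  qed
  have Tx: "(?T *\<^sub>v x) $ 0 = x $ 0" "?r (?T *\<^sub>v x) = ?C *\<^sub>v ?r x" if "x \<in> carrier_vec (Suc N)" for x
    unfolding mult[OF one_carrier_mat Cc that] by (auto intro!: eq_vecI simp: append_vec_def)
  have stable: "?T *\<^sub>v x \<in> M" if x: "x \<in> M" for x
  proof -
    have xc: "x \<in> carrier_vec (Suc N)" and rc: "?r x \<in> carrier_vec N" using x by (simp_all add: M_def)
    obtain c a where h: "poly (vpoly (?r x)) (- 1) = 2 ^ j * to_fract c" "(x :: q2 vec) $ 0 = to_fract c / (2 * to_fract w) + to_fract a"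
      using x unfolding M_def by blast
    have N1: "N - 1 < N" using N by simp
    then have "x $ Suc (N - 1) \<in> O2" using x unfolding M_def by blast
    then have "?r x $ (N - 1) \<in> O2" by (simp only: index_vec[OF N1])
    then obtain t where t: "?r x $ (N - 1) = to_fract t" by (elim O2_E)
    have v: "vpoly (?C *\<^sub>v ?r x) = pCons 0 (vpoly (?r x)) - smult (to_fract t) K"
      using vpoly_companion[OF rc K_monic(1) N(2,1)] unfolding t .
    \<comment> \<open>The shift negates the value at -1 while the first coordinate has to stay
      fixed. The difference c / w is integral since w is a unit, and goes into the free
      part.\<close>
    let ?c = "- c + 2 * (t * ((- 1) ^ m * (2 ^ j * w)))"
    let ?a = "a + c * w' - t * ((- 1) ^ m * 2 ^ j)"
    have 1: "poly (vpoly (?r (?T *\<^sub>v x))) (- 1) = 2 ^ j * to_fract ?c"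
      unfolding Tx(2)[OF xc] v poly_diff poly_smult K_eval poly_pCons h(1) p2' four by (simp add: algebra_simps)
    have 2: "(?T *\<^sub>v x) $ 0 = to_fract ?c / (2 * to_fract w) + to_fract ?a"
      unfolding Tx(1)[OF xc] h(2) using w0 by (simp add: w'F field_simps)
    have "coeff (vpoly (?C *\<^sub>v ?r x)) k \<in> O2" for k
    proof -
      have "coeff K k = to_fract (coeff ([:- 1, 1:] * P) k)"
        using arg_cong[OF fract_poly_mult[of "[:- 1, 1:]" P], of "\<lambda>p. coeff p k"] by (simp add: map_poly_pCons coeff_map_poly)
      then have "coeff K k \<in> O2" by (metis to_fract_in_O2)
      then show ?thesis unfolding v using iv[OF x] by (auto simp: coeff_pCons simp del: mult_pCons_left split: nat.split)
    qed
    then have "(?T *\<^sub>v x) $ Suc k \<in> O2" if "k < N" for k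
    proof -
      have "(?T *\<^sub>v x) $ Suc k = ?r (?T *\<^sub>v x) $ k" using that by simp
      also have "\<dots> = coeff (vpoly (?C *\<^sub>v ?r x)) k" unfolding Tx(2)[OF xc] using that by (simp add: coeff_vpoly)
      finally show ?thesis using \<open>\<And>k. coeff (vpoly (?C *\<^sub>v ?r x)) k \<in> O2\<close> by simp
    qed
    moreover have "?T *\<^sub>v x \<in> carrier_vec (Suc N)" by (intro carrier_vecI) simp
    ultimately show ?thesis unfolding M_def using 1 2 by blast
  qed
  \<comment> \<open>The vector adjoined, the constant \<open>2 ^ j\<close> with its coordinate 1 /
    (2 w), and sums of neighbouring monomials, which vanish at -1.\<close>
  define Q where "Q = mat (Suc N) (Suc N) (\<lambda>(k, l). if l = 0 then if k = 0 then 1 else 0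
    else if l = 1 then if k = 0 then 1 / (2 * to_fract w) else if k = 1 then 2 ^ j else 0
    else if k = l \<or> Suc k = l then 1 else 0)"
  have Q: "Q \<in> carrier_mat (Suc N) (Suc N)" by (simp add: Q_def)
  have basis: "col Q l \<in> M" if l: "l < Suc N" for l
  proof -
    have vr: "vpoly (?r (col Q l)) = (if l = 0 then 0 else if l = 1 then [:2 ^ j:] else monom 1 (l - 2) + monom 1 (l - 1))"
      using l by (intro poly_eqI) (auto simp: coeff_vpoly Q_def coeff_pCons split: nat.split)
    have "\<exists>y a. poly (vpoly (?r (col Q l))) (- 1) = 2 ^ j * to_fract y
        \<and> col Q l $ 0 = to_fract y / (2 * to_fract w) + to_fract a"
    proof -
      consider "l = 0" | "l = 1" | k where "l = Suc (Suc k)" by (metis One_nat_def not0_implies_Suc)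
      then show ?thesis
      proof cases
        case 1
        then show ?thesis unfolding vr by (intro exI[of _ 0] exI[of _ 1]) (simp add: Q_def)
      next
        case 2
        then show ?thesis unfolding vr using l by (intro exI[of _ 1] exI[of _ 0]) (simp add: Q_def)
      next
        case (3 k)
        then show ?thesis unfolding vr using l by (intro exI[of _ 0]) (simp add: Q_def poly_monom)
      qed
    qed
    moreover have "col Q l $ Suc k \<in> O2" if "k < N" for k using l that by (auto simp: Q_def)
    moreover have "col Q l \<in> carrier_vec (Suc N)" using Q l by (intro carrier_vecI) simp
    ultimately show ?thesis unfolding M_def by blast
  qed
  have detQ: "det Q = 2 ^ j"
  proof -
    obtain e where e: "N = Suc e" using N by (cases N) auto
    have "upper_triangular Q" by (auto simp: upper_triangular_def Q_def)
    then have "det Q = prod_list (diag_mat Q)" using det_upper_triangular Q by blast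
    also have "diag_mat Q = map (\<lambda>l. if l = 1 then 2 ^ j else 1) [0..<Suc N]"
      by (auto simp: diag_mat_def Q_def)
    also have "[0..<Suc N] = 0 # 1 # [2..<Suc N]" unfolding e by (simp add: upt_conv_Cons numeral_2_eq_2)
    also have "prod_list (map (\<lambda>l. if l = 1 then 2 ^ j else 1) (0 # 1 # [2..<Suc N])) = (2 ^ j :: q2)"
    proof -
      have "map (\<lambda>l. if l = 1 then 2 ^ j else (1 :: q2)) [2..<Suc N] = map (\<lambda>_. 1) [2..<Suc N]" by (intro map_cong) auto
      then show ?thesis by (simp add: map_replicate_const del: upt_Suc)
    qed
    finally show ?thesis .
  qed
  have "det ?W = - 2 * to_fract w" by (subst det_single) auto
  then have "det ?G = (- 2 * to_fract w) * ((- 1) ^ m / (2 * p2))"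
    using det_four_block_mat_lower_left_zero[OF Wc zero_carrier_mat refl Gc] det_b1[folded N_def] by simp
  then have detG: "det ?G = (- 1) ^ Suc m / 4 ^ j" unfolding p2' using w0 by (simp add: field_simps)
  have iso: "transpose_mat ?T * ?G * ?T = ?G"
  proof -
    have Ct: "transpose_mat ?C \<in> carrier_mat N N" by simp
    have "transpose_mat ?T * ?G * ?T
      = four_block_mat (1\<^sub>m 1 * ?W * 1\<^sub>m 1) (0\<^sub>m 1 N) (0\<^sub>m N 1) (transpose_mat ?C * gram_poly N b1 * ?C)"
      unfolding block_diag_transpose[OF one_carrier_mat Cc] transpose_one block_diag_mult[OF one_carrier_mat Ct Wc Gc]
        block_diag_mult[OF mult_carrier_mat[OF one_carrier_mat Wc] mult_carrier_mat[OF Ct Gc] one_carrier_mat Cc] ..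
    also have "transpose_mat ?C * gram_poly N b1 * ?C = gram_poly N b1"
      by (rule b1.companion_isometry[OF K_monic(1) N(2,1)]) (rule b1_K)
    also have "1\<^sub>m 1 * ?W * 1\<^sub>m 1 = ?W" by simp
    finally show ?thesis .
  qed
  have sym: "transpose_mat ?G = ?G"
  proof -
    have "transpose_mat ?W = ?W" by (intro eq_matI) auto
    then show ?thesis unfolding block_diag_transpose[OF Wc Gc] b1.gram_poly_sym by simp
  qed
  have cp: "char_poly ?T = map_poly to_fract ([:- 1, 1:] * ([:- 1, 1:] * P))"
  proof -
    have "char_poly (1\<^sub>m 1 :: q2 mat) = [:- 1, 1:]"
      unfolding char_poly_def by (subst det_single) (auto simp: char_poly_matrix_def)
    then have "char_poly ?T = [:- 1, 1:] * K"
      using char_poly_four_block[OF one_carrier_mat Cc] separable_companion(2)[OF sep K_monic(1) N(2)] by simp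
    also have "\<dots> = map_poly to_fract ([:- 1, 1:] * ([:- 1, 1:] * P))"
      by (simp only: fract_poly_mult) (simp add: map_poly_pCons del: mult_pCons_left)
    finally show ?thesis .
  qed
  have diag: "diagonalizable ?T"
  proof (rule diagonalizable_four_block[OF one_carrier_mat Cc])
    have "diagonal_mat (map_mat to_ac (1\<^sub>m 1 :: q2 mat))" by (auto simp: diagonal_mat_def)
    then show "diagonalizable (1\<^sub>m 1)" unfolding diagonalizable_def
      using similar_mat_refl[of "map_mat to_ac (1\<^sub>m 1 :: q2 mat)" 1] by auto
    show "diagonalizable ?C" by (rule separable_companion(1)[OF sep K_monic(1) N(2)])
  qed
  show ?thesis
  proof (rule realizable_by_basis[of ?G "Suc m" ?T Q M "inverse (2 ^ j)" "(- 1) ^ Suc m", unfolded dN])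
    show "?G \<in> carrier_mat (Suc N) (Suc N)" "?T \<in> carrier_mat (Suc N) (Suc N)"
      using four_block_carrier_mat[OF Wc Gc] four_block_carrier_mat[OF one_carrier_mat Cc, of 1] by simp_all
    have pm: "(- 1) ^ k * ((- 1) ^ k / x) = inverse x" for k and x :: q2
      by (cases "even k") (simp_all add: inverse_eq_divide)
    show "(- 1) ^ Suc m * det ?G = (inverse (2 ^ j))\<^sup>2"
      unfolding detG pm four by (simp add: power2_eq_square)
    show "det Q * det Q * det ?G = to_fract ((- 1) ^ Suc m)"
      unfolding detG detQ four by simp
    show "(- 1 :: z2) ^ Suc m dvd 1" by (cases "even m") auto
  qed (use int even stable basis Q sym iso cp diag in simp_all)
qed

end

section \<open>Factorization\<close>

lemma clear_denominator: "\<exists>a h0. smult (2 ^ a) h = map_poly to_fract (h0 :: z2 poly)"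
proof (induction h)
  case 0
  show ?case by (intro exI[of _ 0]) simp
next
  case (pCons x h)
  obtain a h0 where a: "smult (2 ^ a) h = map_poly to_fract h0" using pCons.IH by blast
  obtain b y where b: "2 ^ b * x = to_fract y"
  proof (cases "x = 0")
    case True
    then show ?thesis using that[of 0 0] by simp
  next
    case False
    then obtain u k l where "x = to_fract u * 2 ^ k / 2 ^ l" by (rule q2_factor)
    then have "2 ^ l * x = to_fract (u * 2 ^ k)" by simp
    then show ?thesis by (rule that)
  qed
  have "smult (2 ^ (a + b)) (pCons x h) = pCons (2 ^ a * (2 ^ b * x)) (smult (2 ^ b) (smult (2 ^ a) h))"
    by (simp add: power_add ac_simps)
  also have "\<dots> = map_poly to_fract (pCons (2 ^ a * y) (smult (2 ^ b) h0))"
    unfolding a b by (rule poly_eqI) (simp add: coeff_pCons coeff_map_poly split: nat.split)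
  finally show ?case by blast
qed

text \<open>Gauss' lemma for monic factors, by clearing denominators with the least powers of 2.\<close>

lemma monic_factors_integral:
  assumes F: "map_poly to_fract F = h * k" and monic: "lead_coeff h = 1" "lead_coeff k = 1"
  obtains H K :: "z2 poly" where "h = map_poly to_fract H" "k = map_poly to_fract K" "F = H * K"
proof -
  define D where "D g a \<longleftrightarrow> (\<exists>g0 :: z2 poly. smult (2 ^ a) g = map_poly to_fract g0)" for g a
  have ex: "\<exists>a. D g a" for g unfolding D_def using clear_denominator by blast
  define a b where "a = (LEAST a. D h a)" and "b = (LEAST b. D k b)"
  have ab: "D h a" "D k b" unfolding a_def b_def using LeastI_ex[OF ex] by blast+
  have low: "n < a \<Longrightarrow> \<not> D h n" "n < b \<Longrightarrow> \<not> D k n" for n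
    unfolding a_def b_def using not_less_Least by blast+
  obtain h0 where h0: "smult (2 ^ a) h = map_poly to_fract h0" using ab(1) D_def by blast
  obtain k0 where k0: "smult (2 ^ b) k = map_poly to_fract k0" using ab(2) D_def by blast
  \<comment> \<open>Divisibility by 2 would allow a smaller exponent; for exponent 0 it would make
    the leading coefficient 1 even.\<close>
  have ndvd: "\<not> [:2:] dvd g0" if g: "smult (2 ^ c) g = map_poly to_fract g0" "lead_coeff g = 1"
    "\<And>n. n < c \<Longrightarrow> \<not> D g n" for g and g0 :: "z2 poly" and c
  proof
    assume "[:2:] dvd g0"
    then obtain g1 where g1: "g0 = smult 2 g1" by (auto elim: dvdE)
    show False
    proof (cases c)
      case 0
      have "g = map_poly to_fract g0" using g(1) 0 by simp
      then have "lead_coeff g0 = 1" using g(2) by simp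
      then have "(2 :: z2) * lead_coeff g1 = 1" unfolding g1 by simp
      then have "(2 :: z2) dvd 1" by (metis dvd_triv_left)
      then show False using prime_elem_2_z2 prime_elem_not_unit by blast
    next
      case (Suc n)
      have "smult 2 (smult (2 ^ n) g) = smult 2 (map_poly to_fract g1)"
        using g(1) unfolding Suc g1 by simp
      from arg_cong[OF this, of "smult (1 / 2)"]
      have "smult (2 ^ n) g = map_poly to_fract g1" by simp
      then show False using g(3)[of n] Suc unfolding D_def by blast
    qed
  qed
  have prod: "h0 * k0 = smult (2 ^ (a + b)) F"
  proof -
    have "map_poly to_fract (h0 * k0) = smult (2 ^ a) h * smult (2 ^ b) k" by (simp add: h0 k0)
    also have "\<dots> = map_poly to_fract (smult (2 ^ (a + b)) F)" by (simp add: F power_add mult.commute)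
    finally show ?thesis unfolding fract_poly_eq_iff .
  qed
  have pr: "prime_elem [:2 :: z2:]" by (rule lift_prime_elem_poly[OF prime_elem_2_z2])
  have "a + b = 0"
  proof (rule ccontr)
    assume "a + b \<noteq> 0"
    then obtain n where "a + b = Suc n" using not0_implies_Suc by blast
    then have "h0 * k0 = [:2:] * smult (2 ^ n) F" unfolding prod by (simp add: mult.commute)
    then have "[:2:] dvd h0 * k0" by (metis dvd_triv_left)
    then show False using prime_elem_dvd_multD[OF pr] ndvd[OF h0 monic(1) low(1)] ndvd[OF k0 monic(2) low(2)] by blast
  qed
  then have "h = map_poly to_fract h0" "k = map_poly to_fract k0" "F = h0 * k0"
    using h0 k0 prod by simp_all
  then show thesis by (rule that)
qed

lemma irreducible_factor_exists:
  fixes p :: "'a :: field poly"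
  assumes "degree p > 0"
  shows "\<exists>h. irreducible h \<and> h dvd p"
  using assms
proof (induction "degree p" arbitrary: p rule: less_induct)
  case less
  show ?case
  proof (cases "irreducible p")
    case False
    have "p \<noteq> 0" "\<not> p dvd 1" using less.prems by (auto simp: is_unit_iff_degree)
    then obtain q r where qr: "p = q * r" "\<not> q dvd 1" "\<not> r dvd 1"
      using False unfolding irreducible_def by blast
    have nz: "q \<noteq> 0" "r \<noteq> 0" using qr \<open>p \<noteq> 0\<close> by auto
    have "degree q > 0" "degree r > 0" using qr nz by (auto simp: is_unit_iff_degree)
    moreover have "degree p = degree q + degree r" unfolding qr using nz by (rule degree_mult_eq)
    ultimately obtain h where "irreducible h" "h dvd q" using less.hyps[of q] by auto
    then show ?thesis using qr by (auto intro: dvd_mult2)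
  qed auto
qed

lemma common_divisor_bezout:
  fixes p q :: "'a :: field poly"
  assumes "p \<noteq> 0"
  shows "\<exists>u v d. d = u * p + v * q \<and> d dvd p \<and> d dvd q \<and> d \<noteq> 0"
proof -
  define I where "I = {u * p + v * q | u v. True} - {0}"
  have "p \<in> I" using assms unfolding I_def by (auto intro: exI[of _ 1] exI[of _ 0])
  define d where "d = arg_min degree (\<lambda>x. x \<in> I)"
  have d: "d \<in> I" "\<And>x. x \<in> I \<Longrightarrow> degree d \<le> degree x"
    unfolding d_def using arg_min_natI[of "\<lambda>x. x \<in> I", OF \<open>p \<in> I\<close>] arg_min_nat_le[of "\<lambda>x. x \<in> I"] by blast+
  obtain u v where uv: "d = u * p + v * q" using d(1) unfolding I_def by blast
  have d0: "d \<noteq> 0" using d(1) by (simp add: I_def)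
  have dvd: "d dvd x * p + y * q" for x y
  proof (rule ccontr)
    let ?z = "x * p + y * q"
    assume "\<not> d dvd ?z"
    then have nz: "?z mod d \<noteq> 0" by (simp add: dvd_eq_mod_eq_0)
    obtain s where s: "?z div d = s" by blast
    have "?z mod d = ?z - s * d" unfolding s[symmetric] by (simp add: minus_div_mult_eq_mod)
    also have "\<dots> = (x - s * u) * p + (y - s * v) * q"
      unfolding uv by (simp add: algebra_simps)
    finally have "?z mod d \<in> I" using nz unfolding I_def by blast
    then have "degree d \<le> degree (?z mod d)" by (rule d(2))
    then show False using degree_mod_less'[OF d0 nz] by simp
  qed
  show ?thesis using uv d0 dvd[of 1 0] dvd[of 0 1] by auto
qed

lemma irreducible_smult:
  fixes g :: "'a :: field poly"
  assumes "irreducible g" "c \<noteq> 0"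
  shows "irreducible (smult c g)"
proof (rule irreducibleI)
  show "smult c g \<noteq> 0" using assms by auto
  have "\<not> g dvd 1" using assms(1) unfolding irreducible_def by blast
  then show "\<not> smult c g dvd 1" unfolding smult_dvd_iff using assms(2) by (simp only: if_False not_False_eq_True)
  fix a b assume "smult c g = a * b"
  then have "g = smult (inverse c) a * b"
    using assms(2) by (metis mult_smult_left right_inverse left_inverse smult_1_left smult_smult)
  then have "smult (inverse c) a dvd 1 \<or> b dvd 1" using assms(1) by (metis irreducibleD)
  then show "a dvd 1 \<or> b dvd 1" using assms(2) by (simp add: smult_dvd_iff)
qed

lemma irreducible_imp_prime_field:
  fixes h :: "'a :: field poly"
  assumes h: "irreducible h"
  shows "prime_elem h"
proof (rule prime_elemI)
  show h0: "h \<noteq> 0" and nu: "\<not> h dvd 1" using h by (auto simp: irreducible_def)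
  fix a b assume ab: "h dvd a * b"
  show "h dvd a \<or> h dvd b"
  proof (cases "h dvd a")
    case False
    obtain u v d where d: "d = u * h + v * a" "d dvd h" "d dvd a"
      using common_divisor_bezout[OF h0] by blast
    obtain k where k: "h = d * k" using d(2) by (elim dvdE)
    have "\<not> k dvd 1"
    proof
      assume "k dvd 1"
      then obtain k' where "1 = k * k'" by (elim dvdE)
      then have "d = h * k'" using k by (metis mult.assoc mult.right_neutral)
      then show False using d(3) False by (metis dvd_mult_left)
    qed
    then have "d dvd 1" using irreducibleD[OF h k] by blast
    then obtain e where e: "1 = d * e" by (elim dvdE)
    have "d * b = h * (u * b) + v * (a * b)" unfolding d(1) by (simp add: algebra_simps)
    then have "h dvd d * b" using ab by (metis dvd_add dvd_mult dvd_triv_left)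
    then have "h dvd e * (d * b)" by (rule dvd_mult)
    moreover have "e * (d * b) = (d * e) * b" by (simp only: ac_simps)
    ultimately show ?thesis unfolding e[symmetric] by simp
  qed simp
qed

text \<open>Let h be an irreducible common factor of p = h q and its derivative. Then h divides q
  h', but in characteristic 0 it does not divide h', so it divides q.\<close>

lemma not_separable_square_factor:
  fixes p :: "'a :: field_char_0 poly"
  assumes p: "p \<noteq> 0" and ns: "\<not> separable p"
  shows "\<exists>h. irreducible h \<and> lead_coeff h = 1 \<and> h * h dvd p"
proof -
  obtain u v d where d: "d = u * p + v * pderiv p" "d dvd p" "d dvd pderiv p" "d \<noteq> 0"
    using common_divisor_bezout[OF p] by blast
  have "degree d \<noteq> 0"
  proof
    assume "degree d = 0"
    then obtain c where c: "d = [:c:]" by (rule degree_eq_zeroE)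
    then have "c \<noteq> 0" using d(4) by simp
    then have "smult (inverse c) d = 1" using c by (simp add: one_pCons)
    then have "(smult (inverse c) u) * p + (smult (inverse c) v) * pderiv p = 1"
      unfolding d(1) by (simp only: smult_add_right mult_smult_left)
    then show False using ns unfolding separable_def by blast
  qed
  then obtain g where g: "irreducible g" "g dvd d" using irreducible_factor_exists[of d] by auto
  then have g0: "g \<noteq> 0" by auto
  define h where "h = smult (inverse (lead_coeff g)) g"
  have hg: "h dvd g" unfolding h_def using g0 by (simp add: smult_dvd_iff)
  have "irreducible h" unfolding h_def using g0 by (intro irreducible_smult g(1)) simp
  then have pr: "prime_elem h" by (rule irreducible_imp_prime_field)
  have lead: "lead_coeff h = 1" unfolding h_def using g0 by simp
  have hp: "h dvd p" "h dvd pderiv p" using hg g(2) d(2,3) by (meson dvd_trans)+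
  obtain q where q: "p = h * q" using hp(1) by (elim dvdE)
  have "h dvd h * pderiv q + q * pderiv h" using hp(2) unfolding q pderiv_mult .
  then have "h dvd q * pderiv h" by (metis dvd_add_right_iff dvd_triv_left)
  moreover have "\<not> h dvd pderiv h"
  proof
    assume "h dvd pderiv h"
    have "degree h \<noteq> 0" using \<open>irreducible h\<close> by (metis irreducible_def is_unit_iff_degree)
    then have "pderiv h \<noteq> 0" by (simp add: pderiv_eq_0_iff)
    then have "degree h \<le> degree (pderiv h)" using \<open>h dvd pderiv h\<close> by (simp add: dvd_imp_degree_le)
    then show False using \<open>degree h \<noteq> 0\<close> by (simp add: degree_pderiv)
  qed
  ultimately have "h dvd q" using prime_elem_dvd_multD[OF pr] by blast
  then have "h * h dvd p" unfolding q by (rule mult_dvd_mono[OF dvd_refl])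
  then show ?thesis using \<open>irreducible h\<close> lead by blast
qed

lemma irreducible_separable:
  fixes h :: "'a :: field_char_0 poly"
  assumes "irreducible h"
  shows "separable h"
proof (rule ccontr)
  assume "\<not> separable h"
  moreover have "h \<noteq> 0" using assms by auto
  ultimately obtain g where g: "irreducible g" "g * g dvd h" using not_separable_square_factor by blast
  then obtain k where "h = g * (g * k)" by (auto elim!: dvdE simp: mult.assoc)
  then have "g dvd 1 \<or> g * k dvd 1" using assms by (metis irreducibleD)
  then have "g dvd 1" by (metis dvd_mult_left)
  then show False using g(1) by (simp add: irreducible_def)
qed

section \<open>Sufficiency\<close>

text \<open>Star-symmetry without inverses; the sign is F(0) and is multiplicative, so it can be
  followed through quotients.\<close>

definition star_sign :: "z2 \<Rightarrow> z2 poly \<Rightarrow> bool" where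
  "star_sign \<sigma> F \<longleftrightarrow> (\<sigma> = 1 \<or> \<sigma> = - 1) \<and> lead_coeff F = 1 \<and> reflect_poly F = smult \<sigma> F"

lemma star_signD:
  assumes "star_sign \<sigma> F"
  shows "\<sigma> * \<sigma> = 1" "lead_coeff F = 1" "reflect_poly F = smult \<sigma> F" "F \<noteq> 0" "poly F 0 = \<sigma>" "poly F 0 dvd 1"
    "poly F 1 = \<sigma> * poly F 1" "(- 1) ^ degree F * poly F (- 1) = \<sigma> * poly F (- 1)"
proof -
  show s: "\<sigma> * \<sigma> = 1" and l: "lead_coeff F = 1" and r: "reflect_poly F = smult \<sigma> F" and "F \<noteq> 0"
    using assms unfolding star_sign_def by auto
  have "coeff (reflect_poly F) 0 = 1" using l by (simp add: coeff_reflect_poly)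
  then have "\<sigma> * (\<sigma> * poly F 0) = \<sigma>" unfolding r by (simp add: poly_0_coeff_0)
  then show 0: "poly F 0 = \<sigma>" using s by (simp add: mult.assoc[symmetric])
  show "poly F 0 dvd 1" unfolding 0 using s by (metis dvd_triv_left)
  let ?F = "map_poly to_fract F"
  have R: "reflect_poly ?F = map_poly to_fract (reflect_poly F)"
    by (intro poly_eqI) (auto simp: coeff_reflect_poly)
  have e1: "poly ?F 1 = to_fract (poly F 1)" "poly ?F (- 1) = to_fract (poly F (- 1))"
    using poly_map_to_fract[of F 1] poly_map_to_fract[of F "- 1"] by simp_all
  have "poly (reflect_poly ?F) 1 = to_fract \<sigma> * poly ?F 1" unfolding R r by simp
  moreover have "poly (reflect_poly ?F) 1 = poly ?F 1" by (simp add: poly_reflect_poly_nz)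
  ultimately have "to_fract (poly F 1) = to_fract (\<sigma> * poly F 1)" unfolding e1 by simp
  then show "poly F 1 = \<sigma> * poly F 1" unfolding to_fract_eq_iff .
  have "poly (reflect_poly ?F) (- 1) = to_fract \<sigma> * poly ?F (- 1)" unfolding R r by simp
  moreover have "poly (reflect_poly ?F) (- 1) = (- 1) ^ degree F * poly ?F (- 1)"
    using poly_reflect_poly_nz[of "- 1" ?F] by simp
  ultimately have "to_fract ((- 1) ^ degree F * poly F (- 1)) = to_fract (\<sigma> * poly F (- 1))" unfolding e1 by simp
  then show "(- 1) ^ degree F * poly F (- 1) = \<sigma> * poly F (- 1)" unfolding to_fract_eq_iff .
qed

lemma z2_self_minus: "x = - x \<Longrightarrow> x = (0 :: z2)"
proof -
  assume "x = - x"
  then have "x + x = 0" by (metis add.right_inverse)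
  then have "2 * x = 0" by (simp only: mult_2)
  then show ?thesis using two_neq_0 by simp
qed

text \<open>The symmetry at 1 and -1 makes the values equal to their negatives. Hence (a) and (b)
  are vacuous for the sign -1 in even degree.\<close>

lemma star_sign_minus_zero:
  assumes "star_sign (- 1) F"
  shows "poly F 1 = 0" "even (degree F) \<Longrightarrow> poly F (- 1) = 0"
  using star_signD(7,8)[OF assms] by (auto intro: z2_self_minus)

lemma star_sign_quotient:
  assumes "star_sign \<sigma> (A * K)" "star_sign \<tau> A"
  shows "star_sign (\<sigma> * \<tau>) K" "degree (A * K) = degree A + degree K"
proof -
  note a = star_signD[OF assms(1)] and t = star_signD[OF assms(2)]
  have nz: "A \<noteq> 0" "K \<noteq> 0" using a(4) by auto
  have "lead_coeff K = 1" using a(2) t(2) unfolding lead_coeff_mult by simp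
  moreover have "smult \<tau> A * reflect_poly K = smult \<sigma> (A * K)"
    using a(3) unfolding reflect_poly_mult t(3) .
  then have "A * smult \<tau> (reflect_poly K) = A * smult \<sigma> K" by simp
  then have "smult \<tau> (reflect_poly K) = smult \<sigma> K" unfolding mult_cancel_left using nz(1) by blast
  from arg_cong[OF this, of "smult \<tau>"] have "reflect_poly K = smult (\<sigma> * \<tau>) K"
    using t(1) by (simp add: mult.commute)
  moreover have "\<sigma> * \<tau> = 1 \<or> \<sigma> * \<tau> = - 1"
    using assms unfolding star_sign_def by auto
  ultimately show "star_sign (\<sigma> * \<tau>) K" unfolding star_sign_def by blast
  show "degree (A * K) = degree A + degree K" by (rule degree_mult_eq[OF nz])
qed

lemma star_sign_hyperbolic:
  assumes monic: "lead_coeff H = 1" and c: "c * poly H 0 = 1"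
  shows "star_sign 1 (H * smult c (reflect_poly H))" "degree (smult c (reflect_poly H)) = degree H"
    "lead_coeff (smult c (reflect_poly H)) = 1"
proof -
  have c0: "c \<noteq> 0" and h0: "coeff H 0 \<noteq> 0" using c by (auto simp: poly_0_coeff_0)
  show d: "degree (smult c (reflect_poly H)) = degree H" using c0 h0 by simp
  then show l: "lead_coeff (smult c (reflect_poly H)) = 1"
    using c h0 by (simp add: coeff_reflect_poly poly_0_coeff_0)
  have "reflect_poly (H * smult c (reflect_poly H)) = H * smult c (reflect_poly H)"
    using h0 by (simp add: reflect_poly_mult reflect_poly_smult mult.commute)
  then show "star_sign 1 (H * smult c (reflect_poly H))"
    unfolding star_sign_def lead_coeff_mult l using monic by simp
qed

lemma poly_reflect_z2:
  "poly (reflect_poly H) 1 = poly (H :: z2 poly) 1"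
  "poly (reflect_poly H) (- 1) = (- 1) ^ degree H * poly H (- 1)"
proof -
  let ?F = "map_poly to_fract H"
  have R: "reflect_poly ?F = map_poly to_fract (reflect_poly H)"
    by (intro poly_eqI) (auto simp: coeff_reflect_poly)
  have e: "poly (map_poly to_fract p) 1 = to_fract (poly p 1)" "poly (map_poly to_fract p) (- 1) = to_fract (poly p (- 1))"
    for p :: "z2 poly"
    using poly_map_to_fract[of p 1] poly_map_to_fract[of p "- 1"] by simp_all
  have "to_fract (poly (reflect_poly H) 1) = to_fract (poly H 1)"
    using poly_reflect_poly_nz[of 1 ?F] unfolding R e by simp
  then show "poly (reflect_poly H) 1 = poly H 1" unfolding to_fract_eq_iff .
  have "to_fract (poly (reflect_poly H) (- 1)) = to_fract ((- 1) ^ degree H * poly H (- 1))"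
    using poly_reflect_poly_nz[of "- 1" ?F] unfolding R e by (simp add: e)
  then show "poly (reflect_poly H) (- 1) = (- 1) ^ degree H * poly H (- 1)" unfolding to_fract_eq_iff .
qed

section \<open>Conditions (a) and (b) under removal of hyperbolic factors\<close>

definition admissible :: "nat \<Rightarrow> z2 poly \<Rightarrow> bool" where
  "admissible n F \<longleftrightarrow> even (v2 (poly F 1)) \<and> even (v2 (poly F (- 1))) \<and>
    (poly F 1 * poly F (- 1) \<noteq> 0 \<longrightarrow> (\<exists>t. to_fract ((- 1) ^ n * poly F 1 * poly F (- 1)) = t\<^sup>2))"

lemma v2_mult:
  assumes "x \<noteq> 0" "y \<noteq> 0"
  shows "v2 (x * y) = v2 x + v2 y"
proof -
  obtain k u where k: "u dvd 1" "x = 2 ^ k * u" using assms(1) by (rule z2_factor)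
  obtain l w where l: "w dvd 1" "y = 2 ^ l * w" using assms(2) by (rule z2_factor)
  have "x * y = 2 ^ (k + l) * (u * w)" unfolding k l by (simp add: power_add)
  moreover have "u * w dvd 1" using k(1) l(1) by (simp add: is_unit_mult_iff)
  ultimately have "v2 (x * y) = k + l" by (simp only: v2_pow2_times_unit)
  moreover have "v2 x = k" "v2 y = l" unfolding k(2) l(2) using k(1) l(1) by (simp_all only: v2_pow2_times_unit)
  ultimately show ?thesis by simp
qed

lemma v2_unit: "u dvd 1 \<Longrightarrow> v2 u = 0"
  using v2_pow2_times_unit[of u 0] by simp

lemma even_v2_square_mult:
  assumes "x = 0 \<longrightarrow> z = 0" "u dvd 1" "even (v2 (u * (x * x) * z))"
  shows "even (v2 z)"
proof (cases "z = 0")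
  case True
  then show ?thesis by (simp add: v2_def)
next
  case False
  then have "x \<noteq> 0" "u \<noteq> 0" using assms by auto
  then show ?thesis using assms(3) False v2_unit[OF assms(2)] by (simp add: v2_mult)
qed

text \<open>At 1 and -1 the factor H H* takes values that are units times squares, and the product
  of the two units is (-1)^(degree H) times a square, which matches the change of n. If H vanishes
  at 1 or -1, the value of F there carries no information about K, hence the two guards.\<close>

lemma admissible_strip:
  assumes F: "F = (H * smult c (reflect_poly H)) * K" and c: "c * poly H 0 = 1"
    and z: "poly H 1 = 0 \<longrightarrow> poly K 1 = 0" "poly H (- 1) = 0 \<longrightarrow> poly K (- 1) = 0"
    and adm: "admissible (degree H + n) F"
  shows "admissible n K"
proof -
  let ?s = "(- 1 :: z2) ^ degree H"
  have cu: "c dvd 1" using c by (metis dvd_triv_left)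
  have su: "?s dvd 1" by (cases "even (degree H)") auto
  have F1: "poly F 1 = c * (poly H 1 * poly H 1) * poly K 1"
    unfolding F by (simp add: poly_reflect_z2 ac_simps)
  have Fm1: "poly F (- 1) = (?s * c) * (poly H (- 1) * poly H (- 1)) * poly K (- 1)"
    unfolding F by (simp add: poly_reflect_z2 ac_simps)
  have "even (v2 (poly K 1))"
    by (rule even_v2_square_mult[OF z(1) cu]) (use adm in \<open>simp only: admissible_def F1\<close>)
  moreover have "even (v2 (poly K (- 1)))"
    by (rule even_v2_square_mult[OF z(2), of "?s * c"]) (use adm cu su in \<open>simp_all only: admissible_def Fm1 is_unit_mult_iff simp_thms\<close>)
  moreover have "\<exists>t. to_fract ((- 1) ^ n * poly K 1 * poly K (- 1)) = t\<^sup>2" if nz: "poly K 1 * poly K (- 1) \<noteq> 0"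
  proof -
    have h: "poly H 1 \<noteq> 0" "poly H (- 1) \<noteq> 0" using z nz by auto
    let ?q = "c * poly H 1 * poly H (- 1)"
    have q0: "?q \<noteq> 0" using h cu by auto
    have "poly F 1 * poly F (- 1) \<noteq> 0" unfolding F1 Fm1 using h nz cu su by auto
    then obtain t where t: "to_fract ((- 1) ^ (degree H + n) * poly F 1 * poly F (- 1)) = t\<^sup>2"
      using adm unfolding admissible_def by blast
    have "(- 1) ^ (degree H + n) * poly F 1 * poly F (- 1) = (?s * ?s) * ((?q * ?q) * ((- 1) ^ n * poly K 1 * poly K (- 1)))"
      unfolding F1 Fm1 by (simp add: power_add ac_simps)
    also have "?s * ?s = 1" by (cases "even (degree H)") auto
    finally have "to_fract (?q * ?q) * to_fract ((- 1) ^ n * poly K 1 * poly K (- 1)) = t\<^sup>2"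
      using t by (simp only: mult_1 to_fract_mult)
    then have "to_fract ((- 1) ^ n * poly K 1 * poly K (- 1)) = t\<^sup>2 / to_fract (?q * ?q)"
      using q0 by (simp add: eq_divide_eq mult.commute del: to_fract_mult)
    also have "\<dots> = (t / to_fract ?q)\<^sup>2" by (simp add: power2_eq_square)
    finally show ?thesis by blast
  qed
  ultimately show ?thesis unfolding admissible_def by blast
qed

lemma reflect_factor_irreducible:
  fixes h :: "'a :: field poly"
  assumes h: "irreducible h" and c: "c \<noteq> 0" and h0: "coeff h 0 \<noteq> 0"
  shows "irreducible (smult c (reflect_poly h))"
proof (rule irreducible_smult[OF _ c], rule irreducibleI)
  show "reflect_poly h \<noteq> 0" using h by auto
  have "\<not> h dvd 1" "h \<noteq> 0" using h by (auto simp: irreducible_def)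
  then show "\<not> reflect_poly h dvd 1" using h0 by (simp add: is_unit_iff_degree)
  fix a b assume ab: "reflect_poly h = a * b"
  have r0: "coeff (a * b) 0 \<noteq> 0" unfolding ab[symmetric] using \<open>h \<noteq> 0\<close> by (simp add: coeff_reflect_poly)
  then have ab0: "coeff a 0 \<noteq> 0" "coeff b 0 \<noteq> 0" "a \<noteq> 0" "b \<noteq> 0" by (auto simp: coeff_mult_0)
  have "h = reflect_poly a * reflect_poly b"
    using arg_cong[OF ab, of reflect_poly] h0 by (simp add: reflect_poly_mult)
  then have "reflect_poly a dvd 1 \<or> reflect_poly b dvd 1" using irreducibleD[OF h] by blast
  then show "a dvd 1 \<or> b dvd 1" using ab0 by (auto simp: is_unit_iff_degree)
qed

lemma degree_fract_poly: "degree (map_poly to_fract p) = degree p"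
  and lead_coeff_fract_poly: "lead_coeff (map_poly to_fract p) = to_fract (lead_coeff p)"
  by simp_all

text \<open>By symmetry the reflected factor h* divides F as well. If h* = h, the given square is h
  h*; otherwise h* is prime to h and divides the cofactor. Thus the square secures h h* even for a
  self-reciprocal h.\<close>

lemma square_factor_strip:
  assumes F: "star_sign \<sigma> F" and h: "irreducible h" "lead_coeff h = 1" "h * h dvd map_poly to_fract F"
  obtains H K c where "h = map_poly to_fract H" "lead_coeff H = 1" "c * poly H 0 = 1"
    "F = (H * smult c (reflect_poly H)) * K" "degree H > 0"
proof -
  note s = star_signD[OF F]
  let ?F = "map_poly to_fract F"
  have Fl: "lead_coeff ?F = 1" using s(2) by simp
  obtain k where "?F = h * h * k" using h(3) by (elim dvdE)
  then have k: "?F = h * (h * k)" by (simp only: mult.assoc)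
  have "lead_coeff (h * k) = 1" using Fl unfolding k lead_coeff_mult h(2) by simp
  obtain H K1 where HK: "h = map_poly to_fract H" "F = H * K1"
    using monic_factors_integral[OF k h(2) \<open>lead_coeff (h * k) = 1\<close>] by blast
  have Hl: "lead_coeff H = 1" using h(2) unfolding HK(1) by simp
  have "poly H 0 dvd poly F 0" unfolding HK(2) by simp
  then have "poly H 0 dvd 1" using s(6) dvd_trans by blast
  then obtain c where c: "c * poly H 0 = 1" by (metis dvdE mult.commute)
  have H0: "coeff H 0 \<noteq> 0" "c \<noteq> 0" using c by (auto simp: poly_0_coeff_0)
  have dH: "degree H > 0"
  proof -
    have "degree h \<noteq> 0" using h(1) by (metis irreducible_def is_unit_iff_degree)
    then show ?thesis unfolding HK(1) by simp
  qed
  let ?Hs = "smult c (reflect_poly H)" and ?hs = "map_poly to_fract (smult c (reflect_poly H))"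
  note hyp = star_sign_hyperbolic[OF Hl c]
  have hs: "?hs = smult (to_fract c) (reflect_poly h)"
    unfolding HK(1) by (intro poly_eqI) (auto simp: coeff_reflect_poly coeff_map_poly)
  have irr: "irreducible ?hs"
    unfolding hs by (rule reflect_factor_irreducible[OF h(1)]) (use H0 in \<open>simp_all add: HK(1)\<close>)
  have "?hs dvd ?F"
  proof -
    have "reflect_poly H dvd reflect_poly F" unfolding HK(2) reflect_poly_mult by simp
    then have "reflect_poly H dvd smult \<sigma> (reflect_poly F)" by (rule dvd_smult)
    also have "smult \<sigma> (reflect_poly F) = F" unfolding s(3) using s(1) by simp
    finally obtain w where "F = reflect_poly H * w" by (elim dvdE)
    then have "F = ?Hs * smult (poly H 0) w" using c by (simp add: mult.commute)
    then have "?Hs dvd F" by (metis dvd_triv_left)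
    then show ?thesis by (rule fract_poly_dvd)
  qed
  have lhs: "lead_coeff ?hs = 1" and dhs: "degree ?hs = degree h"
    using hyp(2,3) lead_coeff_fract_poly[of ?Hs] degree_fract_poly[of ?Hs] unfolding HK(1) by (simp_all only: to_fract_1 degree_fract_poly)
  have "\<exists>q. ?F = (h * ?hs) * q"
  proof (cases "?hs dvd h")
    case True
    then obtain r where r: "h = ?hs * r" by (elim dvdE)
    have "degree r = 0"
    proof -
      have "h \<noteq> 0" using h(2) by auto
      then have "?hs \<noteq> 0" "r \<noteq> 0" using r by auto
      then have "degree h = degree ?hs + degree r" using r degree_mult_eq by metis
      then show ?thesis using dhs by linarith
    qed
    moreover have "lead_coeff r = 1" using h(2) lhs r lead_coeff_mult[of ?hs r] by simp
    ultimately have "r = 1" by (metis degree_eq_zeroE lead_coeff_pCons(2) one_pCons)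
    then have "h = ?hs" using r by simp
    then show ?thesis using k by (metis mult.assoc)
  next
    case False
    have "?hs dvd k" using \<open>?hs dvd ?F\<close> False prime_elem_dvd_multD[OF irreducible_imp_prime_field[OF irr]] unfolding k by blast
    then obtain q where "k = ?hs * q" by (elim dvdE)
    then show ?thesis unfolding k by (intro exI[of _ "h * q"]) (simp only: ac_simps)
  qed
  then obtain q where q: "?F = (h * ?hs) * q" by blast
  have lA: "lead_coeff (h * ?hs) = 1" unfolding lead_coeff_mult h(2) lhs by simp
  have "lead_coeff q = 1" using Fl unfolding q lead_coeff_mult[of "h * ?hs"] lA by simp
  obtain A K where AK: "h * ?hs = map_poly to_fract A" "F = A * K"
    using monic_factors_integral[OF q lA \<open>lead_coeff q = 1\<close>] by blast
  have "map_poly to_fract A = map_poly to_fract (H * ?Hs)" unfolding AK(1)[symmetric] HK(1) by (simp only: fract_poly_mult)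
  then have "A = H * ?Hs" unfolding fract_poly_eq_iff .
  then show thesis using that[OF HK(1) Hl c _ dH, of K] AK(2) by simp
qed

text \<open>The induction hypothesis is passed as an assumption, so that the cases of the main
  induction can be separate lemmas.\<close>

lemma realizable_strip:
  assumes IH: "\<forall>K k \<tau>. k < n \<longrightarrow> star_sign \<tau> K \<longrightarrow> degree K = 2 * k \<longrightarrow> admissible k K \<longrightarrow> realizable K"
    and F: "star_sign \<sigma> F" "degree F = 2 * n" "admissible n F"
    and H: "F = (H * smult c (reflect_poly H)) * K" "lead_coeff H = 1" "c * poly H 0 = 1" "degree H > 0"
      "separable (map_poly to_fract H)"
    and z: "poly H 1 = 0 \<longrightarrow> poly K 1 = 0" "poly H (- 1) = 0 \<longrightarrow> poly K (- 1) = 0"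
  shows "realizable F"
proof -
  let ?A = "H * smult c (reflect_poly H)"
  note hyp = star_sign_hyperbolic[OF H(2,3)]
  have "H \<noteq> 0" "smult c (reflect_poly H) \<noteq> 0" using H(2) hyp(3) by auto
  from degree_mult_eq[OF this] have dA: "degree ?A = 2 * degree H" unfolding hyp(2) mult_2 .
  note K = star_sign_quotient[OF F(1)[unfolded H(1)] hyp(1)]
  have dK: "degree K = 2 * (n - degree H)" and nH: "degree H \<le> n"
    using K(2) F(2) unfolding dA H(1)[symmetric] by auto
  have "admissible (degree H + (n - degree H)) F" using F(3) nH by simp
  then have "admissible (n - degree H) K" by (rule admissible_strip[OF H(1,3) z])
  then have "realizable K" using IH[rule_format, OF _ K(1) dK] H(4) nH by simp
  then show ?thesis unfolding H(1)
    by (intro realizable_mult realizable_hyperbolic[OF H(2,5,3)])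
qed

section \<open>Base cases and the treatment of the roots 1 and -1\<close>

lemma realizable_one: "realizable 1"
proof -
  have "char_poly (1\<^sub>m 0 :: z2 mat) = 1" unfolding char_poly_def char_poly_matrix_def by (rule det_dim_zero) simp
  moreover have "diagonal_mat (map_mat to_ac (map_mat to_fract (1\<^sub>m 0 :: z2 mat)))" by (simp add: diagonal_mat_def)
  then have "semisimple (1\<^sub>m 0)" unfolding semisimple_iff diagonalizable_def
    using similar_mat_refl[of "map_mat to_ac (map_mat to_fract (1\<^sub>m 0 :: z2 mat))" 0] by auto
  ultimately show ?thesis unfolding realizable_def
    by (intro exI[of _ 0] exI[of _ "1\<^sub>m 0"]) (auto intro!: exI[of _ 1])
qed

lemma monic_degree_0: "lead_coeff F = 1 \<Longrightarrow> degree F = 0 \<Longrightarrow> F = (1 :: 'a :: comm_ring_1 poly)"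
  by (metis degree_eq_zeroE lead_coeff_pCons(2) one_pCons)

lemma toeplitz_star_sign:
  assumes "star_sign (- 1) F" "degree F = 2 * n" "n > 0"
  shows "toeplitz F n"
  using assms by unfold_locales (auto simp: star_sign_def)

lemma separable_linear: "separable [:a, 1 :: 'a :: field:]"
  unfolding separable_def by (intro exI[of _ 0] exI[of _ 1]) (simp add: pderiv_pCons one_pCons)

lemma realizable_X2_minus_1: "realizable [:- 1, 0, 1:]" "star_sign (- 1) [:- 1, 0, 1:]"
proof -
  show s: "star_sign (- 1) [:- 1, 0, 1:]" by (simp add: star_sign_def reflect_poly_def)
  interpret toeplitz "[:- 1, 0, 1:]" 1 by (rule toeplitz_star_sign[OF s]) simp_all
  have "[:- 1:] * [:- 1, 0, 1:] + [:0, 1 / 2:] * pderiv [:- 1, 0, 1 :: q2:] = 1"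
    by (simp add: pderiv_pCons one_pCons)
  moreover have "FQ = [:- 1, 0, 1:]" by (simp add: map_poly_pCons)
  ultimately have "separable FQ" unfolding separable_def by metis
  then show "realizable [:- 1, 0, 1:]" by (rule realizable_separable)
qed

lemma poly_root_factor:
  fixes F :: "z2 poly"
  assumes "poly F a = 0"
  obtains Q where "F = [:- a, 1:] * Q"
  using assms by (metis poly_eq_0_iff_dvd dvdE)

lemma star_sign_linear: "star_sign (- 1) [:- 1, 1:]"
  by (simp add: star_sign_def reflect_poly_def)

text \<open>For the sign 1 the root 1 is at least double: the cofactor of X - 1 has sign -1 and
  vanishes at 1 again. In F = (X - 1)^2 P the square can be stripped if P(1) = 0. Otherwise P(1) is
  unconstrained, and \<open>realizable_double_root\<close> takes over as soon as (X - 1) P is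
  separable.\<close>

lemma realizable_root_1:
  assumes IH: "\<forall>K k \<tau>. k < n \<longrightarrow> star_sign \<tau> K \<longrightarrow> degree K = 2 * k \<longrightarrow> admissible k K \<longrightarrow> realizable K"
    and F: "star_sign 1 F" "degree F = 2 * n" "admissible n F"
    and roots: "poly F 1 = 0" "poly F (- 1) \<noteq> 0"
  shows "realizable F"
proof -
  let ?L = "[:- 1, 1 :: z2:]"
  obtain Q where Q: "F = ?L * Q" using roots(1) by (rule poly_root_factor)
  have sQ: "star_sign (- 1) Q" "degree F = degree ?L + degree Q"
    using star_sign_quotient[OF F(1)[unfolded Q] star_sign_linear] unfolding Q by simp_all
  have "poly Q 1 = 0" by (rule star_sign_minus_zero(1)[OF sQ(1)])
  then obtain P where P: "Q = ?L * P" by (rule poly_root_factor)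
  have sP: "star_sign 1 P" "degree Q = degree ?L + degree P"
    using star_sign_quotient[OF sQ(1)[unfolded P] star_sign_linear] unfolding P by simp_all
  define m where "m = n - 1"
  have dP: "degree P = 2 * m" and n: "n = Suc m" using sP(2) sQ(2) F(2) by (auto simp: m_def)
  have Fm1: "poly F (- 1) = 4 * poly P (- 1)" unfolding Q P by simp
  have Pm1: "poly P (- 1) \<noteq> 0" using roots(2) Fm1 by auto
  have strip: "realizable F" if h: "irreducible h" "lead_coeff h = 1" "h * h dvd map_poly to_fract F"
    "poly h 1 \<noteq> 0" for h
  proof -
    obtain H K c where H: "h = map_poly to_fract H" "lead_coeff H = 1" "c * poly H 0 = 1"
      "F = (H * smult c (reflect_poly H)) * K" "degree H > 0"
      using square_factor_strip[OF F(1) h(1,2,3)] by blast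
    show ?thesis
    proof (rule realizable_strip[OF IH F H(4,2,3,5)])
      show "separable (map_poly to_fract H)" using irreducible_separable[OF h(1)] unfolding H(1) .
      show "poly H 1 = 0 \<longrightarrow> poly K 1 = 0" using h(4) poly_map_to_fract[of H 1] unfolding H(1) by simp
      show "poly H (- 1) = 0 \<longrightarrow> poly K (- 1) = 0" using roots(2) unfolding H(4) by simp
    qed
  qed
  show ?thesis
  proof (cases "poly P 1 = 0")
    case True
    \<comment> \<open>The constant -1 is the inverse of the value of X - 1 at 0.\<close>
    have "smult (- 1) (reflect_poly ?L) = ?L" by (simp add: reflect_poly_def)
    then have F': "F = (?L * smult (- 1) (reflect_poly ?L)) * P" unfolding Q P by (simp only: mult.assoc)
    show ?thesis
    proof (rule realizable_strip[OF IH F F'])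
      show "separable (map_poly to_fract ?L)" using separable_linear[of "- 1"] by (simp add: map_poly_pCons)
    qed (use True in simp_all)
  next
    case False
    have "reflect_poly P = P" using star_signD(3)[OF sP(1)] by simp
    then interpret self_reciprocal P m
      using star_signD(2)[OF sP(1)] dP False Pm1 by unfold_locales
    have Fq: "map_poly to_fract F = [:- 1, 1:] * K"
      unfolding Q P by (simp only: fract_poly_mult) (simp add: map_poly_pCons del: mult_pCons_left)
    show ?thesis
    proof (cases "separable K")
      case True
      have "v2 (poly F (- 1)) = v2 4 + v2 (poly P (- 1))" unfolding Fm1 by (rule v2_mult) (use Pm1 in auto)
      moreover have "v2 4 = 2" using v2_pow2_times_unit[of 1 2] by simp
      ultimately have "even (v2 (poly P (- 1)))" using F(3) unfolding admissible_def by simp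
      then obtain e u where eu: "u dvd 1" "poly P (- 1) = 4 ^ e * u" using Pm1 even_v2_iff by blast
      have "(- 1) ^ m * u dvd 1" using eu(1) by (cases "even m") auto
      moreover have "(- 1) ^ m * poly P (- 1) = 4 ^ e * ((- 1) ^ m * u)" unfolding eu(2) by (simp only: ac_simps)
      ultimately have "realizable (?L * (?L * P))" by (rule realizable_double_root[OF _ _ True])
      then show ?thesis unfolding Q P .
    next
      case False
      moreover have "K \<noteq> 0" using K_monic(1) by auto
      ultimately obtain h where h: "irreducible h" "lead_coeff h = 1" "h * h dvd K"
        using not_separable_square_factor by blast
      \<comment> \<open>P(1) is nonzero, so X - 1 divides (X - 1) P only once.\<close>
      have "poly h 1 \<noteq> 0"
      proof
        assume "poly h 1 = 0"
        then obtain r where r: "h = [:- 1, 1:] * r" by (metis poly_eq_0_iff_dvd dvdE)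
        obtain k where "K = h * h * k" using h(3) by (elim dvdE)
        then have "[:- 1, 1:] * PQ = [:- 1, 1:] * (r * h * k)" unfolding r by (simp only: ac_simps)
        then have "PQ = r * h * k" unfolding mult_cancel_left by (metis one_neq_zero pCons_eq_0_iff)
        then have "poly PQ 1 = 0" using \<open>poly h 1 = 0\<close> by simp
        then show False using p1_nz by (simp add: p1_def)
      qed
      moreover have "h * h dvd map_poly to_fract F" unfolding Fq using h(3) by (rule dvd_mult)
      ultimately show ?thesis using strip h(1,2) by blast
    qed
  qed
qed

text \<open>Condition (b) makes u w a square, first in the field and then, by integral closedness,
  among the units. Hence w differs from u by the square of a unit, as
  \<open>realizable_no_roots\<close> requires.\<close>

lemma realizable_no_unit_roots:
  assumes F: "star_sign 1 F" "degree F = 2 * n" "n > 0" "admissible n F"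
    and roots: "poly F 1 \<noteq> 0" "poly F (- 1) \<noteq> 0" and sep: "separable (map_poly to_fract F)"
  shows "realizable F"
proof -
  have "reflect_poly F = F" using star_signD(3)[OF F(1)] by simp
  then interpret self_reciprocal F n
    using star_signD(2)[OF F(1)] F(2) roots by unfold_locales
  obtain i u where u: "u dvd 1" "poly F 1 = 4 ^ i * u"
    using F(4) roots(1) even_v2_iff[of "poly F 1"] unfolding admissible_def by auto
  obtain j w0 where w0: "w0 dvd 1" "poly F (- 1) = 4 ^ j * w0"
    using F(4) roots(2) even_v2_iff[of "poly F (- 1)"] unfolding admissible_def by auto
  define w where "w = (- 1) ^ n * w0"
  have w: "w dvd 1" "(- 1) ^ n * poly F (- 1) = 4 ^ j * w"
  proof -
    show "w dvd 1" using w0(1) unfolding w_def by (cases "even n") auto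
    show "(- 1) ^ n * poly F (- 1) = 4 ^ j * w" unfolding w0(2) w_def by (simp only: ac_simps)
  qed
  obtain t where t: "to_fract ((- 1) ^ n * poly F 1 * poly F (- 1)) = t\<^sup>2"
    using F(4) roots unfolding admissible_def by auto
  have "(- 1) ^ n * poly F 1 * poly F (- 1) = poly F 1 * ((- 1) ^ n * poly F (- 1))" by (simp only: ac_simps)
  also have "\<dots> = 4 ^ i * 4 ^ j * (u * w)" unfolding u w by (simp only: ac_simps)
  finally have "t\<^sup>2 = to_fract (4 ^ i * 4 ^ j * (u * w))" using t by (simp only:)
  then have e: "t\<^sup>2 = (4 ^ i * 4 ^ j) * to_fract (u * w)" by simp
  have four: "(4 :: q2) ^ k = 2 ^ k * 2 ^ k" for k
    by (subst power_mult_distrib[symmetric]) simp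
  have sq: "(t / (2 ^ i * 2 ^ j))\<^sup>2 = to_fract (u * w)"
    unfolding power_divide e four by (simp add: power2_eq_square)
  have "t / (2 ^ i * 2 ^ j) \<in> O2" by (rule O2_square_root) (simp add: sq del: to_fract_mult)
  then obtain s where "t / (2 ^ i * 2 ^ j) = to_fract s" by (rule O2_E)
  with sq have "(to_fract s)\<^sup>2 = to_fract (u * w)" by (simp only:)
  then have "to_fract (s\<^sup>2) = to_fract (u * w)" by simp
  then have s: "s\<^sup>2 = u * w" unfolding to_fract_eq_iff .
  have "s\<^sup>2 dvd 1" unfolding s using u(1) w(1) by (simp add: is_unit_mult_iff)
  then have su: "s dvd 1" by (simp add: power2_eq_square is_unit_mult_iff)
  obtain u' where u': "1 = u * u'" using u(1) by (elim dvdE)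
  have "(s * u')\<^sup>2 * u = s\<^sup>2 * u' * (u * u')" by (simp add: power2_eq_square ac_simps)
  also have "\<dots> = w * (u * u')" unfolding s u'[symmetric] using u' by (simp add: ac_simps)
  finally have "w = (s * u')\<^sup>2 * u" unfolding u'[symmetric] by simp
  moreover have "s * u' dvd 1" using su u' by (metis dvd_triv_right is_unit_mult_iff)
  ultimately show ?thesis by (intro realizable_no_roots[OF F(3) u w _ _ sep])
qed

lemma realizable_if_admissible:
  "star_sign \<sigma> F \<Longrightarrow> degree F = 2 * n \<Longrightarrow> admissible n F \<Longrightarrow> realizable F"
proof (induction n arbitrary: F \<sigma> rule: less_induct)
  case (less n)
  note F = less.prems and s = star_signD[OF less.prems(1)]
  have IH: "\<forall>K k \<tau>. k < n \<longrightarrow> star_sign \<tau> K \<longrightarrow> degree K = 2 * k \<longrightarrow> admissible k K \<longrightarrow> realizable K"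
    using less.IH by blast
  have Fq0: "map_poly to_fract F \<noteq> 0" using s(4) by simp
  consider "n = 0" | "n > 0" "\<sigma> = - 1" | "n > 0" "\<sigma> = 1" "poly F 1 = 0" "poly F (- 1) = 0"
    | "n > 0" "\<sigma> = 1" "poly F 1 = 0" "poly F (- 1) \<noteq> 0"
    | "n > 0" "\<sigma> = 1" "poly F 1 \<noteq> 0" "poly F (- 1) = 0"
    | "n > 0" "\<sigma> = 1" "poly F 1 \<noteq> 0" "poly F (- 1) \<noteq> 0"
    using F(1) unfolding star_sign_def by blast
  then show ?case
  proof cases
    case 1
    then have "F = 1" using monic_degree_0[OF s(2)] F(2) by simp
    then show ?thesis using realizable_one by simp
  next
    case 2
    show ?thesis
    proof (cases "separable (map_poly to_fract F)")
      case True
      interpret toeplitz F n using toeplitz_star_sign F(1,2) 2 by simp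
      show ?thesis by (rule realizable_separable[OF True])
    next
      case False
      then obtain h where h: "irreducible h" "lead_coeff h = 1" "h * h dvd map_poly to_fract F"
        using not_separable_square_factor[OF Fq0] by blast
      obtain H K c where H: "h = map_poly to_fract H" "lead_coeff H = 1" "c * poly H 0 = 1"
        "F = (H * smult c (reflect_poly H)) * K" "degree H > 0"
        using square_factor_strip[OF F(1) h] by blast
      have hyp: "star_sign 1 (H * smult c (reflect_poly H))" by (rule star_sign_hyperbolic(1)[OF H(2,3)])
      have K: "star_sign (- 1) K" "degree F = degree (H * smult c (reflect_poly H)) + degree K"
        using star_sign_quotient[OF F(1)[unfolded H(4)] hyp] 2(2) unfolding H(4) by simp_all
      have "degree (H * smult c (reflect_poly H)) = 2 * degree H"
      proof -
        have "H \<noteq> 0" "smult c (reflect_poly H) \<noteq> 0" using star_signD(4)[OF hyp] by auto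
        from degree_mult_eq[OF this] show ?thesis unfolding star_sign_hyperbolic(2)[OF H(2,3)] mult_2 .
      qed
      \<comment> \<open>The cofactor has sign -1 and even degree, so it vanishes at 1 and -1 and
        both guards hold.\<close>
      then have "even (degree K)" using K(2) F(2) by (metis dvd_add_right_iff dvd_triv_left)
      then have "poly K 1 = 0" "poly K (- 1) = 0" using star_sign_minus_zero[OF K(1)] by blast+
      then show ?thesis
        by (intro realizable_strip[OF IH F H(4,2,3,5)] irreducible_separable[OF h(1), unfolded H(1)] impI)
    qed
  next
    case 3
    obtain Q where Q: "F = [:- 1, 1:] * Q" using 3(3) by (rule poly_root_factor)
    have "poly Q (- 1) = 0" using 3(4) unfolding Q by simp
    then obtain K where K: "Q = [:1, 1:] * K" using poly_root_factor[of Q "- 1"] by auto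
    \<comment> \<open>Splitting off X^2 - 1 leaves a cofactor of sign -1, for which (a) and (b) are
      vacuous.\<close>
    have FK: "F = [:- 1, 0, 1:] * K"
    proof -
      have "F = ([:- 1, 1:] * [:1, 1:]) * K" unfolding Q K by (simp only: mult.assoc)
      also have "[:- 1, 1:] * [:1, 1:] = [:- 1, 0, 1 :: z2:]" by simp
      finally show ?thesis .
    qed
    have sK: "star_sign (- 1) K" "degree F = degree [:- 1, 0, 1 :: z2:] + degree K"
      using star_sign_quotient[OF F(1)[unfolded FK] realizable_X2_minus_1(2)] 3(2) unfolding FK by simp_all
    then have dK: "degree K = 2 * (n - 1)" using F(2) by simp
    then have "poly K 1 = 0" "poly K (- 1) = 0" using star_sign_minus_zero[OF sK(1)] by simp_all
    then have "admissible (n - 1) K" unfolding admissible_def by (simp add: v2_def)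
    then have "realizable K" using IH[rule_format, OF _ sK(1) dK] 3(1) by simp
    then show ?thesis unfolding FK by (rule realizable_mult[OF realizable_X2_minus_1(1)])
  next
    case 4
    show ?thesis by (rule realizable_root_1[OF IH]) (use F 4 in auto)
  next
    case 5
    \<comment> \<open>The substitution of -X for X moves the root -1 to 1.\<close>
    let ?F = "F \<circ>\<^sub>p [:0, - 1:]"
    have ev: "poly ?F 1 = poly F (- 1)" "poly ?F (- 1) = poly F 1" by (simp_all add: poly_pcompose)
    have co: "coeff ?F i = (- 1) ^ i * coeff F i" for i by (simp add: coeff_pcompose_linear)
    have dF: "degree ?F = 2 * n" using F(2) by simp
    have "star_sign 1 ?F" unfolding star_sign_def
    proof (intro conjI)
      show "lead_coeff ?F = 1" using s(2) F(2) unfolding dF co by simp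
      have r: "coeff (reflect_poly F) i = coeff F i" for i using s(3) 5(2) by simp
      show "reflect_poly ?F = smult 1 ?F"
      proof (rule poly_eqI)
        fix i
        show "coeff (reflect_poly ?F) i = coeff (smult 1 ?F) i"
        proof (cases "i \<le> 2 * n")
          case True
          have "(- 1 :: z2) ^ (2 * n - i) = (- 1) ^ i"
            using True by (auto simp: minus_one_power_iff)
          then show ?thesis using True r[of i] F(2) by (simp add: coeff_reflect_poly co)
        next
          case False
          then show ?thesis using F(2) by (simp add: coeff_reflect_poly coeff_eq_0)
        qed
      qed
    qed simp
    moreover have "admissible n ?F" using F(3) unfolding admissible_def ev by (simp add: ac_simps)
    moreover have "poly ?F 1 = 0" "poly ?F (- 1) \<noteq> 0" unfolding ev by (fact 5(4), fact 5(3))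
    ultimately have "realizable ?F" using realizable_root_1[OF IH _ dF] by blast
    then have "realizable (?F \<circ>\<^sub>p [:0, - 1:])" by (rule realizable_reflect_sign)
    moreover have "?F \<circ>\<^sub>p [:0, - 1:] = F" by (simp flip: pcompose_assoc add: pcompose_pCons)
    ultimately show ?thesis by simp
  next
    case 6
    show ?thesis
    proof (cases "separable (map_poly to_fract F)")
      case True
      show ?thesis by (rule realizable_no_unit_roots[of F n]) (use F 6 True in auto)
    next
      case False
      then obtain h where h: "irreducible h" "lead_coeff h = 1" "h * h dvd map_poly to_fract F"
        using not_separable_square_factor[OF Fq0] by blast
      obtain H K c where H: "h = map_poly to_fract H" "lead_coeff H = 1" "c * poly H 0 = 1"
        "F = (H * smult c (reflect_poly H)) * K" "degree H > 0"
        using square_factor_strip[OF F(1) h] by blast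
      have "poly H 1 \<noteq> 0" "poly H (- 1) \<noteq> 0" using 6(3,4) unfolding H(4) by simp_all
      then have "poly H 1 = 0 \<longrightarrow> poly K 1 = 0" "poly H (- 1) = 0 \<longrightarrow> poly K (- 1) = 0" by simp_all
      then show ?thesis
        by (rule realizable_strip[OF IH F H(4,2,3,5) irreducible_separable[OF h(1), unfolded H(1)]])
    qed
  qed
qed

text \<open>Comparing constant coefficients in the symmetry gives F(0)^2 = 1.\<close>

lemma star_symmetric_sign:
  assumes "star_symmetric (map_poly to_fract F)"
  shows "star_sign (poly F 0) F"
proof -
  let ?F = "map_poly to_fract F"
  have p0: "poly ?F 0 = to_fract (poly F 0)" using poly_map_to_fract[of F 0] by simp
  have l: "lead_coeff ?F = 1" and nz: "poly F 0 \<noteq> 0"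
    and e: "?F = smult (inverse (to_fract (poly F 0))) (reflect_poly ?F)"
    using assms unfolding star_symmetric_def p0 by auto
  have lF: "lead_coeff F = 1" using l lead_coeff_fract_poly[of F] by (metis to_fract_1 to_fract_eq_iff)
  have "smult (to_fract (poly F 0)) ?F = reflect_poly ?F"
    using nz by (subst e) simp
  also have "reflect_poly ?F = map_poly to_fract (reflect_poly F)"
    by (intro poly_eqI) (auto simp: coeff_reflect_poly)
  finally have "map_poly to_fract (smult (poly F 0) F) = map_poly to_fract (reflect_poly F)" by simp
  then have r: "reflect_poly F = smult (poly F 0) F" unfolding fract_poly_eq_iff ..
  have "coeff (reflect_poly F) 0 = 1" using lF by (simp add: coeff_reflect_poly)
  then have "(poly F 0)\<^sup>2 = 1" unfolding r by (simp add: poly_0_coeff_0 power2_eq_square)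
  then have "poly F 0 = 1 \<or> poly F 0 = - 1" by (simp add: power2_eq_1_iff)
  then show ?thesis unfolding star_sign_def using lF r by blast
qed

theorem theorem4p2:
  fixes F :: "z2 poly" and n :: nat
  assumes "star_symmetric (map_poly to_fract F)"
    and "degree F = 2 * n"
  shows "(\<exists>d b T. z2_lattice d b \<and> even_lattice d b \<and> unimodular d b \<and>
            same_square_class (disc d b) 1 \<and>
            isometry d b T \<and> semisimple T \<and> char_poly T = F)
    \<longleftrightarrow>
      (even (v2 (poly F 1)) \<and> even (v2 (poly F (- 1)))) \<and>
      (poly F 1 * poly F (- 1) \<noteq> 0 \<longrightarrow>
         same_square_class (to_fract ((- 1) ^ n * poly F 1 * poly F (- 1))) 1)"
  (is "?L \<longleftrightarrow> ?R")
proof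
  assume ?L
  then show ?R using necessity[OF _ _ _ _ _ _ assms(2,1)] by blast
next
  assume ?R
  then have "admissible n F" unfolding admissible_def same_square_class_def by auto
  then show ?L
    by (intro realizable_imp_lattice realizable_if_admissible[OF star_symmetric_sign[OF assms(1)] assms(2)])
qed

end
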